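(* Let $U:\mathbb{R}^d\to\mathbb{R}$ be of class $C^\infty$ and let $X\in\Lambda_d^g$ (good diffusion process with smooth gradient drift and constant scalar diffusion coefficient $\sigma$) satisfy $\mathcal{D}^2X(t)=-\nabla U(X(t))$. Assume that $K=\sigma^2$. Then the wave function $\Psi=e^{(R+iS)/K}$ of $X$ satisfies on $\Theta$ the linear Schrödinger equation $$i\sigma^2\,\partial_t\Psi+\frac{\sigma^4}{2}\Delta\Psi=U\Psi .$$ Moreover, if $p_t(x)$ is the density of $X(t)$ at the point $x$, then $$(\Psi\overline{\Psi})(t,x)=p_t(x).$$
   Context: $\Lambda_d$ (good diffusion processes), time set $[0,1]$: $\mathbb{R}^d$-valued processes $X$ such that (i) $X$ solves $dX(t)=b(t,X(t))dt+\sigma(t,X(t))dW(t)$, $X(0)=X_0\in L^2(\Omega)$, $W$ a $d$-dimensional Brownian motion, with $b,\sigma$ Borel measurable and, for some constant $C$ and all $x,y$, $\sup_t(|\sigma(t,x)-\sigma(t,y)|+|b(t,x)-b(t,y)|)\le C|x-y|$ and $\sup_t(|\sigma(t,x)|+|b(t,x)|)\le C(1+|x|)$; (ii) for each $t>0$, $X(t)$ has a density $p_t(x)$; (iii) with $a=\sigma\sigma^*$ (sum over repeated index $j$), for all $i$, all $t_0>0$ and all bounded open $B\subset\mathbb{R}^d$, $\int_{t_0}^1\int_B|\partial_j(a_{ij}(t,x)p_t(x))|dxdt<\infty$; (iv) $b$ and $(t,x)\mapsto\frac{1}{p_t(x)}\partial_j(a_{ij}(t,x)p_t(x))$ are continuous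 and bounded. In the claim $\sigma(t,x)=\sigma\,\mathrm{Id}$ with $\sigma$ a constant. $\Lambda_d^g\subset\Lambda_d$ is the subset of processes whose drift $b$ is a smooth gradient. $DX(t)=\lim_{h\to0^+}E[\frac{X(t+h)-X(t)}{h}\mid\mathcal{P}_t]$ and $D_*X(t)=\lim_{h\to0^+}E[\frac{X(t)-X(t-h)}{h}\mid\mathcal{F}_t]$ (limits in $L^1(\Omega)$) are Nelson's forward and backward derivatives, with respect to an increasing filtration $(\mathcal{P}_t)$ and a decreasing filtration $(\mathcal{F}_t)$ for which $X$ is a Markov diffusion. The stochastic derivative is $\mathcal{D}=\frac{D+D_*}{2}+i\frac{D-D_*}{2}$, extended $\mathbb{C}$-linearly to complex processes, and $\mathcal{D}^2=\mathcal{D}\circ\mathcal{D}$. $\Theta$ is the set of $(t,x)$ with $t>0$ (in the time interval), $x\in\mathbb{R}^d$ and $p_t(x)\neq0$. For $X\in\Lambda_d^g$ there exist real valued functions $R,S$, smooth on $\Theta$, such that $\mathcal{D}X(t)=\left(b-\frac{\sigma^2}{2}\nabla\log p_t+i\frac{\sigma^2}{2}\nabla\log p_t\right)(t,X(t))=(\nabla S+i\nabla R)(t,X(t))$, with $R(t,x)=\frac{\sigma^2}{2}\log p_t(x)$. The wave function of $X$, for a positive constant $K$, is $\Psi(t,x)=e^{(R(t,x)+iS(t,x))/K}$.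
   Formalization: S is determined by its spatial gradient only up to a function of time, and for arbitrary S the Schrödinger equation fails (replace S by S+t); it is proved after adding a suitable smooth c(t) to S, while the density identity holds for every S. *)

theory Defs
  imports "HOL-Probability.Probability"
begin

text \<open>On open sets \<open>Ck_on\<close> is the usual class C^k; it is only used there.\<close>

primrec Ck_on :: "nat \<Rightarrow> 'a::euclidean_space set \<Rightarrow> ('a \<Rightarrow> 'b::real_normed_vector) \<Rightarrow> bool" where
  "Ck_on 0 A f \<longleftrightarrow> continuous_on A f"
| "Ck_on (Suc k) A f \<longleftrightarrow>
     (\<forall>x\<in>A. f differentiable (at x)) \<and> (\<forall>v. Ck_on k A (\<lambda>x. frechet_derivative f (at x) v))"

text \<open>
  Smoothness on an arbitrary set: locally the restriction of a smooth function on an open set.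
  This is needed because the time interval contains its end point, so that a subset of
  [0,1] x R^d is in general only relatively open.
\<close>

definition smooth_on :: "'a::euclidean_space set \<Rightarrow> ('a \<Rightarrow> 'b::real_normed_vector) \<Rightarrow> bool" where
  "smooth_on A f \<longleftrightarrow>
     (\<forall>a\<in>A. \<exists>N g. open N \<and> a \<in> N \<and> (\<forall>k. Ck_on k N g) \<and> (\<forall>x\<in>A \<inter> N. f x = g x))"

definition pderiv_at :: "'n::finite \<Rightarrow> (real ^ 'n \<Rightarrow> 'b::real_normed_vector) \<Rightarrow> real ^ 'n \<Rightarrow> 'b" where
  "pderiv_at i f x = vector_derivative (\<lambda>s. f (x + s *\<^sub>R axis i 1)) (at 0)"

definition grad :: "(real ^ 'n::finite \<Rightarrow> real) \<Rightarrow> real ^ 'n \<Rightarrow> real ^ 'n" where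
  "grad f x = (\<chi> i. pderiv_at i f x)"

definition laplacian :: "(real ^ 'n::finite \<Rightarrow> 'b::real_normed_vector) \<Rightarrow> real ^ 'n \<Rightarrow> 'b" where
  "laplacian f x = (\<Sum>i\<in>UNIV. pderiv_at i (pderiv_at i f) x)"

text \<open>The vector with components \<open>\<partial>\<^sub>j (a\<^sub>i\<^sub>j q)\<close>, summed over \<open>j\<close>.\<close>

definition div_matrix :: "real ^ 'n ^ 'n::finite \<Rightarrow> (real ^ 'n \<Rightarrow> real) \<Rightarrow> real ^ 'n \<Rightarrow> real ^ 'n" where
  "div_matrix a q x = (\<chi> i. \<Sum>j\<in>UNIV. pderiv_at j (\<lambda>y. a $ i $ j * q y) x)"

text \<open>A filtration is indexed by the time interval [0,1]; values at other times are irrelevant.\<close>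

definition increasing_filtration :: "'w measure \<Rightarrow> (real \<Rightarrow> 'w measure) \<Rightarrow> bool" where
  "increasing_filtration M P \<longleftrightarrow>
     (\<forall>t\<in>{0..1}. subalgebra M (P t)) \<and>
     (\<forall>s\<in>{0..1}. \<forall>t\<in>{0..1}. s \<le> t \<longrightarrow> sets (P s) \<subseteq> sets (P t))"

definition decreasing_filtration :: "'w measure \<Rightarrow> (real \<Rightarrow> 'w measure) \<Rightarrow> bool" where
  "decreasing_filtration M F \<longleftrightarrow>
     (\<forall>t\<in>{0..1}. subalgebra M (F t)) \<and>
     (\<forall>s\<in>{0..1}. \<forall>t\<in>{0..1}. s \<le> t \<longrightarrow> sets (F t) \<subseteq> sets (F s))"

definition adapted :: "(real \<Rightarrow> 'w measure) \<Rightarrow> (real \<Rightarrow> 'w \<Rightarrow> real ^ 'n::finite) \<Rightarrow> bool" where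
  "adapted G X \<longleftrightarrow> (\<forall>t\<in>{0..1}. X t \<in> borel_measurable (G t))"

definition markov_at ::
  "'w measure \<Rightarrow> (real \<Rightarrow> 'w measure) \<Rightarrow> (real \<Rightarrow> 'w \<Rightarrow> real ^ 'n::finite) \<Rightarrow> real \<Rightarrow> real \<Rightarrow> bool" where
  "markov_at M G X s t \<longleftrightarrow>
     (\<forall>f :: real ^ 'n \<Rightarrow> real. f \<in> borel_measurable borel \<longrightarrow> bounded (range f) \<longrightarrow>
        (AE w in M. real_cond_exp M (G s) (\<lambda>w. f (X t w)) w =
                    real_cond_exp M (vimage_algebra (space M) (X s) borel) (\<lambda>w. f (X t w)) w))"

definition forward_markov ::
  "'w measure \<Rightarrow> (real \<Rightarrow> 'w measure) \<Rightarrow> (real \<Rightarrow> 'w \<Rightarrow> real ^ 'n::finite) \<Rightarrow> bool" where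
  "forward_markov M P X \<longleftrightarrow>
     adapted P X \<and> (\<forall>s\<in>{0..1}. \<forall>t\<in>{0..1}. s \<le> t \<longrightarrow> markov_at M P X s t)"

definition backward_markov ::
  "'w measure \<Rightarrow> (real \<Rightarrow> 'w measure) \<Rightarrow> (real \<Rightarrow> 'w \<Rightarrow> real ^ 'n::finite) \<Rightarrow> bool" where
  "backward_markov M F X \<longleftrightarrow>
     adapted F X \<and> (\<forall>s\<in>{0..1}. \<forall>t\<in>{0..1}. t \<le> s \<longrightarrow> markov_at M F X s t)"

definition brownian_motion ::
  "'w measure \<Rightarrow> (real \<Rightarrow> 'w measure) \<Rightarrow> (real \<Rightarrow> 'w \<Rightarrow> real ^ 'n::finite) \<Rightarrow> bool" where
  "brownian_motion M P W \<longleftrightarrow>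
     adapted P W \<and>
     (AE w in M. W 0 w = 0 \<and> continuous_on {0..1} (\<lambda>t. W t w)) \<and>
     (\<forall>s t. 0 \<le> s \<longrightarrow> s < t \<longrightarrow> t \<le> 1 \<longrightarrow>
        distributed M lborel (\<lambda>w. W t w - W s w)
          (\<lambda>x. ennreal (\<Prod>i\<in>UNIV. normal_density 0 (sqrt (t - s)) (x $ i))) \<and>
        prob_space.indep_set M (sets (P s))
          (sets (vimage_algebra (space M) (\<lambda>w. W t w - W s w) borel)))"

definition Theta :: "(real \<Rightarrow> real ^ 'n::finite \<Rightarrow> real) \<Rightarrow> (real \<times> (real ^ 'n)) set" where
  "Theta p = {(t, x). 0 < t \<and> t \<le> 1 \<and> p t x \<noteq> 0}"

text \<open>
  The stochastic integral of the constant matrix \<open>\<sigma> Id\<close> over [0,t] is \<open>\<sigma> W(t)\<close>,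
  and the Lipschitz and growth conditions on it are void.
\<close>

definition solves_sde ::
  "'w measure \<Rightarrow> (real \<Rightarrow> 'w measure) \<Rightarrow> real \<Rightarrow> (real \<Rightarrow> real ^ 'n \<Rightarrow> real ^ 'n) \<Rightarrow>
   (real \<Rightarrow> 'w \<Rightarrow> real ^ 'n::finite) \<Rightarrow> bool" where
  "solves_sde M P \<sigma> b X \<longleftrightarrow>
     (\<exists>W. brownian_motion M P W \<and>
        (AE w in M. continuous_on {0..1} (\<lambda>t. X t w) \<and>
           (\<forall>t\<in>{0..1}. X t w = X 0 w + (LINT s:{0..t}|lborel. b s (X s w)) + \<sigma> *\<^sub>R W t w)))"

text \<open>
  The density \<open>p t\<close> is the version that is differentiable in space, so that the derivatives
  \<open>\<partial>\<^sub>j (a\<^sub>i\<^sub>j p\<^sub>t)\<close> are functions; their quotient by \<open>p\<^sub>t\<close> is considered where \<open>p\<^sub>t\<close> does not vanish.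
  The matrix \<open>mat \<sigma>\<close> is \<open>\<sigma> Id\<close>.
\<close>

definition good_diffusion ::
  "'w measure \<Rightarrow> (real \<Rightarrow> 'w measure) \<Rightarrow> (real \<Rightarrow> 'w measure) \<Rightarrow> real \<Rightarrow>
   (real \<Rightarrow> real ^ 'n \<Rightarrow> real ^ 'n) \<Rightarrow> (real \<Rightarrow> real ^ 'n \<Rightarrow> real) \<Rightarrow>
   (real \<Rightarrow> 'w \<Rightarrow> real ^ 'n::finite) \<Rightarrow> bool" where
  "good_diffusion M P F \<sigma> b p X \<longleftrightarrow>
     prob_space M \<and>
     increasing_filtration M P \<and> forward_markov M P X \<and>
     decreasing_filtration M F \<and> backward_markov M F X \<and>
     integrable M (\<lambda>w. (norm (X 0 w))\<^sup>2) \<and>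
     solves_sde M P \<sigma> b X \<and>
     set_borel_measurable borel ({0..1} \<times> UNIV) (\<lambda>(t, x). b t x) \<and>
     (\<exists>C. \<forall>t\<in>{0..1}. \<forall>x y. norm (b t x - b t y) \<le> C * norm (x - y) \<and>
                           norm (b t x) \<le> C * (1 + norm x)) \<and>
     (\<forall>t\<in>{0<..1}. (\<forall>x. 0 \<le> p t x) \<and> distributed M lborel (X t) (\<lambda>x. ennreal (p t x)) \<and>
                   p t differentiable_on UNIV) \<and>
     (\<forall>i t0 B. 0 < t0 \<longrightarrow> t0 \<le> 1 \<longrightarrow> open B \<longrightarrow> bounded B \<longrightarrow>
        set_integrable lborel ({t0..1} \<times> B)
          (\<lambda>(t, x). div_matrix (mat \<sigma> ** transpose (mat \<sigma>)) (p t) x $ i)) \<and>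
     continuous_on ({0..1} \<times> UNIV) (\<lambda>(t, x). b t x) \<and>
     bounded ((\<lambda>(t, x). b t x) ` ({0..1} \<times> UNIV)) \<and>
     continuous_on (Theta p)
       (\<lambda>(t, x). (1 / p t x) *\<^sub>R div_matrix (mat \<sigma> ** transpose (mat \<sigma>)) (p t) x) \<and>
     bounded
       ((\<lambda>(t, x). (1 / p t x) *\<^sub>R div_matrix (mat \<sigma> ** transpose (mat \<sigma>)) (p t) x) ` Theta p)"

definition good_gradient_diffusion ::
  "'w measure \<Rightarrow> (real \<Rightarrow> 'w measure) \<Rightarrow> (real \<Rightarrow> 'w measure) \<Rightarrow> real \<Rightarrow>
   (real \<Rightarrow> real ^ 'n \<Rightarrow> real ^ 'n) \<Rightarrow> (real \<Rightarrow> real ^ 'n \<Rightarrow> real) \<Rightarrow>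
   (real \<Rightarrow> 'w \<Rightarrow> real ^ 'n::finite) \<Rightarrow> bool" where
  "good_gradient_diffusion M P F \<sigma> b p X \<longleftrightarrow>
     good_diffusion M P F \<sigma> b p X \<and>
     (\<exists>\<beta> :: real \<Rightarrow> real ^ 'n \<Rightarrow> real. smooth_on ({0..1} \<times> UNIV) (\<lambda>(t, x). \<beta> t x) \<and>
        (\<forall>t\<in>{0..1}. \<forall>x. b t x = grad (\<beta> t) x))"

definition vec_cond_exp ::
  "'w measure \<Rightarrow> 'w measure \<Rightarrow> ('w \<Rightarrow> real ^ 'n::finite) \<Rightarrow> 'w \<Rightarrow> real ^ 'n" where
  "vec_cond_exp M G Y w = (\<chi> i. real_cond_exp M G (\<lambda>w. Y w $ i) w)"

text \<open>The derivatives are limits in L^1, hence determined only almost surely.\<close>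

definition has_forward_deriv ::
  "'w measure \<Rightarrow> (real \<Rightarrow> 'w measure) \<Rightarrow> (real \<Rightarrow> 'w \<Rightarrow> real ^ 'n::finite) \<Rightarrow> real \<Rightarrow>
   ('w \<Rightarrow> real ^ 'n) \<Rightarrow> bool" where
  "has_forward_deriv M P Y t Z \<longleftrightarrow>
     integrable M Z \<and>
     (\<forall>\<^sub>F h in at_right 0. integrable M (\<lambda>w. Y (t + h) w - Y t w)) \<and>
     ((\<lambda>h. LINT w|M. norm (vec_cond_exp M (P t) (\<lambda>w. (Y (t + h) w - Y t w) /\<^sub>R h) w - Z w))
        \<longlongrightarrow> 0) (at_right 0)"

definition has_backward_deriv ::
  "'w measure \<Rightarrow> (real \<Rightarrow> 'w measure) \<Rightarrow> (real \<Rightarrow> 'w \<Rightarrow> real ^ 'n::finite) \<Rightarrow> real \<Rightarrow>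
   ('w \<Rightarrow> real ^ 'n) \<Rightarrow> bool" where
  "has_backward_deriv M F Y t Z \<longleftrightarrow>
     integrable M Z \<and>
     (\<forall>\<^sub>F h in at_right 0. integrable M (\<lambda>w. Y t w - Y (t - h) w)) \<and>
     ((\<lambda>h. LINT w|M. norm (vec_cond_exp M (F t) (\<lambda>w. (Y t w - Y (t - h) w) /\<^sub>R h) w - Z w))
        \<longlongrightarrow> 0) (at_right 0)"

definition Complex_vec :: "real ^ 'n::finite \<Rightarrow> real ^ 'n \<Rightarrow> complex ^ 'n" where
  "Complex_vec u v = (\<chi> i. Complex (u $ i) (v $ i))"

definition Re_vec :: "complex ^ 'n::finite \<Rightarrow> real ^ 'n" where
  "Re_vec z = (\<chi> i. Re (z $ i))"

definition Im_vec :: "complex ^ 'n::finite \<Rightarrow> real ^ 'n" where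
  "Im_vec z = (\<chi> i. Im (z $ i))"

text \<open>
  For a complex process V = Y + iZ the derivative is the one of Y plus i times the one of Z.
  Here (dY, bY) and (dZ, bZ) are the forward and backward derivatives of Y and Z.
\<close>

definition has_stoch_deriv ::
  "'w measure \<Rightarrow> (real \<Rightarrow> 'w measure) \<Rightarrow> (real \<Rightarrow> 'w measure) \<Rightarrow>
   (real \<Rightarrow> 'w \<Rightarrow> complex ^ 'n::finite) \<Rightarrow> real \<Rightarrow> ('w \<Rightarrow> complex ^ 'n) \<Rightarrow> bool" where
  "has_stoch_deriv M P F V t D \<longleftrightarrow>
     (\<exists>dY bY dZ bZ.
        has_forward_deriv M P (\<lambda>s w. Re_vec (V s w)) t dY \<and>
        has_backward_deriv M F (\<lambda>s w. Re_vec (V s w)) t bY \<and>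
        has_forward_deriv M P (\<lambda>s w. Im_vec (V s w)) t dZ \<and>
        has_backward_deriv M F (\<lambda>s w. Im_vec (V s w)) t bZ \<and>
        (AE w in M. D w =
           Complex_vec ((dY w + bY w) /\<^sub>R 2) ((dY w - bY w) /\<^sub>R 2) +
           \<i> *s Complex_vec ((dZ w + bZ w) /\<^sub>R 2) ((dZ w - bZ w) /\<^sub>R 2)))"

definition has_second_stoch_deriv ::
  "'w measure \<Rightarrow> (real \<Rightarrow> 'w measure) \<Rightarrow> (real \<Rightarrow> 'w measure) \<Rightarrow>
   (real \<Rightarrow> 'w \<Rightarrow> real ^ 'n::finite) \<Rightarrow> (real \<Rightarrow> 'w \<Rightarrow> complex ^ 'n) \<Rightarrow> bool" where
  "has_second_stoch_deriv M P F X A \<longleftrightarrow>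
     (\<exists>V. \<forall>t\<in>{0<..<1}.
        has_stoch_deriv M P F (\<lambda>s w. Complex_vec (X s w) 0) t (V t) \<and>
        has_stoch_deriv M P F V t (A t))"

text \<open>
  The real functions R, S attached to a process; R is determined on Theta by the density,
  while S is only determined up to the addition of a function of time.
\<close>

definition wave_potentials ::
  "'w measure \<Rightarrow> (real \<Rightarrow> 'w measure) \<Rightarrow> (real \<Rightarrow> 'w measure) \<Rightarrow> real \<Rightarrow>
   (real \<Rightarrow> real ^ 'n \<Rightarrow> real) \<Rightarrow> (real \<Rightarrow> 'w \<Rightarrow> real ^ 'n::finite) \<Rightarrow>
   (real \<Rightarrow> real ^ 'n \<Rightarrow> real) \<Rightarrow> (real \<Rightarrow> real ^ 'n \<Rightarrow> real) \<Rightarrow> bool" where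
  "wave_potentials M P F \<sigma> p X R S \<longleftrightarrow>
     smooth_on (Theta p) (\<lambda>(t, x). R t x) \<and>
     smooth_on (Theta p) (\<lambda>(t, x). S t x) \<and>
     (\<forall>(t, x)\<in>Theta p. R t x = \<sigma>\<^sup>2 / 2 * ln (p t x)) \<and>
     (\<forall>t\<in>{0<..<1}. has_stoch_deriv M P F (\<lambda>s w. Complex_vec (X s w) 0) t
        (\<lambda>w. Complex_vec (grad (S t) (X t w)) (grad (R t) (X t w))))"

definition wave_function ::
  "real \<Rightarrow> (real \<Rightarrow> real ^ 'n::finite \<Rightarrow> real) \<Rightarrow> (real \<Rightarrow> real ^ 'n \<Rightarrow> real) \<Rightarrow>
   real \<Rightarrow> real ^ 'n \<Rightarrow> complex" where
  "wave_function K R S t x = exp ((of_real (R t x) + \<i> * of_real (S t x)) / of_real K)"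

text \<open>The time derivative is one-sided at the end point t = 1.\<close>

definition schrodinger_at ::
  "real \<Rightarrow> (real ^ 'n::finite \<Rightarrow> real) \<Rightarrow> (real \<Rightarrow> real ^ 'n \<Rightarrow> complex) \<Rightarrow>
   real \<Rightarrow> real ^ 'n \<Rightarrow> bool" where
  "schrodinger_at \<sigma> U \<Psi> t x \<longleftrightarrow>
     \<i> * of_real (\<sigma>\<^sup>2) * vector_derivative (\<lambda>s. \<Psi> s x) (at t within {0<..1})
       + of_real (\<sigma> ^ 4 / 2) * laplacian (\<Psi> t) x
     = of_real (U x) * \<Psi> t x"

end

(*
The SDE has additive noise, so Taylor's formula along the increments replaces Ito calculus. It shows
that, tested against functions of X(t), the forward and backward derivatives of a bounded smooth
f(t, X(t)) are

  d_t f + b.grad f + (sigma^2/2) Lap f   and   d_t f + b_*.grad f - (sigma^2/2) Lap f,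

where b_* = b - sigma^2 grad log p. The backward formula uses no time reversal: it follows from
E[g(X_t) f_t(X_t)] = int g f_t p_t, the expansion of the increment of the test function g, and
integration by parts. For f = 1 it is the continuity equation.

As b = grad S + grad R, the stochastic Newton equation becomes grad (G + U) = 0 with
G = d_t S + |grad S|^2/2 - |grad R|^2/2 - (sigma^2/2) Lap R, so G + U depends on time only and is absorbed
into S by the antiderivative c. Together with the continuity equation this is the Schroedinger
equation, split into real and imaginary parts, for 0 < t < 1; it extends to t = 1 by continuity of
the local smooth extensions of R and S.

Boundedness of grad log p forces p_t > 0 everywhere, hence Theta is all of (0,1] x R^d.
*)

theory Submission
  imports Defs "HOL-Real_Asymp.Real_Asymp"
begin

section \<open>Directional derivatives and classes C^k\<close>

text \<open>Nelson's derivatives are L^1 limits of conditional expectations. A weight g(X(t)) is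
  measurable for both filtrations at time t, so multiplying by it removes the conditioning and
  leaves limits of plain expectations; since p_t is continuous and positive, an identity tested
  against all such g holds pointwise. The obstacle is the backward quotient: g(X(t)) depends on the
  noise between t - h and t, so independence does not apply to it. Shifting the increment from f to
  g leaves the weight f(t - h, X(t - h)), which belongs to the past. Expanding to first order in
  time and second order in space is just enough, because increments have size sqrt h. Hence test
  functions of class C^3 suffice, and a polynomial bump can serve. The complex structure pairs the
  derivatives: twice the real part of the stochastic derivative of Y + iZ is D(Y - Z) + D_*(Y + Z).
  For Y + iZ = grad S + i grad R the arguments are b_* and b. K = sigma^2 is forced twice: |Psi|^2 =
  exp(2R/K) has to be p, and the K/2 before the second derivatives of the exponent has to match the
  sigma^2/2 of the generators.\<close>

definition dd :: "'a::euclidean_space \<Rightarrow> ('a \<Rightarrow> 'b::real_normed_vector) \<Rightarrow> 'a \<Rightarrow> 'b" where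
  "dd v f x = frechet_derivative f (at x) v"

lemma Ck_on_Suc_dd:
  "Ck_on (Suc k) A f \<longleftrightarrow> (\<forall>x\<in>A. f differentiable (at x)) \<and> (\<forall>v. Ck_on k A (dd v f))"
  by (simp add: dd_def[abs_def])

declare Ck_on.simps(2) [simp del]

lemma has_derivative_dd: "f differentiable (at x) \<Longrightarrow> (f has_derivative (\<lambda>v. dd v f x)) (at x)"
  unfolding dd_def using frechet_derivative_works by (metis eta_contract_eq)

lemma dd_unique: "(f has_derivative D) (at x) \<Longrightarrow> dd v f x = D v"
  unfolding dd_def using frechet_derivative_at by metis

text \<open>Functions that agree near x have the same derivatives there, so the choice operator
  behind \<open>frechet_derivative\<close> returns the same value, whether or not a derivative
  exists.\<close>

lemma dd_cong:
  assumes "open A" "x \<in> A" "\<And>y. y \<in> A \<Longrightarrow> f y = g y"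
  shows "dd v f x = dd v g x"
proof -
  have "(f has_derivative D) (at x) \<longleftrightarrow> (g has_derivative D) (at x)" for D
    using has_derivative_transform_within_open[OF _ assms(1,2), of f D UNIV g]
      has_derivative_transform_within_open[OF _ assms(1,2), of g D UNIV f] assms(3) by auto
  then show ?thesis by (simp add: dd_def frechet_derivative_def)
qed

lemma differentiable_cong_open:
  assumes "open A" "x \<in> A" "\<And>y. y \<in> A \<Longrightarrow> f y = g y" "f differentiable (at x)"
  shows "g differentiable (at x)"
  using has_derivative_transform_within_open[OF _ assms(1,2), of f _ UNIV g] assms(3,4)
  unfolding differentiable_def by auto

lemma Ck_on_cong:
  assumes "open A" "\<And>x. x \<in> A \<Longrightarrow> f x = g x" "Ck_on k A f"
  shows "Ck_on k A g"
  using assms(2,3)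
proof (induction k arbitrary: f g)
  case 0
  then show ?case by (simp cong: continuous_on_cong)
next
  case (Suc k)
  have "dd v f x = dd v g x" if "x \<in> A" for v x
    using dd_cong[OF assms(1) that] Suc.prems(1) by blast
  then show ?case
    using Suc.IH[of "dd _ f" "dd _ g"] Suc.prems differentiable_cong_open[OF assms(1)]
    unfolding Ck_on_Suc_dd by blast
qed

lemma Ck_on_subset: "Ck_on k A f \<Longrightarrow> B \<subseteq> A \<Longrightarrow> Ck_on k B f"
proof (induction k arbitrary: f)
  case 0
  then show ?case using continuous_on_subset by auto
next
  case (Suc k)
  then show ?case unfolding Ck_on_Suc_dd by blast
qed

lemma Ck_on_SucD: "Ck_on (Suc k) A f \<Longrightarrow> Ck_on k A f"
proof (induction k arbitrary: f)
  case 0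
  then show ?case
    by (auto simp: Ck_on_Suc_dd intro!: continuous_at_imp_continuous_on differentiable_imp_continuous_within)
next
  case (Suc k)
  show ?case using Suc.prems Suc.IH unfolding Ck_on_Suc_dd[of "Suc k"] Ck_on_Suc_dd[of k] by blast
qed

lemma Ck_on_le:
  assumes "Ck_on k A f" "j \<le> k"
  shows "Ck_on j A f"
  using assms(2,1) by (induction rule: inc_induct) (auto dest: Ck_on_SucD)

lemma Ck_on_local:
  assumes "\<And>a. a \<in> A \<Longrightarrow> \<exists>N. open N \<and> a \<in> N \<and> Ck_on k N f"
  shows "Ck_on k A f"
  using assms
proof (induction k arbitrary: f)
  case 0
  then show ?case
    by (force simp: continuous_on_eq_continuous_at intro!: continuous_at_imp_continuous_on)
next
  case (Suc k)
  show ?case unfolding Ck_on_Suc_dd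
  proof (intro conjI ballI allI)
    show "f differentiable at x" if "x \<in> A" for x
      using Suc.prems[OF that] unfolding Ck_on_Suc_dd by blast
    show "Ck_on k A (dd v f)" for v
      by (rule Suc.IH) (use Suc.prems in \<open>meson Ck_on_Suc_dd\<close>)
  qed
qed

lemma Ck_on_const [simp]: "Ck_on k A (\<lambda>x. c)"
proof (induction k arbitrary: c)
  case (Suc k)
  have "dd v (\<lambda>x. c) = (\<lambda>x::'a. 0)" for v
    by (rule ext) (rule dd_unique[OF has_derivative_const])
  then show ?case using Suc unfolding Ck_on_Suc_dd by simp
qed simp

lemma Ck_on_linear:
  assumes "bounded_linear L"
  shows "Ck_on k A L"
proof (cases k)
  case 0
  then show ?thesis using assms by (simp add: linear_continuous_on)
next
  case (Suc j)
  have "dd v L = (\<lambda>x. L v)" for v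
    by (rule ext) (rule dd_unique[OF bounded_linear_imp_has_derivative[OF assms]])
  then show ?thesis
    unfolding Suc Ck_on_Suc_dd using bounded_linear_imp_differentiable[OF assms] by simp
qed

lemma Ck_on_add:
  assumes "open A" "Ck_on k A f" "Ck_on k A g"
  shows "Ck_on k A (\<lambda>x. f x + g x)"
  using assms(2,3)
proof (induction k arbitrary: f g)
  case 0
  then show ?case by (auto intro: continuous_on_add)
next
  case (Suc k)
  have *: "((\<lambda>x. f x + g x) has_derivative (\<lambda>v. dd v f x + dd v g x)) (at x)" if "x \<in> A" for x
    using Suc.prems that by (auto simp: Ck_on_Suc_dd intro!: has_derivative_add has_derivative_dd)
  have "Ck_on k A (dd v (\<lambda>x. f x + g x))" for v
    by (rule Ck_on_cong[OF assms(1), of "\<lambda>x. dd v f x + dd v g x"])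
      (use Suc dd_unique[OF *] in \<open>auto simp: Ck_on_Suc_dd\<close>)
  then show ?case using * unfolding Ck_on_Suc_dd differentiable_def by blast
qed

lemma Ck_on_mult:
  fixes f g :: "'a::euclidean_space \<Rightarrow> real"
  assumes "open A" "Ck_on k A f" "Ck_on k A g"
  shows "Ck_on k A (\<lambda>x. f x * g x)"
  using assms(2,3)
proof (induction k arbitrary: f g)
  case 0
  then show ?case by (auto intro: continuous_on_mult)
next
  case (Suc k)
  have *: "((\<lambda>x. f x * g x) has_derivative (\<lambda>v. f x * dd v g x + dd v f x * g x)) (at x)" if "x \<in> A" for x
    using Suc.prems that by (auto simp: Ck_on_Suc_dd intro!: has_derivative_mult has_derivative_dd)
  have "Ck_on k A (dd v (\<lambda>x. f x * g x))" for v
    by (rule Ck_on_cong[OF assms(1), of "\<lambda>x. f x * dd v g x + dd v f x * g x"])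
      (use Suc dd_unique[OF *] in \<open>auto simp: Ck_on_Suc_dd intro!: Ck_on_add[OF assms(1)] Suc.IH
        Ck_on_SucD[of k A f] Ck_on_SucD[of k A g]\<close>)
  then show ?case using * unfolding Ck_on_Suc_dd differentiable_def by blast
qed

text \<open>Covers the restriction of space-time functions to a fixed time or a fixed point of
  space, and the pull-back along \<open>fst\<close> and \<open>snd\<close>.\<close>

lemma Ck_on_affine:
  assumes "open B" "bounded_linear L" "\<And>x. x \<in> B \<Longrightarrow> a + L x \<in> A" "Ck_on k A f"
  shows "Ck_on k B (\<lambda>x. f (a + L x))"
  using assms(4)
proof (induction k arbitrary: f)
  case 0
  have "continuous_on B (\<lambda>x. a + L x)"
    by (intro continuous_intros linear_continuous_on assms)
  with 0 assms(3) show ?case by (auto intro!: continuous_on_compose2[of A f B "\<lambda>x. a + L x"])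
next
  case (Suc k)
  have L: "((\<lambda>x. a + L x) has_derivative L) (at x)" for x
    using has_derivative_add[OF has_derivative_const bounded_linear_imp_has_derivative[OF assms(2)]]
    by simp
  have *: "((\<lambda>x. f (a + L x)) has_derivative (\<lambda>v. dd (L v) f (a + L x))) (at x)" if "x \<in> B" for x
    using has_derivative_compose[OF L has_derivative_dd] Suc.prems assms(3)[OF that]
    by (auto simp: Ck_on_Suc_dd)
  have "Ck_on k B (dd v (\<lambda>x. f (a + L x)))" for v
    by (rule Ck_on_cong[OF assms(1), of "\<lambda>x. dd (L v) f (a + L x)"])
      (use Suc dd_unique[OF *] in \<open>auto simp: Ck_on_Suc_dd\<close>)
  then show ?case using * unfolding Ck_on_Suc_dd differentiable_def by blast
qed

definition Cinf_on :: "'a::euclidean_space set \<Rightarrow> ('a \<Rightarrow> 'b::real_normed_vector) \<Rightarrow> bool" where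
  "Cinf_on A f \<longleftrightarrow> (\<forall>k. Ck_on k A f)"

lemma Cinf_on_dd: "Cinf_on A f \<Longrightarrow> Cinf_on A (dd v f)"
  unfolding Cinf_on_def using Ck_on_Suc_dd by blast

lemma Cinf_on_differentiable: "Cinf_on A f \<Longrightarrow> x \<in> A \<Longrightarrow> f differentiable (at x)"
  unfolding Cinf_on_def using Ck_on_Suc_dd by blast

lemma Cinf_on_has_derivative:
  "Cinf_on A f \<Longrightarrow> x \<in> A \<Longrightarrow> (f has_derivative (\<lambda>v. dd v f x)) (at x)"
  by (intro has_derivative_dd Cinf_on_differentiable)

lemma Cinf_on_continuous: "Cinf_on A f \<Longrightarrow> continuous_on A f"
  unfolding Cinf_on_def using Ck_on.simps(1) by blast

lemma Cinf_on_subset: "Cinf_on A f \<Longrightarrow> B \<subseteq> A \<Longrightarrow> Cinf_on B f"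
  unfolding Cinf_on_def using Ck_on_subset by blast

lemma Cinf_on_const: "Cinf_on A (\<lambda>x. c)"
  unfolding Cinf_on_def by simp

lemma Cinf_on_add: "open A \<Longrightarrow> Cinf_on A f \<Longrightarrow> Cinf_on A g \<Longrightarrow> Cinf_on A (\<lambda>x. f x + g x)"
  unfolding Cinf_on_def using Ck_on_add by blast

lemma Cinf_on_mult:
  fixes f g :: "'a::euclidean_space \<Rightarrow> real"
  shows "open A \<Longrightarrow> Cinf_on A f \<Longrightarrow> Cinf_on A g \<Longrightarrow> Cinf_on A (\<lambda>x. f x * g x)"
  unfolding Cinf_on_def using Ck_on_mult by blast

lemma Cinf_on_diff:
  fixes f g :: "'a::euclidean_space \<Rightarrow> real"
  assumes "open A" "Cinf_on A f" "Cinf_on A g"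
  shows "Cinf_on A (\<lambda>x. f x - g x)"
  using Cinf_on_add[OF assms(1,2) Cinf_on_mult[OF assms(1) Cinf_on_const[of A "-1"] assms(3)]] by simp

lemma Cinf_on_sum:
  assumes "open A" "\<And>i. i \<in> I \<Longrightarrow> Cinf_on A (f i)"
  shows "Cinf_on A (\<lambda>x. \<Sum>i\<in>I. f i x)"
  using assms(2)
  by (induction I rule: infinite_finite_induct) (auto simp: Cinf_on_const intro!: Cinf_on_add[OF assms(1)])

lemma Cinf_on_affine:
  "open B \<Longrightarrow> bounded_linear L \<Longrightarrow> (\<And>x. x \<in> B \<Longrightarrow> a + L x \<in> A) \<Longrightarrow> Cinf_on A f \<Longrightarrow>
   Cinf_on B (\<lambda>x. f (a + L x))"
  unfolding Cinf_on_def using Ck_on_affine by blast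

text \<open>On an open set the local extension agrees with f on a full neighbourhood, so f inherits
  its derivatives. On (0,1] x R^d this fails at t = 1, where the extensions themselves have to be
  used.\<close>

lemma smooth_on_open_imp_Cinf_on:
  assumes "open A" "smooth_on A f"
  shows "Cinf_on A f"
  unfolding Cinf_on_def
proof
  fix k
  show "Ck_on k A f"
  proof (rule Ck_on_local)
    fix a assume "a \<in> A"
    then obtain N g where N: "open N" "a \<in> N" "\<And>k. Ck_on k N g" "\<And>x. x \<in> A \<inter> N \<Longrightarrow> f x = g x"
      using assms(2) unfolding smooth_on_def by metis
    have "Ck_on k (A \<inter> N) f"
      by (rule Ck_on_cong[of _ g]) (use N assms(1) in \<open>auto intro: Ck_on_subset\<close>)
    then show "\<exists>N. open N \<and> a \<in> N \<and> Ck_on k N f"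
      using N assms(1) \<open>a \<in> A\<close> by (intro exI[of _ "A \<inter> N"]) auto
  qed
qed

lemma smooth_onD:
  assumes "smooth_on A f" "a \<in> A"
  obtains N g where "open N" "a \<in> N" "Cinf_on N g" "\<And>x. x \<in> A \<inter> N \<Longrightarrow> f x = g x"
  using assms unfolding smooth_on_def Cinf_on_def by metis

lemma smooth_onI:
  assumes "\<And>a. a \<in> A \<Longrightarrow> \<exists>N g. open N \<and> a \<in> N \<and> Cinf_on N g \<and> (\<forall>x\<in>A \<inter> N. f x = g x)"
  shows "smooth_on A f"
  using assms unfolding smooth_on_def Cinf_on_def by blast

section \<open>Derivatives along lines and symmetry of second derivatives\<close>

lemma DERIV_along_line:
  fixes f :: "'a::euclidean_space \<Rightarrow> real"
  assumes "f differentiable (at (x + s *\<^sub>R v))"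
  shows "((\<lambda>s. f (x + s *\<^sub>R v)) has_real_derivative dd v f (x + s *\<^sub>R v)) (at s)"
proof -
  have D: "(f has_derivative (\<lambda>w. dd w f (x + s *\<^sub>R v))) (at (x + s *\<^sub>R v))"
    using has_derivative_dd[OF assms] .
  have "((\<lambda>s. x + s *\<^sub>R v) has_derivative (\<lambda>h. h *\<^sub>R v)) (at s)"
    by (auto intro!: derivative_eq_intros)
  from has_derivative_compose[OF this D]
  have "((\<lambda>s. f (x + s *\<^sub>R v)) has_derivative (\<lambda>h. dd (h *\<^sub>R v) f (x + s *\<^sub>R v))) (at s)" .
  moreover have "dd (h *\<^sub>R v) f (x + s *\<^sub>R v) = h * dd v f (x + s *\<^sub>R v)" for h
    using linear_cmul[OF has_derivative_linear[OF D], of h v] by simp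
  ultimately show ?thesis by (simp add: has_field_derivative_def mult_commute_abs)
qed

lemma pderiv_at_eq_dd:
  fixes f :: "real ^ 'n \<Rightarrow> real"
  assumes "f differentiable (at x)"
  shows "pderiv_at i f x = dd (axis i 1) f x"
  unfolding pderiv_at_def
  using DERIV_along_line[of f x 0 "axis i 1"] assms
  by (intro vector_derivative_at) (simp add: has_real_derivative_iff_has_vector_derivative)

lemma dd_add_dir: "f differentiable (at x) \<Longrightarrow> dd (u + v) f x = dd u f x + dd v f x"
  using linear_add[OF has_derivative_linear[OF has_derivative_dd]] .

lemma dd_scaleR_dir: "f differentiable (at x) \<Longrightarrow> dd (c *\<^sub>R v) f x = c *\<^sub>R dd v f x"
  using linear_cmul[OF has_derivative_linear[OF has_derivative_dd]] .

lemma dd_sum_dir: "f differentiable (at x) \<Longrightarrow> dd (\<Sum>i\<in>I. v i) f x = (\<Sum>i\<in>I. dd (v i) f x)"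
  using linear_sum[OF has_derivative_linear[OF has_derivative_dd]] .

lemma dd_sum_axis:
  fixes f :: "real ^ 'n \<Rightarrow> real"
  assumes "f differentiable (at x)"
  shows "dd v f x = (\<Sum>i\<in>UNIV. v $ i * dd (axis i 1) f x)"
proof -
  have "v = (\<Sum>i\<in>UNIV. v $ i *\<^sub>R axis i 1)"
    by (simp add: vec_eq_iff axis_def if_distrib[of "\<lambda>x. _ * x"] cong: if_cong)
  then have "dd v f x = dd (\<Sum>i\<in>UNIV. v $ i *\<^sub>R axis i 1) f x" by simp
  then show ?thesis by (simp add: dd_sum_dir[OF assms] dd_scaleR_dir[OF assms])
qed

text \<open>Schwarz's theorem: the second difference of f in the directions u and v does not depend
  on their order, and each order expresses it by the corresponding mixed derivative at a point that
  tends to x.\<close>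

lemma dd_dd_symmetric:
  fixes f :: "'a::euclidean_space \<Rightarrow> real"
  assumes "open A" "Ck_on 2 A f" "x \<in> A"
  shows "dd u (dd v f) x = dd v (dd u f) x"
proof -
  have C1: "\<And>w. Ck_on 1 A (dd w f)" and df: "\<And>y. y \<in> A \<Longrightarrow> f differentiable (at y)"
    using assms(2) by (auto simp: numeral_2_eq_2 Ck_on_Suc_dd)
  have ddf: "\<And>w y. y \<in> A \<Longrightarrow> dd w f differentiable (at y)"
    and cont: "\<And>w w'. continuous_on A (dd w' (dd w f))"
    using C1 by (auto simp: Ck_on_Suc_dd)
  obtain e where e: "e > 0" "ball x e \<subseteq> A" using assms(1,3) openE by blast
  \<comment> \<open>the second difference quotient is a mixed derivative at an intermediate point\<close>
  have key: "\<exists>y. dist x y \<le> s * (norm u + norm v) \<and>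
      f (x + s *\<^sub>R u + s *\<^sub>R v) - f (x + s *\<^sub>R u) - f (x + s *\<^sub>R v) + f x = s\<^sup>2 * dd v (dd u f) y"
    if s: "0 < s" "s * (norm u + norm v) < e" for s u v
  proof -
    have inA: "x + a *\<^sub>R u + b *\<^sub>R v \<in> A" "dist x (x + a *\<^sub>R u + b *\<^sub>R v) \<le> s * (norm u + norm v)"
      if "0 \<le> a" "a \<le> s" "0 \<le> b" "b \<le> s" for a b
    proof -
      have "dist x (x + a *\<^sub>R u + b *\<^sub>R v) = norm (a *\<^sub>R u + b *\<^sub>R v)"
        by (metis add.assoc add_diff_cancel_left' dist_commute dist_norm)
      also have "\<dots> \<le> a * norm u + b * norm v"
        using norm_triangle_ineq[of "a *\<^sub>R u" "b *\<^sub>R v"] that by simp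
      also have "\<dots> \<le> s * (norm u + norm v)"
        using that by (simp add: distrib_left add_mono mult_right_mono)
      finally show "dist x (x + a *\<^sub>R u + b *\<^sub>R v) \<le> s * (norm u + norm v)" .
      then show "x + a *\<^sub>R u + b *\<^sub>R v \<in> A" using e s by (auto intro!: subsetD[OF e(2)])
    qed
    define q where "q = (\<lambda>a. f ((x + s *\<^sub>R v) + a *\<^sub>R u) - f (x + a *\<^sub>R u))"
    have "(q has_real_derivative dd u f ((x + s *\<^sub>R v) + a *\<^sub>R u) - dd u f (x + a *\<^sub>R u)) (at a)"
      if "0 \<le> a" "a \<le> s" for a
      unfolding q_def using inA[OF that, of s] inA[OF that, of 0] s
      by (intro DERIV_diff DERIV_along_line df) (auto simp: algebra_simps)
    from MVT2[OF s(1) this]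
    obtain a where a: "0 < a" "a < s"
      "q s - q 0 = (s - 0) * (dd u f ((x + s *\<^sub>R v) + a *\<^sub>R u) - dd u f (x + a *\<^sub>R u))" by blast
    have "((\<lambda>b. dd u f ((x + a *\<^sub>R u) + b *\<^sub>R v)) has_real_derivative
        dd v (dd u f) ((x + a *\<^sub>R u) + b *\<^sub>R v)) (at b)" if "0 \<le> b" "b \<le> s" for b
      using inA(1)[OF _ _ that, of a] a by (intro DERIV_along_line ddf) auto
    from MVT2[OF s(1) this]
    obtain b where b: "0 < b" "b < s"
      "dd u f ((x + a *\<^sub>R u) + s *\<^sub>R v) - dd u f ((x + a *\<^sub>R u) + 0 *\<^sub>R v) =
        (s - 0) * dd v (dd u f) ((x + a *\<^sub>R u) + b *\<^sub>R v)" by blast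
    have "q s - q 0 = s\<^sup>2 * dd v (dd u f) (x + a *\<^sub>R u + b *\<^sub>R v)"
      using a b by (simp add: power2_eq_square algebra_simps)
    moreover have "q s - q 0 = f (x + s *\<^sub>R u + s *\<^sub>R v) - f (x + s *\<^sub>R u) - f (x + s *\<^sub>R v) + f x"
      by (simp add: q_def algebra_simps)
    ultimately show ?thesis using inA(2)[of a b] a b by (intro exI[of _ "x + a *\<^sub>R u + b *\<^sub>R v"]) auto
  qed
  \<comment> \<open>The step sizes keep both points of the second difference inside the ball of
    radius e; the summand 1 covers u = v = 0.\<close>
  define s where "s = (\<lambda>n::nat. e / (norm u + norm v + 1) / real (n + 2))"
  have pos: "0 < (norm u + norm v + 1) * real (n + 2)" for n
    by (intro mult_pos_pos add_nonneg_pos) auto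
  have s0: "0 < s n" for n using e pos[of n] by (simp add: s_def divide_divide_eq_left del: of_nat_add)
  have s1: "s n * (norm u + norm v) < e" for n
  proof -
    have "e * (norm u + norm v) < e * ((norm u + norm v + 1) * real (n + 2))"
    proof (rule mult_strict_left_mono[OF _ e(1)])
      have "norm u + norm v < (norm u + norm v + 1) * 1" by simp
      also have "\<dots> \<le> (norm u + norm v + 1) * real (n + 2)" by (intro mult_left_mono) auto
      finally show "norm u + norm v < (norm u + norm v + 1) * real (n + 2)" .
    qed
    then show ?thesis
      using pos[of n] unfolding s_def by (simp add: pos_divide_less_eq divide_divide_eq_left del: of_nat_add)
  qed
  have lim0: "(\<lambda>n. s n * (norm u + norm v)) \<longlonglongrightarrow> 0" unfolding s_def by real_asymp
  obtain y where y: "\<And>n. dist x (y n) \<le> s n * (norm u + norm v)"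
    "\<And>n. f (x + s n *\<^sub>R u + s n *\<^sub>R v) - f (x + s n *\<^sub>R u) - f (x + s n *\<^sub>R v) + f x = (s n)\<^sup>2 * dd v (dd u f) (y n)"
    using key[OF s0 s1] by metis
  have "s n * (norm v + norm u) < e" for n using s1[of n] by (simp add: add.commute)
  then obtain z where z: "\<And>n. dist x (z n) \<le> s n * (norm u + norm v)"
    "\<And>n. f (x + s n *\<^sub>R v + s n *\<^sub>R u) - f (x + s n *\<^sub>R v) - f (x + s n *\<^sub>R u) + f x = (s n)\<^sup>2 * dd u (dd v f) (z n)"
    using key[OF s0, of _ v u] by (metis add.commute)
  have eq: "dd v (dd u f) (y n) = dd u (dd v f) (z n)" for n
  proof -
    have "(s n)\<^sup>2 * dd v (dd u f) (y n) = (s n)\<^sup>2 * dd u (dd v f) (z n)"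
      using y(2)[of n] z(2)[of n] by (simp add: algebra_simps)
    then show ?thesis using s0[of n] by simp
  qed
  have "y \<longlonglongrightarrow> x"
    by (rule metric_tendsto_imp_tendsto[OF lim0])
      (use order_trans[OF y(1) abs_ge_self] in \<open>simp add: dist_commute[of _ x]\<close>)
  moreover have "z \<longlonglongrightarrow> x"
    by (rule metric_tendsto_imp_tendsto[OF lim0])
      (use order_trans[OF z(1) abs_ge_self] in \<open>simp add: dist_commute[of _ x]\<close>)
  moreover have "isCont (dd w' (dd w f)) x" for w w'
    using cont assms(1,3) by (simp add: continuous_on_eq_continuous_at)
  ultimately have "(\<lambda>n. dd v (dd u f) (y n)) \<longlonglongrightarrow> dd v (dd u f) x"
    "(\<lambda>n. dd u (dd v f) (z n)) \<longlonglongrightarrow> dd u (dd v f) x"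
    by (auto intro: isCont_tendsto_compose)
  then show ?thesis using eq LIMSEQ_unique by auto
qed

section \<open>Taylor estimates and test functions\<close>

abbreviation pdx :: "'n::finite \<Rightarrow> (real ^ 'n \<Rightarrow> real) \<Rightarrow> real ^ 'n \<Rightarrow> real" where
  "pdx i \<equiv> dd (axis i 1)"

lemma dd_lincomb:
  fixes h :: "'i \<Rightarrow> 'a::euclidean_space \<Rightarrow> real"
  assumes "\<And>i. i \<in> I \<Longrightarrow> h i differentiable (at x)"
  shows "dd v (\<lambda>x. \<Sum>i\<in>I. w i * h i x) x = (\<Sum>i\<in>I. w i * dd v (h i) x)"
  by (rule dd_unique) (auto intro!: has_derivative_sum has_derivative_mult_right has_derivative_dd assms)

lemma dd_dd_sum_axis:
  fixes f :: "real ^ 'n \<Rightarrow> real"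
  assumes "Ck_on 2 UNIV f"
  shows "dd k (dd k f) x = (\<Sum>i\<in>UNIV. \<Sum>j\<in>UNIV. k $ i * k $ j * pdx i (pdx j f) x)"
proof -
  have d: "f differentiable (at x)" "dd v f differentiable (at x)" for v x
    using assms by (auto simp: numeral_2_eq_2 Ck_on_Suc_dd)
  have "dd k f = (\<lambda>x. \<Sum>j\<in>UNIV. k $ j * pdx j f x)"
    using dd_sum_axis[OF d(1)] by blast
  then have "dd k (dd k f) x = (\<Sum>j\<in>UNIV. k $ j * dd k (pdx j f) x)"
    by (simp add: dd_lincomb[OF d(2)])
  also have "\<dots> = (\<Sum>j\<in>UNIV. \<Sum>i\<in>UNIV. k $ i * k $ j * pdx i (pdx j f) x)"
    by (simp add: dd_sum_axis[OF d(2), of k] sum_distrib_left mult_ac)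
  also have "\<dots> = (\<Sum>i\<in>UNIV. \<Sum>j\<in>UNIV. k $ i * k $ j * pdx i (pdx j f) x)"
    by (rule sum.swap)
  finally show ?thesis .
qed

lemma compact_abs_bound:
  fixes f :: "'a::metric_space \<Rightarrow> real"
  assumes "compact K" "continuous_on K f"
  obtains C where "C \<ge> 0" "\<And>x. x \<in> K \<Longrightarrow> \<bar>f x\<bar> \<le> C"
proof -
  have "bounded (f ` K)" using compact_continuous_image[OF assms(2,1)] compact_imp_bounded by blast
  then obtain C where "\<And>x. x \<in> K \<Longrightarrow> \<bar>f x\<bar> \<le> C" unfolding bounded_iff by auto
  then show ?thesis using that[of "max C 0"] by fastforce
qed

lemma Ck_on_continuous: "Ck_on k A f \<Longrightarrow> continuous_on A f"
  using Ck_on_le[of k A f 0] by simp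

lemma Ck_on_dd: "Ck_on (Suc k) A f \<Longrightarrow> Ck_on k A (dd v f)"
  by (simp add: Ck_on_Suc_dd)

text \<open>The third derivative in direction k is a cubic form in k whose coefficients are
  continuous, hence bounded on compact sets.\<close>

lemma second_order_Taylor:
  fixes f :: "real ^ 'n \<Rightarrow> real"
  assumes f: "Ck_on 3 UNIV f" and K: "compact K"
  obtains C where "C \<ge> 0"
    "\<And>x k. x \<in> K \<Longrightarrow> norm k \<le> 1 \<Longrightarrow> \<bar>f (x + k) - f x - dd k f x - dd k (dd k f) x / 2\<bar> \<le> C * norm k ^ 3"
proof -
  \<comment> \<open>The closed unit neighbourhood of K contains the intermediate point x + t k of
    Maclaurin's formula for every k of length at most 1.\<close>
  define K' where "K' = {x + y | x y. x \<in> K \<and> y \<in> cball (0 :: real ^ 'n) 1}"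
  have K': "compact K'" unfolding K'_def by (rule compact_sums[OF K compact_cball])
  have f1: "Ck_on 2 UNIV (dd v f)" for v using f by (simp add: numeral_3_eq_3 Ck_on_Suc_dd numeral_2_eq_2)
  have f2: "Ck_on 1 UNIV (dd u (dd v f))" for u v using f1 by (simp add: Ck_on_Suc_dd numeral_2_eq_2)
  have "Ck_on 0 UNIV (dd w (dd u (dd v f)))" for u v w using f2 by (simp add: Ck_on_Suc_dd)
  then have "continuous_on K' (pdx a (pdx b (pdx c f)))" for a b c
    by (auto intro: continuous_on_subset[of UNIV])
  then have "\<exists>C\<ge>0. \<forall>x\<in>K'. \<bar>pdx a (pdx b (pdx c f)) x\<bar> \<le> C" for a b c
    using compact_abs_bound[OF K'] by metis
  then obtain B where B: "\<And>a b c. B a b c \<ge> 0"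
    "\<And>a b c x. x \<in> K' \<Longrightarrow> \<bar>pdx a (pdx b (pdx c f)) x\<bar> \<le> B a b c" by metis
  define C where "C = (\<Sum>c\<in>UNIV. \<Sum>a\<in>UNIV. \<Sum>b\<in>UNIV. B a b c)"
  have C0: "C \<ge> 0" unfolding C_def by (intro sum_nonneg B)
  have d: "f differentiable (at x)" "dd u f differentiable (at x)" "dd v (dd u f) differentiable (at x)" for u v x
    using f f1 f2 by (auto simp: numeral_3_eq_3 numeral_2_eq_2 Ck_on_Suc_dd)
  have ddd: "dd k (dd k (dd k f)) x = (\<Sum>c\<in>UNIV. \<Sum>a\<in>UNIV. \<Sum>b\<in>UNIV. k $ c * (k $ a * k $ b * pdx a (pdx b (pdx c f)) x))" for k x
  proof -
    have "dd k f = (\<lambda>x. \<Sum>j\<in>UNIV. k $ j * pdx j f x)" using dd_sum_axis[OF d(1)] by blast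
    moreover have "dd k (\<lambda>x. \<Sum>j\<in>UNIV. k $ j * pdx j f x) = (\<lambda>x. \<Sum>j\<in>UNIV. k $ j * dd k (pdx j f) x)"
      by (rule ext) (rule dd_lincomb[OF d(2)])
    moreover have "dd k (\<lambda>x. \<Sum>j\<in>UNIV. k $ j * dd k (pdx j f) x) x = (\<Sum>j\<in>UNIV. k $ j * dd k (dd k (pdx j f)) x)"
      using dd_lincomb[OF d(3)] .
    ultimately show ?thesis by (simp add: dd_dd_sum_axis[OF f1] sum_distrib_left)
  qed
  have bound: "\<bar>dd k (dd k (dd k f)) x\<bar> \<le> C * norm k ^ 3" if "x \<in> K'" for x k
  proof -
    have "\<bar>k $ c * (k $ a * k $ b * pdx a (pdx b (pdx c f)) x)\<bar> \<le> norm k ^ 3 * B a b c" for a b c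
    proof -
      have "\<bar>k $ c\<bar> * (\<bar>k $ a\<bar> * \<bar>k $ b\<bar> * \<bar>pdx a (pdx b (pdx c f)) x\<bar>) \<le> norm k * (norm k * norm k * B a b c)"
        using B that by (intro mult_mono component_le_norm_cart mult_nonneg_nonneg) auto
      then show ?thesis by (simp add: abs_mult power3_eq_cube mult_ac)
    qed
    then have "\<bar>dd k (dd k (dd k f)) x\<bar> \<le> (\<Sum>c\<in>UNIV. \<Sum>a\<in>UNIV. \<Sum>b\<in>UNIV. norm k ^ 3 * B a b c)"
      unfolding ddd by (intro sum_abs[THEN order_trans] sum_mono)
    also have "\<dots> = C * norm k ^ 3"
      unfolding C_def by (simp add: sum_distrib_left mult.commute)
    finally show ?thesis .
  qed
  have "\<bar>f (x + k) - f x - dd k f x - dd k (dd k f) x / 2\<bar> \<le> C * norm k ^ 3" if "x \<in> K" "norm k \<le> 1" for x k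
  proof -
    define diff where "diff = (\<lambda>m::nat. if m = 0 then (\<lambda>s. f (x + s *\<^sub>R k)) else if m = 1 then (\<lambda>s. dd k f (x + s *\<^sub>R k))
      else if m = 2 then (\<lambda>s. dd k (dd k f) (x + s *\<^sub>R k)) else (\<lambda>s. dd k (dd k (dd k f)) (x + s *\<^sub>R k)))"
    have "\<exists>t. 0 < t \<and> t < 1 \<and> f (x + 1 *\<^sub>R k) = (\<Sum>m<3. diff m 0 / fact m * 1 ^ m) + diff 3 t / fact 3 * 1 ^ 3"
    proof (rule Maclaurin)
      show "\<forall>m t. m < 3 \<and> 0 \<le> t \<and> t \<le> 1 \<longrightarrow> (diff m has_real_derivative diff (Suc m) t) (at t)"
        by (auto simp: diff_def numeral_3_eq_3 less_Suc_eq intro!: DERIV_along_line d)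
    qed (auto simp: diff_def)
    then obtain t where t: "0 < t" "t < 1"
      "f (x + k) = f x + dd k f x + dd k (dd k f) x / 2 + dd k (dd k (dd k f)) (x + t *\<^sub>R k) / 6"
      by (auto simp: diff_def numeral_3_eq_3 lessThan_Suc)
    have "norm (t *\<^sub>R k) \<le> 1" using t that by (simp add: mult_le_one)
    then have "x + t *\<^sub>R k \<in> K'" 
      using that unfolding K'_def by (intro CollectI exI[of _ x] exI[of _ "t *\<^sub>R k"]) auto
    from bound[OF this, of k] show ?thesis unfolding t(3) by simp
  qed
  then show ?thesis using that C0 by blast
qed

text \<open>Controls the Taylor polynomial for long increments, for which the local Taylor estimate
  says nothing.\<close>

lemma Taylor_term_bounds:
  fixes f :: "real ^ 'n \<Rightarrow> real"
  assumes f: "Ck_on 2 UNIV f" and K: "compact K"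
  obtains C where "C \<ge> 0" "\<And>x. x \<in> K \<Longrightarrow> \<bar>f x\<bar> \<le> C"
    "\<And>x k. x \<in> K \<Longrightarrow> \<bar>dd k f x\<bar> \<le> C * norm k"
    "\<And>x k. x \<in> K \<Longrightarrow> \<bar>dd k (dd k f) x\<bar> \<le> C * norm k ^ 2"
proof -
  have d: "f differentiable (at x)" for x
    using f by (auto simp: numeral_2_eq_2 Ck_on_Suc_dd)
  have c: "continuous_on K f" "continuous_on K (pdx i f)" "continuous_on K (pdx i (pdx j f))" for i j
  proof -
    have f1: "Ck_on 1 UNIV (pdx j f)" for j using f by (simp add: numeral_2_eq_2 Ck_on_Suc_dd)
    then have "Ck_on 0 UNIV (pdx i (pdx j f))" by (simp add: Ck_on_Suc_dd)
    then show "continuous_on K f" "continuous_on K (pdx i f)" "continuous_on K (pdx i (pdx j f))"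
      using Ck_on_continuous[OF f] Ck_on_continuous[OF f1] by (auto intro: continuous_on_subset)
  qed
  obtain B0 where B0: "B0 \<ge> 0" "\<And>x. x \<in> K \<Longrightarrow> \<bar>f x\<bar> \<le> B0" using compact_abs_bound[OF K c(1)] by blast
  have "\<exists>C\<ge>0. \<forall>x\<in>K. \<bar>pdx i f x\<bar> \<le> C" for i
    using compact_abs_bound[OF K c(2)] by metis
  then obtain B1 where B1: "\<And>i. B1 i \<ge> 0" "\<And>i x. x \<in> K \<Longrightarrow> \<bar>pdx i f x\<bar> \<le> B1 i" by metis
  have "\<exists>C\<ge>0. \<forall>x\<in>K. \<bar>pdx i (pdx j f) x\<bar> \<le> C" for i j
    using compact_abs_bound[OF K c(3)] by metis
  then obtain B2 where B2: "\<And>i j. B2 i j \<ge> 0" "\<And>i j x. x \<in> K \<Longrightarrow> \<bar>pdx i (pdx j f) x\<bar> \<le> B2 i j" by metis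
  define C where "C = B0 + (\<Sum>i\<in>UNIV. B1 i) + (\<Sum>i\<in>UNIV. \<Sum>j\<in>UNIV. B2 i j)"
  have s: "0 \<le> (\<Sum>i\<in>UNIV. B1 i)" "0 \<le> (\<Sum>i\<in>UNIV. \<Sum>j\<in>UNIV. B2 i j)"
    by (auto intro!: sum_nonneg B1 B2)
  have 1: "\<bar>dd k f x\<bar> \<le> C * norm k" if "x \<in> K" for x k
  proof -
    have "\<bar>dd k f x\<bar> \<le> (\<Sum>i\<in>UNIV. norm k * B1 i)"
      unfolding dd_sum_axis[OF d, of k] using B1 that
      by (intro sum_abs[THEN order_trans] sum_mono) (auto simp: abs_mult intro!: mult_mono component_le_norm_cart)
    also have "\<dots> = (\<Sum>i\<in>UNIV. B1 i) * norm k" by (simp add: sum_distrib_left mult.commute)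
    also have "\<dots> \<le> C * norm k" using s B0 by (intro mult_right_mono) (auto simp: C_def)
    finally show ?thesis .
  qed
  have 2: "\<bar>dd k (dd k f) x\<bar> \<le> C * norm k ^ 2" if "x \<in> K" for x k
  proof -
    have "\<bar>dd k (dd k f) x\<bar> \<le> (\<Sum>i\<in>UNIV. \<Sum>j\<in>UNIV. norm k * norm k * B2 i j)"
      unfolding dd_dd_sum_axis[OF f] using B2 that
      by (intro sum_abs[THEN order_trans] sum_mono) (auto simp: abs_mult intro!: mult_mono component_le_norm_cart)
    also have "\<dots> = (\<Sum>i\<in>UNIV. \<Sum>j\<in>UNIV. B2 i j) * norm k ^ 2"
      by (simp add: sum_distrib_left mult_ac power2_eq_square)
    also have "\<dots> \<le> C * norm k ^ 2" using s B0 by (intro mult_right_mono) (auto simp: C_def)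
    finally show ?thesis .
  qed
  have "0 \<le> C" "\<And>x. x \<in> K \<Longrightarrow> \<bar>f x\<bar> \<le> C" using s B0 by (fastforce simp: C_def)+
  then show ?thesis using that 1 2 by blast
qed

text \<open>Boundedness of \<open>f\<close> turns the local Taylor estimate into one for increments of any size.\<close>

lemma second_order_Taylor_bounded:
  fixes f :: "real ^ 'n \<Rightarrow> real"
  assumes f: "Ck_on 3 UNIV f" and K: "compact K" and M: "\<And>x. \<bar>f x\<bar> \<le> M"
  obtains C where "C \<ge> 0"
    "\<And>x k. x \<in> K \<Longrightarrow> \<bar>f (x + k) - f x - dd k f x - dd k (dd k f) x / 2\<bar> \<le> C * norm k ^ 3"
proof -
  obtain C1 where C1: "C1 \<ge> 0"
    "\<And>x k. x \<in> K \<Longrightarrow> norm k \<le> 1 \<Longrightarrow> \<bar>f (x + k) - f x - dd k f x - dd k (dd k f) x / 2\<bar> \<le> C1 * norm k ^ 3"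
    using second_order_Taylor[OF f K] by blast
  have "Ck_on 2 UNIV f" using Ck_on_le[OF f] by simp
  then obtain C2 where C2: "C2 \<ge> 0" "\<And>x k. x \<in> K \<Longrightarrow> \<bar>dd k f x\<bar> \<le> C2 * norm k"
    "\<And>x k. x \<in> K \<Longrightarrow> \<bar>dd k (dd k f) x\<bar> \<le> C2 * norm k ^ 2"
    using Taylor_term_bounds[OF _ K] by metis
  have M0: "0 \<le> M" using M[of 0] by linarith
  define C where "C = C1 + 2 * M + 2 * C2"
  have "\<bar>f (x + k) - f x - dd k f x - dd k (dd k f) x / 2\<bar> \<le> C * norm k ^ 3" if x: "x \<in> K" for x k
  proof (cases "norm k \<le> 1")
    case True
    have "C1 * norm k ^ 3 \<le> C * norm k ^ 3"
      using C1(1) C2(1) M0 by (intro mult_right_mono) (auto simp: C_def)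
    then show ?thesis using C1(2)[OF x True] by linarith
  next
    case False
    \<comment> \<open>For increments longer than 1 there is no cancellation to exploit: the two
      values of f and both Taylor terms are each at most a constant times norm k ^ 3.\<close>
    define q where "q = norm k ^ 3"
    have q: "1 \<le> q" "norm k \<le> q" "norm k ^ 2 \<le> q"
      using False power_increasing[of 1 3 "norm k"] power_increasing[of 2 3 "norm k"]
      by (auto simp: q_def intro!: one_le_power)
    have "C2 * norm k \<le> C2 * q" "C2 * norm k ^ 2 \<le> C2 * q" "2 * M * 1 \<le> 2 * M * q" "0 \<le> C1 * q"
      using q C2(1) C1(1) M0 by (intro mult_left_mono mult_nonneg_nonneg; simp)+
    moreover have "C * q = C1 * q + 2 * M * q + 2 * (C2 * q)" by (simp add: C_def algebra_simps)
    ultimately show ?thesis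
      using M[of "x + k"] M[of x] C2(2)[OF x, of k] C2(3)[OF x, of k] unfolding q_def[symmetric] by linarith
  qed
  moreover have "C \<ge> 0" using C1 C2 M0 by (simp add: C_def)
  ultimately show ?thesis using that by blast
qed

text \<open>A polynomial bump of finite smoothness: the exponent m gives class C^(m - 1) and support
  in the closed ball. The exponent 4 used later gives the class C^3 that the second order Taylor
  estimate demands.\<close>

definition bump :: "nat \<Rightarrow> 'a::euclidean_space \<Rightarrow> real \<Rightarrow> 'a \<Rightarrow> real" where
  "bump m c r x = (max 0 (r\<^sup>2 - (x - c) \<bullet> (x - c))) ^ m"

lemma bump_nonneg: "0 \<le> bump m c r x"
  by (simp add: bump_def)

lemma bump_pos: "x \<in> ball c r \<Longrightarrow> 0 < bump m c r x"
proof -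
  assume "x \<in> ball c r"
  then have "(norm (x - c))\<^sup>2 < r\<^sup>2" by (intro power_strict_mono) (auto simp: dist_norm norm_minus_commute)
  then show ?thesis by (simp add: bump_def power2_norm_eq_inner)
qed

lemma bump_eq_0: "x \<notin> cball c r \<Longrightarrow> 0 < m \<Longrightarrow> 0 \<le> r \<Longrightarrow> bump m c r x = 0"
proof -
  assume "x \<notin> cball c r" "0 < m" "0 \<le> r"
  then have "r\<^sup>2 \<le> (norm (x - c))\<^sup>2" by (intro power_mono) (auto simp: dist_norm norm_minus_commute)
  then show ?thesis using \<open>0 < m\<close> by (simp add: bump_def power2_norm_eq_inner)
qed

lemma bump_le: "bump m c r x \<le> (r\<^sup>2) ^ m"
  unfolding bump_def by (intro power_mono) auto

lemma DERIV_max0_power: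
  assumes "2 \<le> m"
  shows "((\<lambda>s. (max 0 s) ^ m) has_real_derivative real m * (max 0 s) ^ (m - 1)) (at s)"
proof -
  consider "s > 0" | "s < 0" | "s = 0" by linarith
  then show ?thesis
  proof cases
    case 1
    have "((\<lambda>s. s ^ m) has_real_derivative real m * s ^ (m - 1)) (at s)"
      by (auto intro!: derivative_eq_intros)
    then have "((\<lambda>s. (max 0 s) ^ m) has_real_derivative real m * s ^ (m - 1)) (at s)"
      by (rule has_field_derivative_transform_within_open[where S = "{0<..}"]) (use 1 in auto)
    with 1 show ?thesis by simp
  next
    case 2
    then have "((\<lambda>s. (max 0 s) ^ m) has_real_derivative 0) (at s)"
      using assms by (intro has_field_derivative_transform_within_open[OF DERIV_const, where S = "{..<0}"]) auto
    with 2 assms show ?thesis by (simp add: power_0_left)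
  next
    case 3
    \<comment> \<open>At the origin the exponent m \<ge> 2 makes the difference quotient at most
      |h|, so that the two branches fit together differentiably.\<close>
    have "((\<lambda>h::real. (max 0 h) ^ m / h) \<longlongrightarrow> 0) (at 0)"
    proof (rule Lim_null_comparison)
      have "norm ((max 0 h) ^ m / h) \<le> \<bar>h\<bar>" if "\<bar>h\<bar> \<le> 1" for h :: real
      proof (cases "h > 0")
        case True
        have "h ^ m \<le> h ^ 2" using True that assms by (intro power_decreasing) auto
        then show ?thesis using True by (simp add: field_simps power2_eq_square)
      next
        case False
        then show ?thesis using assms by (simp add: power_0_left)
      qed
      then show "\<forall>\<^sub>F h in at 0. norm ((max 0 h) ^ m / h) \<le> \<bar>h::real\<bar>"
        unfolding eventually_at by (intro exI[of _ 1]) auto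
      show "((\<lambda>h. \<bar>h::real\<bar>) \<longlongrightarrow> 0) (at 0)" by (auto intro!: tendsto_eq_intros)
    qed
    then show ?thesis using 3 assms by (simp add: DERIV_def power_0_left)
  qed
qed

lemma has_derivative_bump:
  fixes c :: "'a::euclidean_space"
  shows "(bump (Suc (Suc m)) c r has_derivative
     (\<lambda>v. bump (Suc m) c r x * (- 2 * real (Suc (Suc m)) * ((x - c) \<bullet> v)))) (at x)"
proof -
  let ?s = "\<lambda>x. r\<^sup>2 - (x - c) \<bullet> (x - c)"
  have 1: "(?s has_derivative (\<lambda>v. - 2 * ((x - c) \<bullet> v))) (at x)"
    by (auto intro!: derivative_eq_intros simp: inner_commute)
  have "((\<lambda>s. (max 0 s) ^ Suc (Suc m)) has_derivative (\<lambda>h. real (Suc (Suc m)) * (max 0 (?s x)) ^ Suc m * h)) (at (?s x))"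
    using DERIV_max0_power[of "Suc (Suc m)" "?s x"] by (simp add: has_field_derivative_def)
  from has_derivative_compose[OF 1 this]
  show ?thesis
    unfolding bump_def[abs_def]
    by (rule has_derivative_eq_rhs) (simp add: fun_eq_iff mult_ac del: power_Suc of_nat_Suc)
qed

lemma dd_bump:
  "dd v (bump (Suc (Suc m)) c r) x = bump (Suc m) c r x * (- 2 * real (Suc (Suc m)) * ((x - c) \<bullet> v))"
  by (rule dd_unique[OF has_derivative_bump])

text \<open>Differentiating lowers the exponent by one and multiplies by an affine function, which
  is the induction step.\<close>

lemma Ck_on_bump: "Ck_on k UNIV (bump (Suc k) c r)"
proof (induction k)
  case 0
  show ?case unfolding bump_def by (auto intro!: continuous_intros)
next
  case (Suc k)
  have lin: "Ck_on k UNIV (\<lambda>x. - 2 * real (Suc (Suc k)) * ((x - c) \<bullet> v))" for v :: 'a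
  proof -
    have "bounded_linear (\<lambda>x. - 2 * real (Suc (Suc k)) * (x \<bullet> v))"
      by (intro bounded_linear_mult_const bounded_linear_const_mult bounded_linear_inner_left)
    from Ck_on_add[OF open_UNIV Ck_on_linear[OF this] Ck_on_const[of k UNIV "2 * real (Suc (Suc k)) * (c \<bullet> v)"]]
    show ?thesis by (simp add: inner_diff_left algebra_simps)
  qed
  have "dd v (bump (Suc (Suc k)) c r) = (\<lambda>x. bump (Suc k) c r x * (- 2 * real (Suc (Suc k)) * ((x - c) \<bullet> v)))" for v
    using dd_bump by blast
  then have "Ck_on k UNIV (dd v (bump (Suc (Suc k)) c r))" for v
    using Ck_on_mult[OF open_UNIV Suc lin] by simp
  then show ?case using has_derivative_bump unfolding Ck_on_Suc_dd differentiable_def by blast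
qed

lemma dd_eq_0_outside:
  fixes g :: "'a::euclidean_space \<Rightarrow> real"
  assumes "\<And>x. x \<notin> cball c r \<Longrightarrow> g x = 0" "x \<notin> cball c r"
  shows "dd v g x = 0"
proof -
  have "dd v g x = dd v (\<lambda>x. 0) x"
    by (rule dd_cong[of "- cball c r"]) (use assms in auto)
  also have "\<dots> = 0" by (rule dd_unique[OF has_derivative_const])
  finally show ?thesis .
qed

text \<open>Uniform in the base point x, which is needed when x is a random point that no other
  factor confines to a compact set. Far from the support all terms at x vanish, and g(x + k) can
  only be nonzero if k is longer than 1.\<close>

lemma second_order_Taylor_compact_support:
  fixes g :: "real ^ 'n \<Rightarrow> real"
  assumes g: "Ck_on 3 UNIV g" and supp: "\<And>x. x \<notin> cball c r \<Longrightarrow> g x = 0"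
  obtains C where "C \<ge> 0"
    "\<And>x k. \<bar>g (x + k) - g x - dd k g x - dd k (dd k g) x / 2\<bar> \<le> C * norm k ^ 3"
proof -
  obtain M where M: "M \<ge> 0" "\<And>x. x \<in> cball c r \<Longrightarrow> \<bar>g x\<bar> \<le> M"
    using compact_abs_bound[OF compact_cball continuous_on_subset[OF Ck_on_continuous[OF g] subset_UNIV]]
    by blast
  have M': "\<bar>g x\<bar> \<le> M" for x using M supp[of x] by fastforce
  obtain C where C: "C \<ge> 0"
    "\<And>x k. x \<in> cball c (r + 1) \<Longrightarrow> \<bar>g (x + k) - g x - dd k g x - dd k (dd k g) x / 2\<bar> \<le> C * norm k ^ 3"
    using second_order_Taylor_bounded[OF g compact_cball M'] by blast
  have "\<bar>g (x + k) - g x - dd k g x - dd k (dd k g) x / 2\<bar> \<le> (C + M) * norm k ^ 3" for x k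
  proof (cases "x \<in> cball c (r + 1)")
    case True
    have "C * norm k ^ 3 \<le> (C + M) * norm k ^ 3" using M by (intro mult_right_mono) auto
    then show ?thesis using C(2)[OF True, of k] by linarith
  next
    case False
    then have x: "x \<notin> cball c r" by auto
    have 0: "g x = 0" "dd k g x = 0" "dd k (dd k g) x = 0"
      using supp x dd_eq_0_outside[OF supp] dd_eq_0_outside[OF dd_eq_0_outside[OF supp]] by auto
    have "\<bar>g (x + k)\<bar> \<le> M * norm k ^ 3"
    proof (cases "norm k \<le> 1")
      case True
      then have "x + k \<notin> cball c r"
        using False norm_triangle_ineq4[of "x + k - c" k] by (auto simp: dist_norm norm_minus_commute[of c] algebra_simps)
      then show ?thesis using supp M by simp
    next
      case False
      then have "M * 1 \<le> M * norm k ^ 3" using M by (intro mult_left_mono one_le_power) auto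
      then show ?thesis using M'[of "x + k"] by linarith
    qed
    moreover have "0 \<le> C * norm k ^ 3" using C by simp
    ultimately show ?thesis unfolding 0 by (simp add: distrib_right)
  qed
  moreover have "C + M \<ge> 0" using C M by simp
  ultimately show ?thesis using that by blast
qed

section \<open>Space-time functions and integration by parts\<close>

abbreviation spacetime :: "(real \<times> (real ^ 'n::finite)) set" where
  "spacetime \<equiv> {0<..<1} \<times> UNIV"

lemma open_spacetime: "open spacetime"
  by (intro open_Times) auto

abbreviation dt :: "(real \<times> (real ^ 'n::finite) \<Rightarrow> real) \<Rightarrow> real \<times> (real ^ 'n) \<Rightarrow> real" where
  "dt \<equiv> dd (1, 0)"

abbreviation dx :: "'n::finite \<Rightarrow> (real \<times> (real ^ 'n) \<Rightarrow> real) \<Rightarrow> real \<times> (real ^ 'n) \<Rightarrow> real" where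
  "dx i \<equiv> dd (0, axis i 1)"

lemma dd_Pair:
  fixes F :: "real \<times> (real ^ 'n) \<Rightarrow> real"
  assumes "F differentiable (at z)"
  shows "dd (h, k) F z = h * dt F z + (\<Sum>i\<in>UNIV. k $ i * dx i F z)"
proof -
  have "k = (\<Sum>i\<in>UNIV. k $ i *\<^sub>R axis i 1)"
    by (simp add: vec_eq_iff axis_def if_distrib[of "\<lambda>x. _ * x"] cong: if_cong)
  then have "(h, k) = h *\<^sub>R (1, 0) + (\<Sum>i\<in>UNIV. k $ i *\<^sub>R (0 :: real, axis i 1 :: real ^ 'n))"
    by (simp add: prod_eq_iff fst_sum snd_sum)
  then have "dd (h, k) F z = dd (h *\<^sub>R (1, 0) + (\<Sum>i\<in>UNIV. k $ i *\<^sub>R (0, axis i 1))) F z" by simp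
  then show ?thesis
    by (simp add: dd_add_dir[OF assms] dd_sum_dir[OF assms] dd_scaleR_dir[OF assms] del: scaleR_Pair)
qed

lemma Cinf_on_slice:
  assumes "open A" "Cinf_on A F" "\<And>x. x \<in> B \<Longrightarrow> (t, x) \<in> A" "open B"
  shows "Cinf_on B (\<lambda>x. F (t, x))"
proof -
  have "bounded_linear (\<lambda>x::'b. (0::'a, x))" by (intro bounded_linear_Pair bounded_linear_zero bounded_linear_ident)
  from Cinf_on_affine[OF assms(4) this, of "(t, 0)" A F] assms show ?thesis by simp
qed

lemma dd_slice:
  assumes "F differentiable (at (t, x))"
  shows "dd v (\<lambda>x. F (t, x)) x = dd (0, v) F (t, x)"
proof (rule dd_unique)
  have "((\<lambda>x. (t, x)) has_derivative (\<lambda>v. (0, v))) (at x)" by (auto intro!: derivative_eq_intros)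
  from has_derivative_compose[OF this has_derivative_dd[OF assms]]
  show "((\<lambda>x. F (t, x)) has_derivative (\<lambda>v. dd (0, v) F (t, x))) (at x)" .
qed

lemma DERIV_time:
  fixes F :: "real \<times> 'a::euclidean_space \<Rightarrow> real"
  assumes "F differentiable (at (t, x))"
  shows "((\<lambda>s. F (s, x)) has_real_derivative dd (1, 0) F (t, x)) (at t)"
  using DERIV_along_line[of F "(0, x)" t "(1, 0)"] assms by simp

text \<open>The remainder respects parabolic scaling: for k of size sqrt h each of its three terms
  is o(h). The point moves in space at time t, then in time at x + k; a Lipschitz bound for
  \<open>dt F\<close> accounts for evaluating it at (t, x) and yields the cross term h * norm k. The
  bound on F admits k of any length, as Gaussian noise requires.\<close>

lemma spacetime_Taylor:
  fixes F :: "real \<times> (real ^ 'n) \<Rightarrow> real"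
  assumes F: "Cinf_on spacetime F" and M: "\<And>z. z \<in> spacetime \<Longrightarrow> \<bar>F z\<bar> \<le> M" and t: "0 < t" "t < 1"
  obtains C \<delta> where "C \<ge> 0" "\<delta> > 0" "t + \<delta> < 1"
    "\<And>x k h. x \<in> cball c r \<Longrightarrow> 0 \<le> h \<Longrightarrow> h \<le> \<delta> \<Longrightarrow>
      \<bar>F (t + h, x + k) - F (t, x) - h * dt F (t, x) - dd k (\<lambda>x. F (t, x)) x - dd k (dd k (\<lambda>x. F (t, x))) x / 2\<bar>
        \<le> C * (h ^ 2 + h * norm k + norm k ^ 3)"
proof -
  define \<delta> where "\<delta> = (1 - t) / 2"
  have \<delta>: "\<delta> > 0" "t + \<delta> < 1" "\<delta> \<le> 1" using t by (auto simp: \<delta>_def field_simps)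
  \<comment> \<open>\<open>K\<close> lies inside the open time interval, and its convexity keeps the
    segment from (t, x) to (t + h, x + k) in it.\<close>
  define K where "K = {t..t + \<delta>} \<times> cball c (r + 1)"
  have K: "compact K" "convex K" "K \<subseteq> spacetime" using t \<delta>
    by (auto simp: K_def intro!: compact_Times convex_Times)
  have "Cinf_on UNIV (\<lambda>x. F (t, x))"
    by (rule Cinf_on_slice[OF open_spacetime F]) (use t in auto)
  then have "Ck_on 3 UNIV (\<lambda>x. F (t, x))" by (simp add: Cinf_on_def)
  then obtain C1 where C1: "C1 \<ge> 0" "\<And>x k. x \<in> cball c r \<Longrightarrow>
      \<bar>F (t, x + k) - F (t, x) - dd k (\<lambda>x. F (t, x)) x - dd k (dd k (\<lambda>x. F (t, x))) x / 2\<bar> \<le> C1 * norm k ^ 3"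
    using second_order_Taylor_bounded[of "\<lambda>x. F (t, x)" "cball c r" M] M t by auto
  define G where "G = dt F"
  have G: "Cinf_on spacetime G" unfolding G_def by (rule Cinf_on_dd[OF F])
  have cont: "continuous_on K (dd v G)" "continuous_on K G" for v
    using Cinf_on_continuous[OF Cinf_on_dd[OF G]] Cinf_on_continuous[OF G] K(3) continuous_on_subset by blast+
  obtain B where B: "B \<ge> 0" "\<And>z. z \<in> K \<Longrightarrow> \<bar>G z\<bar> \<le> B" using compact_abs_bound[OF K(1) cont(2)] by blast
  obtain B0 where B0: "B0 \<ge> 0" "\<And>z. z \<in> K \<Longrightarrow> \<bar>dt G z\<bar> \<le> B0" using compact_abs_bound[OF K(1) cont(1)] by blast
  have "\<exists>C\<ge>0. \<forall>x\<in>K. \<bar>dx i G x\<bar> \<le> C" for i using compact_abs_bound[OF K(1) cont(1)] by metis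
  then obtain B1 where B1: "\<And>i. B1 i \<ge> 0" "\<And>i z. z \<in> K \<Longrightarrow> \<bar>dx i G z\<bar> \<le> B1 i" by metis
  define L where "L = B0 + (\<Sum>i\<in>UNIV. B1 i)"
  have L0: "0 \<le> L" "B0 \<le> L" "(\<Sum>i\<in>UNIV. B1 i) \<le> L" using B0 by (auto simp: L_def intro!: sum_nonneg B1 add_nonneg_nonneg)
  have Lip: "\<bar>G (t + h, x + k) - G (t, x)\<bar> \<le> L * (h + norm k)"
    if x: "x \<in> cball c r" and k: "norm k \<le> 1" and h: "0 \<le> h" "h \<le> \<delta>" for x k h
  proof -
    have xk: "x + k \<in> cball c (r + 1)" "x \<in> cball c (r + 1)"
      using x k norm_triangle_ineq4[of "c - x" k] by (auto simp: dist_norm algebra_simps)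
    have inK: "(t, x) + s *\<^sub>R (h, k) \<in> K" if "0 \<le> s" "s \<le> 1" for s
    proof -
      have "(1 - s) *\<^sub>R (t, x) + s *\<^sub>R (t + h, x + k) \<in> K"
        by (rule convexD_alt[OF K(2)]) (use h xk \<delta> that in \<open>auto simp: K_def\<close>)
      then show ?thesis by (simp add: algebra_simps)
    qed
    have "((\<lambda>s. G ((t, x) + s *\<^sub>R (h, k))) has_real_derivative dd (h, k) G ((t, x) + s *\<^sub>R (h, k))) (at s)"
      if "0 \<le> s" "s \<le> 1" for s
      by (rule DERIV_along_line, rule Cinf_on_differentiable[OF G]) (use inK[OF that] K(3) in blast)
    from MVT2[OF zero_less_one this] obtain s where s: "0 < s" "s < 1"
      "G ((t, x) + 1 *\<^sub>R (h, k)) - G ((t, x) + 0 *\<^sub>R (h, k)) = dd (h, k) G ((t, x) + s *\<^sub>R (h, k))" by auto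
    define z where "z = (t, x) + s *\<^sub>R (h, k)"
    have z: "z \<in> K" using inK s by (simp add: z_def)
    have "\<bar>dd (h, k) G z\<bar> \<le> \<bar>h * dt G z\<bar> + (\<Sum>i\<in>UNIV. \<bar>k $ i * dx i G z\<bar>)"
      unfolding dd_Pair[OF Cinf_on_differentiable[OF G subsetD[OF K(3) z]], of h k]
      by (intro abs_triangle_ineq[THEN order_trans] add_left_mono sum_abs)
    also have "\<dots> \<le> h * B0 + (\<Sum>i\<in>UNIV. norm k * B1 i)"
      using h B0(1) B1(1) B0(2)[OF z] B1(2)[OF z] by (intro add_mono sum_mono) (auto simp: abs_mult intro!: mult_mono component_le_norm_cart)
    also have "\<dots> = h * B0 + norm k * (\<Sum>i\<in>UNIV. B1 i)" by (simp add: sum_distrib_left)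
    also have "\<dots> \<le> h * L + norm k * L" using h L0 by (intro add_mono mult_left_mono) auto
    finally show ?thesis using s(3) by (simp add: z_def algebra_simps)
  qed
  have time: "\<bar>F (t + h, x + k) - F (t, x + k) - h * G (t, x)\<bar> \<le> L * (h ^ 2 + h * norm k)"
    if x: "x \<in> cball c r" and k: "norm k \<le> 1" and h: "0 \<le> h" "h \<le> \<delta>" for x k h
  proof (cases "h = 0")
    case False
    then have "t < t + h" using h by simp
    have "((\<lambda>s. F (s, x + k)) has_real_derivative G (s, x + k)) (at s)" if "t \<le> s" "s \<le> t + h" for s
      unfolding G_def by (rule DERIV_time, rule Cinf_on_differentiable[OF F]) (use that t h \<delta> in auto)
    from MVT2[OF \<open>t < t + h\<close> this] obtain s where s: "t < s" "s < t + h"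
      "F (t + h, x + k) - F (t, x + k) = h * G (s, x + k)" by auto
    have "\<bar>G (t + (s - t), x + k) - G (t, x)\<bar> \<le> L * ((s - t) + norm k)"
      by (rule Lip) (use x k s h in auto)
    also have "\<dots> \<le> L * (h + norm k)" using s L0 by (intro mult_left_mono) auto
    finally have "h * \<bar>G (s, x + k) - G (t, x)\<bar> \<le> h * (L * (h + norm k))"
      using h by (intro mult_left_mono) auto
    moreover have "\<bar>h * (G (s, x + k) - G (t, x))\<bar> = h * \<bar>G (s, x + k) - G (t, x)\<bar>"
      using h by (simp add: abs_mult)
    ultimately show ?thesis unfolding s(3) by (simp add: algebra_simps power2_eq_square)
  qed simp
  have M0: "0 \<le> M" using M[of "(t, 0)"] t by force
  define C where "C = L + C1 + 2 * M + B"
  have "\<bar>F (t + h, x + k) - F (t, x + k) - h * G (t, x)\<bar> \<le> (L + 2 * M + B) * (h ^ 2 + h * norm k + norm k ^ 3)"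
    if x: "x \<in> cball c r" and h: "0 \<le> h" "h \<le> \<delta>" for x k h
  proof (cases "norm k \<le> 1")
    case True
    have "L * (h ^ 2 + h * norm k) \<le> (L + 2 * M + B) * (h ^ 2 + h * norm k + norm k ^ 3)"
      using L0 M0 B h by (intro mult_mono) auto
    then show ?thesis using time[OF x True h] by linarith
  next
    case False
    \<comment> \<open>A long increment makes norm k ^ 3 at least 1, which absorbs the bounds on F
      and on its time derivative.\<close>
    have "\<bar>F (t + h, x + k)\<bar> \<le> M" "\<bar>F (t, x + k)\<bar> \<le> M" using M t h \<delta> by auto
    moreover have "\<bar>h * G (t, x)\<bar> \<le> 1 * B"
      using h \<delta> B x unfolding abs_mult by (intro mult_mono) (auto simp: K_def)
    moreover have "(L + 2 * M + B) * 1 \<le> (L + 2 * M + B) * (h ^ 2 + h * norm k + norm k ^ 3)"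
    proof (rule mult_left_mono)
      have "1 \<le> norm k ^ 3" using False by (intro one_le_power) auto
      moreover have "0 \<le> h ^ 2" "0 \<le> h * norm k" using h by auto
      ultimately show "1 \<le> h ^ 2 + h * norm k + norm k ^ 3" by linarith
    qed (use L0 M0 B in auto)
    moreover have "\<bar>F (t + h, x + k) - F (t, x + k) - h * G (t, x)\<bar> \<le> (L + 2 * M + B) * 1"
      if "\<bar>F (t + h, x + k)\<bar> \<le> M" "\<bar>F (t, x + k)\<bar> \<le> M" "\<bar>h * G (t, x)\<bar> \<le> 1 * B"
      using that L0 by (smt (verit))
    ultimately show ?thesis by (meson order_trans)
  qed
  moreover have "C1 * norm k ^ 3 \<le> C1 * (h ^ 2 + h * norm k + norm k ^ 3)" if "0 \<le> h" for h and k :: "real ^ 'n"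
    using C1 that by (intro mult_left_mono) auto
  ultimately have "\<bar>F (t + h, x + k) - F (t, x) - h * dt F (t, x) - dd k (\<lambda>x. F (t, x)) x - dd k (dd k (\<lambda>x. F (t, x))) x / 2\<bar>
        \<le> C * (h ^ 2 + h * norm k + norm k ^ 3)"
    if x: "x \<in> cball c r" and h: "0 \<le> h" "h \<le> \<delta>" for x k h
    using C1(2)[OF x, of k] that unfolding C_def G_def[symmetric] distrib_right[of "L + C1 + 2 * M" B] distrib_right[of _ "2 * M"] distrib_right[of L C1]
    by (smt (verit) distrib_right)
  moreover have "C \<ge> 0" using C1 L0 M0 B by (simp add: C_def)
  ultimately show ?thesis using that \<delta> by blast
qed

section \<open>Lebesgue integrals against compactly supported functions\<close>

lemma integrable_compact_support:
  fixes G :: "'a::euclidean_space \<Rightarrow> real"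
  assumes "continuous_on UNIV G" "\<And>x. x \<notin> cball c r \<Longrightarrow> G x = 0"
  shows "integrable lborel G"
proof -
  have "integrable lborel (\<lambda>x. indicator (cball c r) x *\<^sub>R G x)"
    by (rule borel_integrable_compact[OF compact_cball continuous_on_subset[OF assms(1) subset_UNIV]])
  also have "(\<lambda>x. indicator (cball c r) x *\<^sub>R G x) = G" using assms(2) by (auto simp: indicator_def fun_eq_iff)
  finally show ?thesis .
qed

lemma integral_translation:
  fixes G :: "'a::euclidean_space \<Rightarrow> real"
  assumes [measurable]: "G \<in> borel_measurable borel"
  shows "(LINT x|lborel. G (a + x)) = (LINT x|lborel. G x)"
  by (subst (2) lborel_distr_plus[symmetric, of a]) (simp add: integral_distr)

text \<open>Translation invariance gives every difference quotient of G integral zero, and dominated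
  convergence carries this over to the derivative.\<close>

lemma integral_dd_eq_0:
  fixes G :: "'a::euclidean_space \<Rightarrow> real"
  assumes G: "Ck_on 1 UNIV G" and supp: "\<And>x. x \<notin> cball c r \<Longrightarrow> G x = 0"
  shows "(LINT x|lborel. dd v G x) = 0"
proof -
  have d: "G differentiable (at x)" for x using G by (simp add: Ck_on_Suc_dd)
  have c: "continuous_on UNIV G" "continuous_on UNIV (dd v G)"
    using Ck_on_continuous[OF G] G by (auto simp: Ck_on_Suc_dd)
  then have [measurable]: "G \<in> borel_measurable borel" "dd v G \<in> borel_measurable borel"
    by (auto intro: borel_measurable_continuous_onI)
  \<comment> \<open>Enlarging the radius by norm v accommodates the supports of all difference
    quotients with step at most 1, which gives a common integrable majorant.\<close>
  obtain B where B: "B \<ge> 0" "\<And>x. x \<in> cball c (r + norm v) \<Longrightarrow> \<bar>dd v G x\<bar> \<le> B"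
    using compact_abs_bound[OF compact_cball continuous_on_subset[OF c(2) subset_UNIV]] by blast
  have B': "\<bar>dd v G x\<bar> \<le> B" for x
  proof (cases "x \<in> cball c r")
    case True
    then have "x \<in> cball c (r + norm v)" by (simp add: add_increasing2)
    then show ?thesis by (rule B(2))
  next
    case False
    then show ?thesis using dd_eq_0_outside[of c r G x v] supp B(1) by simp
  qed
  define Q where "Q = (\<lambda>n x. (G (inverse (real (Suc n)) *\<^sub>R v + x) - G x) / inverse (real (Suc n)))"
  have int: "integrable lborel G" by (rule integrable_compact_support[OF c(1) supp])
  have int': "integrable lborel (\<lambda>x. G (a + x))" for a
    using int by (subst (asm) lborel_distr_plus[symmetric, of a]) (simp add: integrable_distr_eq)
  have "(LINT x|lborel. Q n x) = 0" for n
    unfolding Q_def using int int' by (simp add: integral_translation)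
  moreover have "(\<lambda>n. LINT x|lborel. Q n x) \<longlonglongrightarrow> (LINT x|lborel. dd v G x)"
  proof (rule integral_dominated_convergence)
    show "Q n \<in> borel_measurable lborel" for n unfolding Q_def by measurable
    show "integrable lborel (\<lambda>x. B * indicator (cball c (r + norm v)) x)"
      using emeasure_bounded_finite[OF bounded_cball, of c "r + norm v"]
      by (intro integrable_mult_right integrable_real_indicator) auto
    show "AE x in lborel. (\<lambda>n. Q n x) \<longlonglongrightarrow> dd v G x"
    proof (rule AE_I2)
      fix x
      have "((\<lambda>s. G (x + s *\<^sub>R v)) has_real_derivative dd v G x) (at 0)"
        using DERIV_along_line[of G x 0 v] d by simp
      then have "((\<lambda>s. (G (x + s *\<^sub>R v) - G x) / s) \<longlongrightarrow> dd v G x) (at 0)"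
        by (simp add: DERIV_def)
      moreover have "filterlim (\<lambda>n. inverse (real (Suc n))) (at 0) sequentially"
        using LIMSEQ_inverse_real_of_nat by (auto simp: filterlim_at)
      ultimately show "(\<lambda>n. Q n x) \<longlonglongrightarrow> dd v G x"
        unfolding Q_def by (auto simp: add.commute dest: filterlim_compose)
    qed
    show "AE x in lborel. norm (Q n x) \<le> B * indicator (cball c (r + norm v)) x" for n
    proof (rule AE_I2)
      fix x
      define s where "s = inverse (real (Suc n))"
      have s: "0 < s" "s \<le> 1" by (auto simp: s_def inverse_le_1_iff)
      show "norm (Q n x) \<le> B * indicator (cball c (r + norm v)) x"
      proof (cases "x \<in> cball c (r + norm v)")
        case True
        have "((\<lambda>s. G (x + s *\<^sub>R v)) has_real_derivative dd v G (x + s *\<^sub>R v)) (at s)" for s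
          by (rule DERIV_along_line[OF d])
        from MVT2[OF s(1) this] obtain z where "G (x + s *\<^sub>R v) - G x = s * dd v G (x + z *\<^sub>R v)" by auto
        then have "Q n x = dd v G (x + z *\<^sub>R v)" using s unfolding Q_def s_def[symmetric] by (simp add: add.commute)
        then show ?thesis using B' True by simp
      next
        case False
        have "norm (s *\<^sub>R v) \<le> norm v" using s mult_left_le_one_le[of "norm v" s] by simp
        moreover have "r + norm v < norm (x - c)" using False by (simp add: dist_norm norm_minus_commute)
        moreover have "norm (x - c) \<le> norm (s *\<^sub>R v + x - c) + norm (s *\<^sub>R v)"
          using norm_triangle_ineq4[of "s *\<^sub>R v + x - c" "s *\<^sub>R v"] by (simp add: algebra_simps)
        ultimately have "r < norm (x - c)" "r < norm (s *\<^sub>R v + x - c)"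
          using norm_ge_zero[of v] by linarith+
        then have "x \<notin> cball c r" "s *\<^sub>R v + x \<notin> cball c r"
          by (auto simp: dist_norm norm_minus_commute[of c])
        then show ?thesis using supp False unfolding Q_def s_def[symmetric] by simp
      qed
    qed
  qed auto
  ultimately show ?thesis using LIMSEQ_unique by (auto simp: LIMSEQ_const_iff)
qed

lemma integration_by_parts:
  fixes q g :: "'a::euclidean_space \<Rightarrow> real"
  assumes q: "Ck_on 1 UNIV q" and g: "Ck_on 1 UNIV g" and supp: "\<And>x. x \<notin> cball c r \<Longrightarrow> g x = 0"
  shows "(LINT x|lborel. q x * dd v g x) = - (LINT x|lborel. g x * dd v q x)"
proof -
  have d: "q differentiable (at x)" "g differentiable (at x)" for x using q g by (auto simp: Ck_on_Suc_dd)
  have c: "continuous_on UNIV q" "continuous_on UNIV (dd v q)" "continuous_on UNIV g" "continuous_on UNIV (dd v g)"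
    using Ck_on_continuous[OF q] Ck_on_continuous[OF g] q g by (auto simp: Ck_on_Suc_dd)
  have "dd v (\<lambda>x. q x * g x) x = q x * dd v g x + g x * dd v q x" for x
    by (subst dd_unique[OF has_derivative_mult[OF has_derivative_dd[OF d(1)] has_derivative_dd[OF d(2)]]])
      (simp add: mult.commute)
  moreover have "(LINT x|lborel. dd v (\<lambda>x. q x * g x) x) = 0"
    by (rule integral_dd_eq_0[OF Ck_on_mult[OF open_UNIV q g]]) (use supp in auto)
  moreover have "integrable lborel (\<lambda>x. q x * dd v g x)"
    by (rule integrable_compact_support[OF continuous_on_mult[OF c(1,4)], of c r])
      (use dd_eq_0_outside[of c r g _ v] supp in simp)
  moreover have "integrable lborel (\<lambda>x. g x * dd v q x)"
    by (rule integrable_compact_support[OF continuous_on_mult[OF c(3,2)], of c r]) (use supp in simp)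
  ultimately show ?thesis by simp
qed

text \<open>The fundamental lemma of the calculus of variations with bumps as the only test
  functions: if Q were positive at x, a bump supported where Q is positive would give a positive
  integral, and likewise for -Q. It turns every tested identity below into a pointwise one.\<close>

lemma test_function_zero:
  fixes Q :: "'a::euclidean_space \<Rightarrow> real"
  assumes Q: "continuous_on UNIV Q" and m: "0 < m"
    and 0: "\<And>c r. 0 < r \<Longrightarrow> (LINT x|lborel. bump m c r x * Q x) = 0"
  shows "Q x = 0"
proof -
  have *: "\<not> 0 < P x" if P: "continuous_on UNIV P" and P0: "\<And>c r. 0 < r \<Longrightarrow> (LINT x|lborel. bump m c r x * P x) = 0"
    for P :: "'a \<Rightarrow> real"
  proof
    assume "0 < P x"
    moreover have "open (P -` {0<..})" by (rule open_vimage[OF open_greaterThan P])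
    ultimately obtain r where r: "0 < r" "cball x r \<subseteq> P -` {0<..}"
      using open_contains_cball by (metis greaterThan_iff vimage_eq)
    have pos: "0 \<le> bump m x r y * P y" for y
      using r bump_eq_0[of y x r m] m bump_nonneg[of m x r y] by (cases "y \<in> cball x r") force+
    have c: "continuous_on UNIV (\<lambda>y. bump m x r y * P y)"
      unfolding bump_def by (intro continuous_intros P)
    have "integrable lborel (\<lambda>y. bump m x r y * P y)"
      by (rule integrable_compact_support[OF c, of x r]) (use r m bump_eq_0[of _ x r m] in auto)
    then have "AE y in lborel. bump m x r y * P y = 0"
      using P0[OF r(1), of x] pos by (subst (asm) integral_nonneg_eq_0_iff_AE) auto
    moreover have "bump m x r y * P y \<noteq> 0" if "y \<in> ball x r" for y
      using subsetD[OF r(2), of y] that bump_pos[OF that, of m] by auto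
    ultimately have "AE y in lborel. y \<notin> ball x r" by (auto elim!: eventually_mono)
    then have "emeasure lborel (ball x r) = 0"
      by (subst (asm) AE_iff_measurable[of "ball x r"]) auto
    then show False using content_ball_pos[OF r(1), of x] by (simp add: measure_def)
  qed
  have "(LINT x|lborel. bump m c r x * - Q x) = 0" if "0 < r" for c r using 0[OF that, of c] by simp
  then have "\<not> 0 < - Q x" by (intro *) (auto intro!: continuous_intros Q)
  moreover have "\<not> 0 < Q x" by (intro * Q 0)
  ultimately show ?thesis by simp
qed

section \<open>Increments of a diffusion with additive noise\<close>

text \<open>\<open>lborel\<close> on vectors is the image of a product measure over the orthonormal
  basis, so Fubini for products applies once the basis vectors \<open>axis i 1\<close> are matched
  with the indices i.\<close>

lemma lborel_vec_prod:
  fixes f :: "'n::finite \<Rightarrow> real \<Rightarrow> real"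
  assumes f: "\<And>i. integrable lborel (f i)"
  shows "integrable lborel (\<lambda>x :: real ^ 'n. \<Prod>i\<in>UNIV. f i (x $ i))"
    and "(LINT x|lborel. (\<Prod>i\<in>UNIV. f i ((x :: real ^ 'n) $ i))) = (\<Prod>i\<in>UNIV. (LINT y|lborel. f i y))"
proof -
  have [measurable]: "f i \<in> borel_measurable borel" for i
    using borel_measurable_integrable[OF f[of i]] by simp
  interpret product_sigma_finite "\<lambda>_ :: real ^ 'n. lborel :: real measure" by standard
  have bij: "bij_betw (\<lambda>i. axis i 1 :: real ^ 'n) UNIV Basis"
    by (auto simp: bij_betw_def inj_on_def axis_eq_axis dest: axis_inverse)
  have reindex: "(\<Prod>b\<in>(Basis :: (real ^ 'n) set). h (axis_index b) (b :: real ^ 'n)) = (\<Prod>i\<in>UNIV. h i (axis i 1))"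
    for h :: "'n \<Rightarrow> real ^ 'n \<Rightarrow> real"
    using prod.reindex_bij_betw[OF bij, of "\<lambda>b. h (axis_index b) b"] by simp
  let ?M = "PiM (Basis :: (real ^ 'n) set) (\<lambda>_. lborel :: real measure)"
  have coord: "(\<Sum>b\<in>(Basis :: (real ^ 'n) set). y b *\<^sub>R b) $ i = y (axis i 1)" for y i
  proof -
    have "(\<Sum>b\<in>(Basis :: (real ^ 'n) set). y b *\<^sub>R b) \<bullet> axis i 1 = y (axis i 1)"
      by (rule inner_sum_left_Basis) simp
    then show ?thesis by (simp add: inner_axis)
  qed
  have m[measurable]: "(\<lambda>y. \<Sum>b\<in>(Basis :: (real ^ 'n) set). y b *\<^sub>R b) \<in> ?M \<rightarrow>\<^sub>M borel" by measurable
  have mp[measurable]: "(\<lambda>x :: real ^ 'n. \<Prod>i\<in>UNIV. f i (x $ i)) \<in> borel_measurable borel" by measurable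
  have eq: "(\<Prod>i\<in>UNIV. f i ((\<Sum>b\<in>(Basis :: (real ^ 'n) set). y b *\<^sub>R b) $ i)) =
      (\<Prod>b\<in>(Basis :: (real ^ 'n) set). f (axis_index b) (y b))" for y
    unfolding coord by (rule reindex[symmetric, of "\<lambda>i b. f i (y b)"])
  have "integrable ?M (\<lambda>y. \<Prod>b\<in>(Basis :: (real ^ 'n) set). f (axis_index b) (y b))"
    by (rule product_integrable_prod) (auto simp: f)
  then show "integrable lborel (\<lambda>x :: real ^ 'n. \<Prod>i\<in>UNIV. f i (x $ i))"
    unfolding lborel_eq[where 'a = "real ^ 'n"] by (subst integrable_distr_eq[OF m mp]) (simp only: eq)
  have "(LINT x|lborel. (\<Prod>i\<in>UNIV. f i ((x :: real ^ 'n) $ i))) =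
      (LINT y|?M. (\<Prod>b\<in>(Basis :: (real ^ 'n) set). f (axis_index b) (y b)))"
    unfolding lborel_eq[where 'a = "real ^ 'n"] by (subst integral_distr[OF m mp]) (simp only: eq)
  also have "\<dots> = (\<Prod>b\<in>(Basis :: (real ^ 'n) set). (LINT y|lborel. f (axis_index b) y))"
    by (rule product_integral_prod) (auto simp: f)
  also have "\<dots> = (\<Prod>i\<in>UNIV. (LINT y|lborel. f i y))"
    by (rule reindex[of "\<lambda>i b. LINT y|lborel. f i y"])
  finally show "(LINT x|lborel. (\<Prod>i\<in>UNIV. f i ((x :: real ^ 'n) $ i))) = (\<Prod>i\<in>UNIV. (LINT y|lborel. f i y))" .
qed

lemma gaussian_vector_prod:
  fixes Y :: "'w \<Rightarrow> real ^ 'n::finite" and m :: "'n \<Rightarrow> real \<Rightarrow> real"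
  assumes D: "distributed M lborel Y (\<lambda>x. ennreal (\<Prod>i\<in>UNIV. normal_density 0 s (x $ i)))"
    and m: "\<And>i. has_bochner_integral lborel (\<lambda>x. normal_density 0 s x * m i x) (c i)"
    and [measurable]: "\<And>i. m i \<in> borel_measurable borel"
  shows "has_bochner_integral M (\<lambda>w. \<Prod>i\<in>UNIV. m i (Y w $ i)) (\<Prod>i\<in>UNIV. c i)"
proof -
  have mm: "(\<lambda>x :: real ^ 'n. \<Prod>i\<in>UNIV. m i (x $ i)) \<in> borel_measurable lborel" by measurable
  have nn: "0 \<le> (\<Prod>i\<in>UNIV. normal_density 0 s (x $ i))" for x :: "real ^ 'n"
    by (intro prod_nonneg) simp
  have i: "integrable lborel (\<lambda>x. normal_density 0 s x * m i x)" for i using m by (rule integrable.intros)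
  have "integrable M (\<lambda>w. \<Prod>i\<in>UNIV. m i (Y w $ i))"
    using distributed_integrable[OF D mm nn] lborel_vec_prod(1)[of "\<lambda>i x. normal_density 0 s x * m i x", OF i] by (simp add: prod.distrib)
  moreover have "(LINT w|M. (\<Prod>i\<in>UNIV. m i (Y w $ i))) = (\<Prod>i\<in>UNIV. c i)"
    using distributed_integral[OF D mm nn] lborel_vec_prod(2)[of "\<lambda>i x. normal_density 0 s x * m i x", OF i] has_bochner_integral_integral_eq[OF m]
    by (simp add: prod.distrib)
  ultimately show ?thesis by (simp add: has_bochner_integral_iff)
qed

lemma gaussian_vector_moments:
  fixes Y :: "'w \<Rightarrow> real ^ 'n::finite"
  assumes D: "distributed M lborel Y (\<lambda>x. ennreal (\<Prod>i\<in>UNIV. normal_density 0 s (x $ i)))" and s: "0 < s"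
  shows gaussian_vector_mean: "has_bochner_integral M (\<lambda>w. Y w $ i) 0"
    and gaussian_vector_covariance:
      "has_bochner_integral M (\<lambda>w. Y w $ i * Y w $ j) (if i = j then s\<^sup>2 else 0)"
    and gaussian_vector_abs: "has_bochner_integral M (\<lambda>w. \<bar>Y w $ i\<bar>) (s * sqrt (2 / pi))"
    and gaussian_vector_abs_cube: "has_bochner_integral M (\<lambda>w. \<bar>Y w $ i\<bar> ^ 3) (2 * s ^ 3 * sqrt (2 / pi))"
proof -
  have one: "has_bochner_integral lborel (\<lambda>x. normal_density 0 s x * 1) 1"
    using normal_moment_even[OF s, of 0 0] by simp
  have mean: "has_bochner_integral lborel (\<lambda>x. normal_density 0 s x * x) 0"
    using normal_moment_odd[OF s, of 0 0] by simp
  have single: "has_bochner_integral M (\<lambda>w. u (Y w $ i)) c"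
    if "has_bochner_integral lborel (\<lambda>x. normal_density 0 s x * u x) c" and [measurable]: "u \<in> borel_measurable borel"
    for u c
  proof -
    \<comment> \<open>A function of one coordinate is a product in which all other factors are the
      constant 1, whose Gaussian mean is 1.\<close>
    have "has_bochner_integral M (\<lambda>w. \<Prod>k\<in>UNIV. (if k = i then u else (\<lambda>_. 1)) (Y w $ k)) (\<Prod>k\<in>UNIV. if k = i then c else 1)"
      by (rule gaussian_vector_prod[OF D]) (use that one in auto)
    moreover have "(\<Prod>k\<in>UNIV. (if k = i then u else (\<lambda>_. 1)) (Y w $ k)) = u (Y w $ i)" for w
      by (simp add: if_distribR)
    ultimately show ?thesis by simp
  qed
  show "has_bochner_integral M (\<lambda>w. Y w $ i) 0" by (rule single[OF mean]) simp
  show "has_bochner_integral M (\<lambda>w. \<bar>Y w $ i\<bar>) (s * sqrt (2 / pi))"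
    by (rule single) (use normal_moment_abs_odd[OF s, of 0 0] in simp_all)
  show "has_bochner_integral M (\<lambda>w. \<bar>Y w $ i\<bar> ^ 3) (2 * s ^ 3 * sqrt (2 / pi))"
    by (rule single) (use normal_moment_abs_odd[OF s, of 0 1] in \<open>simp_all add: eval_nat_numeral\<close>)
  show "has_bochner_integral M (\<lambda>w. Y w $ i * Y w $ j) (if i = j then s\<^sup>2 else 0)"
  proof (cases "i = j")
    case True
    have "has_bochner_integral lborel (\<lambda>x. normal_density 0 s x * x\<^sup>2) (s\<^sup>2)"
      using normal_moment_even[OF s, of 0 1] by (simp add: eval_nat_numeral)
    from single[OF this] True show ?thesis by (simp add: power2_eq_square)
  next
    case False
    \<comment> \<open>For distinct i and j the product contains two separate factors of mean
      zero.\<close>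
    have "has_bochner_integral M (\<lambda>w. \<Prod>k\<in>UNIV. (if k = i \<or> k = j then (\<lambda>x. x) else (\<lambda>_. 1)) (Y w $ k))
        (\<Prod>k\<in>UNIV. if k = i \<or> k = j then 0 else 1)"
      by (rule gaussian_vector_prod[OF D]) (use mean one in auto)
    moreover have "(\<Prod>k\<in>UNIV. if k = i \<or> k = j then 0 else 1) = (0 :: real)"
      by (rule prod_zero) auto
    moreover have "(\<Prod>k\<in>UNIV. (if k = i \<or> k = j then (\<lambda>x. x) else (\<lambda>_. 1)) (Y w $ k)) = Y w $ i * Y w $ j" for w
    proof -
      have "(\<Prod>k\<in>UNIV. (if k = i \<or> k = j then (\<lambda>x. x) else (\<lambda>_. 1)) (Y w $ k)) = (\<Prod>k\<in>{i, j}. Y w $ k)"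
        by (rule prod.mono_neutral_cong_right) auto
      then show ?thesis using False by simp
    qed
    ultimately show ?thesis using False by simp
  qed
qed

text \<open>Comparison with the largest coordinate; it reduces the third moment of the norm to third
  absolute moments of the coordinates.\<close>

lemma norm_vec_cube_le: "norm (x :: real ^ 'n::finite) ^ 3 \<le> real CARD('n) ^ 3 * (\<Sum>i\<in>UNIV. \<bar>x $ i\<bar> ^ 3)"
proof -
  obtain i where i: "\<And>j. \<bar>x $ j\<bar> \<le> \<bar>x $ i\<bar>"
  proof -
    have "Max (range (\<lambda>j. \<bar>x $ j\<bar>)) \<in> range (\<lambda>j. \<bar>x $ j\<bar>)" by (rule Max_in) auto
    then obtain i where "Max (range (\<lambda>j. \<bar>x $ j\<bar>)) = \<bar>x $ i\<bar>" by (rule imageE)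
    moreover have "\<bar>x $ j\<bar> \<le> Max (range (\<lambda>j. \<bar>x $ j\<bar>))" for j by (rule Max_ge) auto
    ultimately show ?thesis using that by metis
  qed
  have "norm x \<le> (\<Sum>j\<in>UNIV. \<bar>x $ j\<bar>)" by (rule norm_le_l1_cart)
  also have "\<dots> \<le> real CARD('n) * \<bar>x $ i\<bar>" using sum_bounded_above[of UNIV "\<lambda>j. \<bar>x $ j\<bar>"] i by simp
  finally have "norm x ^ 3 \<le> (real CARD('n) * \<bar>x $ i\<bar>) ^ 3" by (intro power_mono) auto
  also have "\<dots> = real CARD('n) ^ 3 * \<bar>x $ i\<bar> ^ 3" by (simp add: power_mult_distrib)
  also have "\<bar>x $ i\<bar> ^ 3 \<le> (\<Sum>i\<in>UNIV. \<bar>x $ i\<bar> ^ 3)" by (rule member_le_sum) auto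
  finally show ?thesis by (simp add: mult_left_mono)
qed

text \<open>Fixes one Brownian motion \<open>W\<close>, which \<open>solves_sde\<close> only asserts
  to exist, and an explicit bound \<open>B\<close> of the drift.\<close>

locale diffusion = prob_space M for M :: "'w measure" +
  fixes P F :: "real \<Rightarrow> 'w measure" and X W :: "real \<Rightarrow> 'w \<Rightarrow> real ^ 'n::finite"
    and b :: "real \<Rightarrow> real ^ 'n \<Rightarrow> real ^ 'n" and p :: "real \<Rightarrow> real ^ 'n \<Rightarrow> real" and \<sigma> B :: real
  assumes incr: "increasing_filtration M P" and adapted_P: "adapted P X"
    and decr: "decreasing_filtration M F" and adapted_F: "adapted F X"
    and bm: "brownian_motion M P W"
    and sde: "AE w in M. continuous_on {0..1} (\<lambda>t. X t w) \<and>
           (\<forall>t\<in>{0..1}. X t w = X 0 w + (LINT s:{0..t}|lborel. b s (X s w)) + \<sigma> *\<^sub>R W t w)"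
    and b_cont: "continuous_on ({0..1} \<times> UNIV) (\<lambda>(t, x). b t x)"
    and b_bound: "\<And>t x. t \<in> {0..1} \<Longrightarrow> norm (b t x) \<le> B"
    and density: "\<And>t. t \<in> {0<..1} \<Longrightarrow> distributed M lborel (X t) (\<lambda>x. ennreal (p t x))"
    and density_nonneg: "\<And>t x. t \<in> {0<..1} \<Longrightarrow> 0 \<le> p t x"
begin

lemma b_slice_continuous: "t \<in> {0..1} \<Longrightarrow> continuous_on UNIV (b t)"
proof -
  assume "t \<in> {0..1}"
  then have "continuous_on UNIV (\<lambda>x. (\<lambda>(t, x). b t x) (t, x))"
    by (intro continuous_on_compose2[OF b_cont]) (auto intro!: continuous_intros)
  then show ?thesis by simp
qed

lemma subalgebra_P: "t \<in> {0..1} \<Longrightarrow> subalgebra M (P t)"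
  using incr by (simp add: increasing_filtration_def)

lemma subalgebra_F: "t \<in> {0..1} \<Longrightarrow> subalgebra M (F t)"
  using decr by (simp add: decreasing_filtration_def)

lemma measurable_X_P: "t \<in> {0..1} \<Longrightarrow> X t \<in> borel_measurable (P t)"
  using adapted_P by (simp add: adapted_def)

lemma measurable_X_F: "t \<in> {0..1} \<Longrightarrow> X t \<in> borel_measurable (F t)"
  using adapted_F by (simp add: adapted_def)

lemma measurable_X: "t \<in> {0..1} \<Longrightarrow> X t \<in> borel_measurable M"
  using measurable_from_subalg[OF subalgebra_P] measurable_X_P by blast

lemma measurable_W: "t \<in> {0..1} \<Longrightarrow> W t \<in> borel_measurable M"
  by (rule measurable_from_subalg[OF subalgebra_P]) (use bm in \<open>auto simp: brownian_motion_def adapted_def\<close>)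

lemma bm_increment:
  assumes "0 \<le> s" "s < t" "t \<le> 1"
  shows "distributed M lborel (\<lambda>w. W t w - W s w) (\<lambda>x. ennreal (\<Prod>i\<in>UNIV. normal_density 0 (sqrt (t - s)) (x $ i)))"
    and "indep_set (sets (P s)) (sets (vimage_algebra (space M) (\<lambda>w. W t w - W s w) borel))"
  using bm assms unfolding brownian_motion_def by blast+

text \<open>Independence of sigma-algebras in the form in which it enters: a weight known at time s
  factors out of the expectation, so that Gaussian moments of the later increment can be
  inserted.\<close>

lemma bm_increment_indep:
  fixes \<zeta> :: "'w \<Rightarrow> real" and u :: "real ^ 'n \<Rightarrow> real"
  assumes st: "0 \<le> s" "s < t" "t \<le> 1"
    and \<zeta>: "\<zeta> \<in> borel_measurable (P s)" "integrable M \<zeta>"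
    and u: "u \<in> borel_measurable borel" and ui: "has_bochner_integral M (\<lambda>w. u (W t w - W s w)) c"
  shows "has_bochner_integral M (\<lambda>w. \<zeta> w * u (W t w - W s w)) (expectation \<zeta> * c)"
proof -
  have s: "s \<in> {0..1}" "t \<in> {0..1}" using st by auto
  have m: "(\<lambda>w. W t w - W s w) \<in> borel_measurable M" using measurable_W[OF s(1)] measurable_W[OF s(2)] by measurable
  have "{\<zeta> -` A \<inter> space M | A. A \<in> sets borel} \<subseteq> sets (P s)"
    using measurable_sets[OF \<zeta>(1)] subalgebra_P[OF s(1)] by (auto simp: subalgebra_def)
  then have 1: "sigma_sets (space M) {\<zeta> -` A \<inter> space M | A. A \<in> sets borel} \<subseteq> sets (P s)"
    using subalgebra_P[OF s(1)] sets.sigma_sets_subset by (metis (no_types, lifting) subalgebra_def)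
  \<comment> \<open>Preimages under u of the increment are preimages under the increment itself, so
    they belong to the sigma-algebra that is independent of \<open>P s\<close>.\<close>
  have "{(\<lambda>w. u (W t w - W s w)) -` A \<inter> space M | A. A \<in> sets borel}
      \<subseteq> {(\<lambda>w. W t w - W s w) -` A \<inter> space M | A. A \<in> sets borel}"
  proof safe
    fix A :: "real set" assume "A \<in> sets borel"
    then have "u -` A \<in> sets borel" using measurable_sets[OF u, of A] by simp
    then show "\<exists>A'. (\<lambda>w. u (W t w - W s w)) -` A \<inter> space M = (\<lambda>w. W t w - W s w) -` A' \<inter> space M \<and> A' \<in> sets borel"
      by (intro exI[of _ "u -` A"]) auto
  qed
  then have 2: "sigma_sets (space M) {(\<lambda>w. u (W t w - W s w)) -` A \<inter> space M | A. A \<in> sets borel}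
      \<subseteq> sets (vimage_algebra (space M) (\<lambda>w. W t w - W s w) borel)"
    unfolding vimage_algebra_def
    by (subst sets_measure_of) (auto intro!: sigma_sets_mono')
  have "indep_var borel \<zeta> borel (\<lambda>w. u (W t w - W s w))"
    unfolding indep_var_eq
  proof (intro conjI)
    show "\<zeta> \<in> borel_measurable M" by (rule borel_measurable_integrable[OF \<zeta>(2)])
    show "(\<lambda>w. u (W t w - W s w)) \<in> borel_measurable M" using u m by measurable
    show "indep_set (sigma_sets (space M) {\<zeta> -` A \<inter> space M | A. A \<in> sets borel})
      (sigma_sets (space M) {(\<lambda>w. u (W t w - W s w)) -` A \<inter> space M | A. A \<in> sets borel})"
      using bm_increment(2)[OF st] 1 2 unfolding indep_sets2_eq by blast
  qed
  from indep_var_lebesgue_integral[OF this \<zeta>(2)] indep_var_integrable[OF this \<zeta>(2)] ui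
  show ?thesis by (auto simp: has_bochner_integral_iff)
qed

text \<open>The time integral of the drift, written as increment minus noise: measurability is then
  immediate, and the integral form holds almost surely by \<open>drift_part_eq\<close>.\<close>

definition drift_part :: "real \<Rightarrow> real \<Rightarrow> 'w \<Rightarrow> real ^ 'n" where
  "drift_part s t w = X t w - X s w - \<sigma> *\<^sub>R (W t w - W s w)"

lemma measurable_drift_part:
  "s \<in> {0..1} \<Longrightarrow> t \<in> {0..1} \<Longrightarrow> drift_part s t \<in> borel_measurable M"
  unfolding drift_part_def using measurable_X[of s] measurable_X[of t] measurable_W[of s] measurable_W[of t]
  by measurable

text \<open>A single null set serves all pairs s, t, because the equation holds along the whole
  path. The Lebesgue integral becomes a gauge integral in order to split it at s.\<close>

lemma drift_part_eq:
  "AE w in M. continuous_on {0..1} (\<lambda>t. X t w) \<and> continuous_on {0..1} (\<lambda>r. b r (X r w)) \<and>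
     (\<forall>s t. 0 \<le> s \<longrightarrow> s \<le> t \<longrightarrow> t \<le> 1 \<longrightarrow> drift_part s t w = integral {s..t} (\<lambda>r. b r (X r w)))"
  using sde
proof (rule AE_mp, intro AE_I2 impI)
  fix w assume w: "continuous_on {0..1} (\<lambda>t. X t w) \<and>
           (\<forall>t\<in>{0..1}. X t w = X 0 w + (LINT s:{0..t}|lborel. b s (X s w)) + \<sigma> *\<^sub>R W t w)"
  have "continuous_on {0..1} (\<lambda>r. (\<lambda>(t, x). b t x) (r, X r w))"
    by (rule continuous_on_compose2[OF b_cont continuous_on_Pair[OF continuous_on_id conjunct1[OF w]]]) auto
  then have c: "continuous_on {0..1} (\<lambda>r. b r (X r w))" by simp
  have eq: "X t w = X 0 w + integral {0..t} (\<lambda>r. b r (X r w)) + \<sigma> *\<^sub>R W t w" if t: "t \<in> {0..1}" for t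
  proof -
    have "continuous_on {0..t} (\<lambda>r. b r (X r w))" by (rule continuous_on_subset[OF c]) (use t in auto)
    from set_borel_integral_eq_integral(2)[OF borel_integrable_atLeastAtMost'[OF this]]
    show ?thesis using w t by metis
  qed
  have "drift_part s t w = integral {s..t} (\<lambda>r. b r (X r w))" if st: "0 \<le> s" "s \<le> t" "t \<le> 1" for s t
  proof -
    have "(\<lambda>r. b r (X r w)) integrable_on {0..t}"
      by (rule integrable_continuous_real[OF continuous_on_subset[OF c]]) (use st in auto)
    from Henstock_Kurzweil_Integration.integral_combine[OF st(1,2) this] show ?thesis
      using eq[of s] eq[of t] st unfolding drift_part_def by (simp add: algebra_simps)
  qed
  with c w show "continuous_on {0..1} (\<lambda>t. X t w) \<and> continuous_on {0..1} (\<lambda>r. b r (X r w)) \<and>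
     (\<forall>s t. 0 \<le> s \<longrightarrow> s \<le> t \<longrightarrow> t \<le> 1 \<longrightarrow> drift_part s t w = integral {s..t} (\<lambda>r. b r (X r w)))" by blast
qed

lemma drift_part_bound:
  assumes "0 \<le> s" "s \<le> t" "t \<le> 1"
  shows "AE w in M. norm (drift_part s t w) \<le> B * (t - s)"
  using drift_part_eq
proof eventually_elim
  case (elim w)
  have "norm (integral {s..t} (\<lambda>r. b r (X r w))) \<le> B * (t - s)"
  proof (rule integral_bound)
    show "continuous_on {s..t} (\<lambda>r. b r (X r w))"
      by (rule continuous_on_subset[of "{0..1}"]) (use elim assms in auto)
  qed (use assms b_bound in auto)
  then show ?case using elim assms by simp
qed

text \<open>Along a continuous path, averages of the drift over intervals that shrink to t converge
  to its value at t, wherever t sits in the intervals.\<close>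

lemma drift_part_limit:
  assumes h: "\<And>n. 0 < h n" "h \<longlonglongrightarrow> 0" and s: "\<And>n. 0 \<le> s n" "\<And>n. s n \<le> t" "\<And>n. t \<le> s n + h n" "\<And>n. s n + h n \<le> 1"
  shows "AE w in M. (\<lambda>n. drift_part (s n) (s n + h n) w /\<^sub>R h n) \<longlonglongrightarrow> b t (X t w)"
  using drift_part_eq
proof eventually_elim
  case (elim w)
  define q where "q = (\<lambda>r. b r (X r w))"
  have c: "continuous_on {0..1} q" using elim by (simp add: q_def)
  have t: "t \<in> {0..1}" using order_trans[OF s(1) s(2)] order_trans[OF s(3) s(4)] by simp
  show ?case
  proof (rule LIMSEQ_I)
    fix e :: real assume e: "0 < e"
    then obtain d where d: "d > 0" "\<And>r. r \<in> {0..1} \<Longrightarrow> dist r t < d \<Longrightarrow> dist (q r) (q t) < e / 2"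
      using c t unfolding continuous_on_iff by (metis half_gt_zero)
    obtain N where N: "\<And>n. n \<ge> N \<Longrightarrow> norm (h n - 0) < d" using LIMSEQ_D[OF h(2) d(1)] by blast
    have "norm (drift_part (s n) (s n + h n) w /\<^sub>R h n - b t (X t w)) < e" if "n \<ge> N" for n
    proof -
      have sub: "{s n..s n + h n} \<subseteq> {0..1}" using s[of n] by auto
      have cs: "continuous_on {s n..s n + h n} q" by (rule continuous_on_subset[OF c sub])
      have "norm (integral {s n..s n + h n} (\<lambda>r. q r - q t)) \<le> e / 2 * (s n + h n - s n)"
      proof (rule integral_bound)
        show "norm (q r - q t) \<le> e / 2" if "r \<in> {s n..s n + h n}" for r
          using d(2)[of r] that sub N[OF \<open>n \<ge> N\<close>] s[of n] by (force simp: dist_norm)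
      qed (use h(1)[of n] in \<open>auto intro!: continuous_intros cs less_imp_le\<close>)
      moreover have "integral {s n..s n + h n} (\<lambda>r. q r - q t) = drift_part (s n) (s n + h n) w - h n *\<^sub>R q t"
        using elim s[of n] h(1)[of n] integrable_continuous_real[OF cs]
        by (subst Henstock_Kurzweil_Integration.integral_diff) (auto simp: q_def)
      moreover have "drift_part (s n) (s n + h n) w /\<^sub>R h n - q t = (drift_part (s n) (s n + h n) w - h n *\<^sub>R q t) /\<^sub>R h n"
        using h(1)[of n] by (simp add: scaleR_diff_right)
      ultimately have "norm (drift_part (s n) (s n + h n) w /\<^sub>R h n - q t) \<le> inverse (h n) * (e / 2 * h n)"
        using h(1)[of n] by (simp add: mult_left_mono)
      also have "\<dots> = e / 2" using h(1)[of n] by simp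
      finally have "norm (drift_part (s n) (s n + h n) w /\<^sub>R h n - q t) \<le> e / 2" .
      then show ?thesis using e by (simp add: q_def)
    qed
    then show "\<exists>N. \<forall>n\<ge>N. norm (drift_part (s n) (s n + h n) w /\<^sub>R h n - b t (X t w)) < e" by blast
  qed
qed

end

section \<open>Limits of weighted moments over shrinking time intervals\<close>

lemma borel_measurable_vec_nth: "(\<lambda>x :: real ^ 'n::finite. x $ i) \<in> borel_measurable borel"
  by (intro borel_measurable_continuous_onI continuous_intros)

lemma (in prob_space) bounded_convergence:
  fixes a :: "nat \<Rightarrow> 'a \<Rightarrow> real"
  assumes "\<And>n. a n \<in> borel_measurable M" "l \<in> borel_measurable M"
    and "AE w in M. (\<lambda>n. a n w) \<longlonglongrightarrow> l w" "\<And>n. AE w in M. \<bar>a n w\<bar> \<le> C"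
  shows "(\<lambda>n. expectation (a n)) \<longlonglongrightarrow> expectation l"
  by (rule integral_dominated_convergence[where w = "\<lambda>_. C"]) (use assms in auto)

text \<open>Forward increments are the case s n = t, backward increments the case s n = t - h n; the
  limits are proved once for both. In both cases s n is the left end point, at which weights must be
  measurable for independence to apply.\<close>

locale increment_sequence = diffusion M P F X W b p \<sigma> B
  for M :: "'w measure" and P F and X W :: "real \<Rightarrow> 'w \<Rightarrow> real ^ 'n::finite" and b p \<sigma> B +
  fixes t :: real and s h :: "nat \<Rightarrow> real"
  assumes t: "t \<in> {0<..<1}"
    and h_pos: "\<And>n. 0 < h n" and h_lim: "h \<longlonglongrightarrow> 0"
    and s_nonneg: "\<And>n. 0 \<le> s n" and s_le: "\<And>n. s n \<le> t" and le_s_h: "\<And>n. t \<le> s n + h n"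
    and s_h_le: "\<And>n. s n + h n \<le> 1"
begin

definition inc :: "nat \<Rightarrow> 'w \<Rightarrow> real ^ 'n" where "inc n w = X (s n + h n) w - X (s n) w"
definition dr :: "nat \<Rightarrow> 'w \<Rightarrow> real ^ 'n" where "dr n w = drift_part (s n) (s n + h n) w"
definition db :: "nat \<Rightarrow> 'w \<Rightarrow> real ^ 'n" where "db n w = W (s n + h n) w - W (s n) w"

lemma times: "s n \<in> {0..1}" "s n + h n \<in> {0..1}" "t \<in> {0..1}" "t \<in> {0<..1}"
  using s_nonneg[of n] s_h_le[of n] h_pos[of n] t by auto

lemma h_le_1: "h n \<le> 1"
  using s_nonneg[of n] s_h_le[of n] by simp

lemma inc_eq: "inc n w = dr n w + \<sigma> *\<^sub>R db n w"
  by (simp add: inc_def dr_def db_def drift_part_def)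

lemma measurable_inc [measurable]: "inc n \<in> borel_measurable M"
  and measurable_dr [measurable]: "dr n \<in> borel_measurable M"
  and measurable_db [measurable]: "db n \<in> borel_measurable M"
  unfolding inc_def dr_def db_def using measurable_X[OF times(1)] measurable_X[OF times(2)]
    measurable_W[OF times(1)] measurable_W[OF times(2)] measurable_drift_part[OF times(1,2)] by measurable

lemma measurable_components [measurable]:
  "(\<lambda>w. inc n w $ i) \<in> borel_measurable M" "(\<lambda>w. dr n w $ i) \<in> borel_measurable M"
  "(\<lambda>w. db n w $ i) \<in> borel_measurable M"
  by (rule measurable_compose[OF _ borel_measurable_vec_nth], measurable)+

lemma db_distributed: "distributed M lborel (db n) (\<lambda>x. ennreal (\<Prod>i\<in>UNIV. normal_density 0 (sqrt (h n)) (x $ i)))"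
  using bm_increment(1)[of "s n" "s n + h n"] s_nonneg h_pos s_h_le by (simp add: db_def[abs_def])

lemma db_indep:
  fixes \<zeta> :: "'w \<Rightarrow> real" and u :: "real ^ 'n \<Rightarrow> real"
  assumes "\<zeta> \<in> borel_measurable (P (s n))" "integrable M \<zeta>" "u \<in> borel_measurable borel"
    "has_bochner_integral M (\<lambda>w. u (db n w)) c"
  shows "has_bochner_integral M (\<lambda>w. \<zeta> w * u (db n w)) (expectation \<zeta> * c)"
  using bm_increment_indep[of "s n" "s n + h n" \<zeta> u c] assms s_nonneg h_pos s_h_le by (simp add: db_def)

lemma dr_bound: "AE w in M. norm (dr n w) \<le> B * h n"
  using drift_part_bound[of "s n" "s n + h n"] s_nonneg h_pos[of n] s_h_le by (simp add: dr_def)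

lemma dr_nth_bound: "AE w in M. \<bar>dr n w $ i\<bar> \<le> B * h n"
  using dr_bound[of n]
proof eventually_elim
  case (elim w)
  show ?case using order_trans[OF component_le_norm_cart elim] .
qed

lemma dr_limit: "AE w in M. (\<lambda>n. dr n w $ i / h n) \<longlonglongrightarrow> b t (X t w) $ i"
  using drift_part_limit[OF h_pos h_lim s_nonneg s_le le_s_h s_h_le]
proof eventually_elim
  case (elim w)
  from tendsto_vec_nth[OF this, of i] show ?case by (simp add: dr_def divide_inverse mult.commute)
qed

lemma B_nonneg: "0 \<le> B"
  using b_bound[of 0 0] norm_ge_zero by (meson order_trans atLeastAtMost_iff order_refl zero_le_one)

lemma measurable_P_M: "a \<in> borel_measurable (P (s n)) \<Longrightarrow> a \<in> borel_measurable M"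
  using measurable_from_subalg[OF subalgebra_P[OF times(1)]] .

lemma db_moments:
  shows "has_bochner_integral M (\<lambda>w. db n w $ i) 0"
    and "has_bochner_integral M (\<lambda>w. db n w $ i * db n w $ j) (if i = j then h n else 0)"
    and "has_bochner_integral M (\<lambda>w. \<bar>db n w $ i\<bar>) (sqrt (h n) * sqrt (2 / pi))"
    and "has_bochner_integral M (\<lambda>w. \<bar>db n w $ i\<bar> ^ 3) (2 * sqrt (h n) ^ 3 * sqrt (2 / pi))"
proof -
  have s: "0 < sqrt (h n)" using h_pos[of n] by simp
  note G = gaussian_vector_moments[OF db_distributed s]
  show "has_bochner_integral M (\<lambda>w. db n w $ i) 0" by (rule G)
  have eq: "(sqrt (h n))\<^sup>2 = h n" using h_pos[of n] by simp
  show "has_bochner_integral M (\<lambda>w. db n w $ i * db n w $ j) (if i = j then h n else 0)"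
    using G(2)[of i j] unfolding eq .
  show "has_bochner_integral M (\<lambda>w. \<bar>db n w $ i\<bar>) (sqrt (h n) * sqrt (2 / pi))" by (rule G)
  show "has_bochner_integral M (\<lambda>w. \<bar>db n w $ i\<bar> ^ 3) (2 * sqrt (h n) ^ 3 * sqrt (2 / pi))" by (rule G)
qed

lemma sqrt_h_lim: "(\<lambda>n. sqrt (h n)) \<longlonglongrightarrow> 0"
  using tendsto_real_sqrt[OF h_lim] by simp

text \<open>The noise has mean zero given the weight, which is known at the start of the interval.
  What remains is the drift, whose quotient by h n is bounded and converges.\<close>

lemma linear_limit:
  assumes a: "\<And>n. a n \<in> borel_measurable (P (s n))" and C: "\<And>n w. \<bar>a n w\<bar> \<le> C"
    and l: "l \<in> borel_measurable M" "AE w in M. (\<lambda>n. a n w) \<longlonglongrightarrow> l w"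
  shows "integrable M (\<lambda>w. a n w * inc n w $ i)"
    and "(\<lambda>n. expectation (\<lambda>w. a n w * inc n w $ i) / h n) \<longlonglongrightarrow> expectation (\<lambda>w. l w * b t (X t w) $ i)"
proof -
  have [measurable]: "a n \<in> borel_measurable M" for n by (rule measurable_P_M[OF a])
  have C0: "0 \<le> C" using C[of 0 undefined] by linarith
  have bd: "AE w in M. \<bar>a n w * dr n w $ i\<bar> \<le> C * (B * h n)" for n
    using dr_nth_bound[of n i] by eventually_elim (auto simp: abs_mult intro!: mult_mono C C0)
  have ia: "integrable M (a n)" for n using C by (intro integrable_const_bound[of _ C]) auto
  have id: "integrable M (\<lambda>w. a n w * dr n w $ i)" for n
  proof (rule integrable_const_bound)
    show "AE w in M. norm (a n w * dr n w $ i) \<le> C * (B * h n)" using bd[of n] by simp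
  qed measurable
  have db0: "has_bochner_integral M (\<lambda>w. a n w * db n w $ i) 0" for n
    using db_indep[OF a ia, of "\<lambda>x. x $ i" n 0] db_moments(1)[of n i] by simp
  have eq: "a n w * inc n w $ i = a n w * dr n w $ i + \<sigma> * (a n w * db n w $ i)" for n w
    by (simp add: inc_eq algebra_simps)
  show "integrable M (\<lambda>w. a n w * inc n w $ i)" for n
    unfolding eq using id db0 by (auto simp: has_bochner_integral_iff)
  have "expectation (\<lambda>w. a n w * inc n w $ i) = expectation (\<lambda>w. a n w * dr n w $ i)" for n
    unfolding eq using id db0 by (simp add: has_bochner_integral_iff)
  then have e: "expectation (\<lambda>w. a n w * inc n w $ i) / h n = expectation (\<lambda>w. a n w * (dr n w $ i / h n))" for n
    by (simp add: divide_inverse mult.assoc[symmetric])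
  have m: "(\<lambda>w. l w * b t (X t w) $ i) \<in> borel_measurable M"
  proof -
    have "(\<lambda>w. b t (X t w) $ i) \<in> borel_measurable M"
      by (intro measurable_compose[OF measurable_X[OF times(3)]] borel_measurable_continuous_onI
          continuous_on_component b_slice_continuous times)
    with l(1) show ?thesis by measurable
  qed
  show "(\<lambda>n. expectation (\<lambda>w. a n w * inc n w $ i) / h n) \<longlonglongrightarrow> expectation (\<lambda>w. l w * b t (X t w) $ i)"
    unfolding e
  proof (rule bounded_convergence[OF _ m, where C = "C * B"])
    show "AE w in M. (\<lambda>n. a n w * (dr n w $ i / h n)) \<longlonglongrightarrow> l w * b t (X t w) $ i"
      using l(2) dr_limit[of i] by eventually_elim (rule tendsto_mult)
    show "AE w in M. \<bar>a n w * (dr n w $ i / h n)\<bar> \<le> C * B" for n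
      using bd[of n] by eventually_elim (use h_pos[of n] in \<open>simp add: abs_mult field_simps\<close>)
  qed measurable
qed

text \<open>Only the product of two noise terms has order h n; its covariance is h n times the
  identity.\<close>

lemma quadratic_limit:
  assumes a: "\<And>n. a n \<in> borel_measurable (P (s n))" and C: "\<And>n w. \<bar>a n w\<bar> \<le> C"
    and l: "l \<in> borel_measurable M" "AE w in M. (\<lambda>n. a n w) \<longlonglongrightarrow> l w"
  shows "integrable M (\<lambda>w. a n w * (inc n w $ i * inc n w $ j))"
    and "(\<lambda>n. expectation (\<lambda>w. a n w * (inc n w $ i * inc n w $ j)) / h n)
      \<longlonglongrightarrow> (if i = j then \<sigma>\<^sup>2 * expectation l else 0)"
proof -
  have am[measurable]: "a n \<in> borel_measurable M" for n by (rule measurable_P_M[OF a])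
  have C0: "0 \<le> C" using C[of 0 undefined] by linarith
  have ia: "integrable M (a n)" for n using C by (intro integrable_const_bound[of _ C]) auto
  \<comment> \<open>\<open>r\<close> collects the products with at least one drift factor. They have
    order h * sqrt h or smaller, and \<open>R\<close> is their integrable majorant.\<close>
  define r where "r = (\<lambda>n w. a n w * (dr n w $ i * dr n w $ j + \<sigma> * (dr n w $ i * db n w $ j) + \<sigma> * (db n w $ i * dr n w $ j)))"
  define R where "R = (\<lambda>n w. C * (B * h n * (B * h n) + \<bar>\<sigma>\<bar> * (B * h n * \<bar>db n w $ j\<bar>) + \<bar>\<sigma>\<bar> * (\<bar>db n w $ i\<bar> * (B * h n))))"
  have bd: "AE w in M. \<bar>r n w\<bar> \<le> R n w" for n
    using dr_nth_bound[of n i] dr_nth_bound[of n j]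
  proof eventually_elim
    case (elim w)
    have "\<bar>dr n w $ i * dr n w $ j + \<sigma> * (dr n w $ i * db n w $ j) + \<sigma> * (db n w $ i * dr n w $ j)\<bar>
      \<le> \<bar>dr n w $ i * dr n w $ j\<bar> + \<bar>\<sigma> * (dr n w $ i * db n w $ j)\<bar> + \<bar>\<sigma> * (db n w $ i * dr n w $ j)\<bar>" by linarith
    also have "\<dots> \<le> B * h n * (B * h n) + \<bar>\<sigma>\<bar> * (B * h n * \<bar>db n w $ j\<bar>) + \<bar>\<sigma>\<bar> * (\<bar>db n w $ i\<bar> * (B * h n))"
      unfolding abs_mult using elim B_nonneg h_pos[of n]
      by (intro add_mono mult_mono mult_nonneg_nonneg) auto
    finally show ?case unfolding r_def R_def abs_mult[of "a n w"]
      by (rule mult_mono[OF C]) (use C0 in auto)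
  qed
  have R: "has_bochner_integral M (R n) (C * (B * h n * (B * h n) + \<bar>\<sigma>\<bar> * (B * h n * (sqrt (h n) * sqrt (2 / pi))) + \<bar>\<sigma>\<bar> * (sqrt (h n) * sqrt (2 / pi) * (B * h n))))" for n
  proof -
    have const: "has_bochner_integral M (\<lambda>w. k) k" for k :: real by (simp add: has_bochner_integral_iff prob_space)
    show ?thesis unfolding R_def
      by (rule has_bochner_integral_mult_right, rule has_bochner_integral_add, rule has_bochner_integral_add, rule const)
        (intro has_bochner_integral_mult_right has_bochner_integral_mult_left db_moments)+
  qed
  have rm[measurable]: "r n \<in> borel_measurable M" for n unfolding r_def by measurable
  have ir: "integrable M (r n)" for n
    by (rule Bochner_Integration.integrable_bound[OF integrable.intros[OF R[of n]] rm]) (use bd[of n] in \<open>auto elim!: eventually_mono\<close>)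
  have dbdb: "has_bochner_integral M (\<lambda>w. a n w * (db n w $ i * db n w $ j)) (expectation (a n) * (if i = j then h n else 0))" for n
    using db_indep[OF a ia, of "\<lambda>x. x $ i * x $ j" n] db_moments(2)[of n i j] by simp
  have eq: "a n w * (inc n w $ i * inc n w $ j) = r n w + \<sigma>\<^sup>2 * (a n w * (db n w $ i * db n w $ j))" for n w
    by (simp add: inc_eq r_def algebra_simps power2_eq_square)
  show "integrable M (\<lambda>w. a n w * (inc n w $ i * inc n w $ j))" for n
    unfolding eq using ir dbdb by (auto simp: has_bochner_integral_iff)
  have E: "expectation (\<lambda>w. a n w * (inc n w $ i * inc n w $ j)) / h n
      = expectation (r n) / h n + \<sigma>\<^sup>2 * (expectation (a n) * (if i = j then 1 else 0))" for n
    unfolding eq using ir dbdb[of n] h_pos[of n] by (simp add: has_bochner_integral_iff add_divide_distrib)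
  have rE: "\<bar>expectation (r n)\<bar> \<le> expectation (R n)" for n
  proof -
    have "\<bar>expectation (r n)\<bar> \<le> expectation (\<lambda>w. \<bar>r n w\<bar>)" by (rule integral_abs_bound)
    also have "\<dots> \<le> expectation (R n)"
      by (rule integral_mono_AE[OF integrable_abs[OF ir] integrable.intros[OF R] bd])
    finally show ?thesis .
  qed
  have rb: "\<bar>expectation (r n) / h n\<bar> \<le> C * (B * B * h n + 2 * \<bar>\<sigma>\<bar> * B * sqrt (2 / pi) * sqrt (h n))" for n
    using rE[of n] h_pos[of n] has_bochner_integral_integral_eq[OF R[of n]] by (simp add: field_simps)
  have "(\<lambda>n. C * (B * B * h n + 2 * \<bar>\<sigma>\<bar> * B * sqrt (2 / pi) * sqrt (h n))) \<longlonglongrightarrow> C * (B * B * 0 + 2 * \<bar>\<sigma>\<bar> * B * sqrt (2 / pi) * 0)"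
    by (intro tendsto_intros h_lim sqrt_h_lim)
  then have "(\<lambda>n. expectation (r n) / h n) \<longlonglongrightarrow> 0"
    by (intro Lim_null_comparison[of "\<lambda>n. expectation (r n) / h n"]) (use rb in auto)
  moreover have "(\<lambda>n. expectation (a n)) \<longlonglongrightarrow> expectation l"
    by (rule bounded_convergence[OF am l]) (use C in auto)
  ultimately have "(\<lambda>n. expectation (r n) / h n + \<sigma>\<^sup>2 * (expectation (a n) * (if i = j then 1 else 0)))
      \<longlonglongrightarrow> 0 + \<sigma>\<^sup>2 * (expectation l * (if i = j then 1 else 0))"
    by (intro tendsto_add tendsto_mult tendsto_const)
  then show "(\<lambda>n. expectation (\<lambda>w. a n w * (inc n w $ i * inc n w $ j)) / h n)
      \<longlonglongrightarrow> (if i = j then \<sigma>\<^sup>2 * expectation l else 0)"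
    unfolding E by (auto split: if_splits)
qed

text \<open>These orders make the expected Taylor remainder vanish after division by h n.\<close>

lemma norm_inc_moments:
  obtains D where "D \<ge> 0" "\<And>n. integrable M (\<lambda>w. norm (inc n w))" "\<And>n. integrable M (\<lambda>w. norm (inc n w) ^ 3)"
    "\<And>n. expectation (\<lambda>w. norm (inc n w)) \<le> D * sqrt (h n)"
    "\<And>n. expectation (\<lambda>w. norm (inc n w) ^ 3) \<le> D * (h n * sqrt (h n))"
proof -
  define N where "N = real CARD('n)"
  \<comment> \<open>The mean of |Z| for a standard normal Z; the mean of |Z|^3 is 2c.\<close>
  define c where "c = sqrt (2 / pi)"
  have pos: "0 \<le> N" "0 \<le> c" by (auto simp: N_def c_def)
  define Q1 where "Q1 = (\<lambda>n w. B * h n + \<bar>\<sigma>\<bar> * (\<Sum>i\<in>UNIV. \<bar>db n w $ i\<bar>))"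
  define Q3 where "Q3 = (\<lambda>n w. 4 * (B * h n) ^ 3 + 4 * \<bar>\<sigma>\<bar> ^ 3 * (N ^ 3 * (\<Sum>i\<in>UNIV. \<bar>db n w $ i\<bar> ^ 3)))"
  have const: "has_bochner_integral M (\<lambda>w. k) k" for k :: real by (simp add: has_bochner_integral_iff prob_space)
  have Q1: "has_bochner_integral M (Q1 n) (B * h n + \<bar>\<sigma>\<bar> * (\<Sum>i\<in>(UNIV :: 'n set). sqrt (h n) * c))" for n
    unfolding Q1_def c_def
    by (intro has_bochner_integral_add has_bochner_integral_mult_right has_bochner_integral_sum const db_moments)
  have Q3: "has_bochner_integral M (Q3 n) (4 * (B * h n) ^ 3 + 4 * \<bar>\<sigma>\<bar> ^ 3 * (N ^ 3 * (\<Sum>i\<in>(UNIV :: 'n set). 2 * sqrt (h n) ^ 3 * c)))" for n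
    unfolding Q3_def c_def
    by (intro has_bochner_integral_add has_bochner_integral_mult_right has_bochner_integral_sum const db_moments)
  have b1: "AE w in M. norm (inc n w) \<le> Q1 n w" for n
    using dr_bound[of n]
  proof eventually_elim
    case (elim w)
    have "norm (inc n w) \<le> norm (dr n w) + \<bar>\<sigma>\<bar> * norm (db n w)"
      using norm_triangle_ineq[of "dr n w" "\<sigma> *\<^sub>R db n w"] by (simp add: inc_eq)
    also have "\<dots> \<le> Q1 n w" unfolding Q1_def using elim norm_le_l1_cart[of "db n w"]
      by (intro add_mono mult_left_mono) auto
    finally show ?case .
  qed
  \<comment> \<open>The difference of the two sides factors as 3 (x + y) (x - y)^2.\<close>
  have cube: "(x + y) ^ 3 \<le> 4 * x ^ 3 + 4 * y ^ 3" if "0 \<le> x" "0 \<le> y" for x y :: real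
  proof -
    have "4 * x ^ 3 + 4 * y ^ 3 - (x + y) ^ 3 = 3 * (x + y) * (x - y)\<^sup>2"
      by (simp add: power3_eq_cube power2_eq_square algebra_simps)
    also have "\<dots> \<ge> 0" using that by simp
    finally show ?thesis by simp
  qed
  have b3: "AE w in M. norm (inc n w) ^ 3 \<le> Q3 n w" for n
    using dr_bound[of n]
  proof eventually_elim
    case (elim w)
    have "norm (inc n w) \<le> norm (dr n w) + \<bar>\<sigma>\<bar> * norm (db n w)"
      using norm_triangle_ineq[of "dr n w" "\<sigma> *\<^sub>R db n w"] by (simp add: inc_eq)
    also have "\<dots> \<le> B * h n + \<bar>\<sigma>\<bar> * norm (db n w)" using elim by simp
    finally have "norm (inc n w) ^ 3 \<le> (B * h n + \<bar>\<sigma>\<bar> * norm (db n w)) ^ 3" by (intro power_mono) auto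
    also have "\<dots> \<le> 4 * (B * h n) ^ 3 + 4 * (\<bar>\<sigma>\<bar> * norm (db n w)) ^ 3"
      using B_nonneg h_pos[of n] by (intro cube) auto
    also have "\<dots> \<le> Q3 n w" unfolding Q3_def N_def
      using norm_vec_cube_le[of "db n w"] by (simp add: power_mult_distrib mult_left_mono)
    finally show ?case .
  qed
  have i1: "integrable M (\<lambda>w. norm (inc n w))" for n
    by (rule Bochner_Integration.integrable_bound[OF integrable.intros[OF Q1[of n]]])
      (use b1[of n] in \<open>auto elim!: eventually_mono\<close>)
  have i3: "integrable M (\<lambda>w. norm (inc n w) ^ 3)" for n
    by (rule Bochner_Integration.integrable_bound[OF integrable.intros[OF Q3[of n]]])
      (use b3[of n] in \<open>auto elim!: eventually_mono\<close>)
  \<comment> \<open>The first two summands bound the first moment and the other two the third. The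
    power N ^ 4 is the N ^ 3 of \<open>norm_vec_cube_le\<close> times the number of
    coordinates.\<close>
  define D where "D = B + \<bar>\<sigma>\<bar> * (N * c) + 4 * B ^ 3 + 8 * \<bar>\<sigma>\<bar> ^ 3 * N ^ 4 * c"
  have D: "0 \<le> B + \<bar>\<sigma>\<bar> * (N * c)" "0 \<le> 4 * B ^ 3 + 8 * \<bar>\<sigma>\<bar> ^ 3 * N ^ 4 * c"
    using B_nonneg pos by auto
  have hs: "h n \<le> sqrt (h n)" for n
    using h_pos[of n] h_le_1[of n] by (intro real_le_rsqrt) (simp add: power2_eq_square mult_le_one mult_left_le)
  have "expectation (\<lambda>w. norm (inc n w)) \<le> D * sqrt (h n)" for n
  proof -
    have "expectation (\<lambda>w. norm (inc n w)) \<le> expectation (Q1 n)"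
      by (rule integral_mono_AE[OF i1 integrable.intros[OF Q1] b1])
    also have "\<dots> = B * h n + \<bar>\<sigma>\<bar> * (N * c) * sqrt (h n)"
      using has_bochner_integral_integral_eq[OF Q1[of n]] by (simp add: N_def mult_ac)
    also have "\<dots> \<le> B * sqrt (h n) + \<bar>\<sigma>\<bar> * (N * c) * sqrt (h n)"
      using hs[of n] B_nonneg by (intro add_right_mono mult_left_mono) auto
    also have "\<dots> = (B + \<bar>\<sigma>\<bar> * (N * c)) * sqrt (h n)" by (simp add: algebra_simps)
    also have "\<dots> \<le> D * sqrt (h n)" using D(2) h_pos[of n] by (intro mult_right_mono) (auto simp: D_def)
    finally show ?thesis .
  qed
  moreover have "expectation (\<lambda>w. norm (inc n w) ^ 3) \<le> D * (h n * sqrt (h n))" for n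
  proof -
    have s3: "sqrt (h n) ^ 3 = h n * sqrt (h n)" using h_pos[of n] by (simp add: power3_eq_cube)
    have "expectation (\<lambda>w. norm (inc n w) ^ 3) \<le> expectation (Q3 n)"
      by (rule integral_mono_AE[OF i3 integrable.intros[OF Q3] b3])
    also have "\<dots> = 4 * B ^ 3 * h n ^ 3 + 8 * \<bar>\<sigma>\<bar> ^ 3 * N ^ 4 * c * (h n * sqrt (h n))"
      using has_bochner_integral_integral_eq[OF Q3[of n]] h_pos[of n]
      by (simp add: N_def s3 power_mult_distrib eval_nat_numeral mult_ac)
    also have "\<dots> \<le> 4 * B ^ 3 * (h n * sqrt (h n)) + 8 * \<bar>\<sigma>\<bar> ^ 3 * N ^ 4 * c * (h n * sqrt (h n))"
    proof (intro add_right_mono mult_left_mono)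
      have "h n * h n \<le> 1 * sqrt (h n)" using h_le_1[of n] hs[of n] h_pos[of n] by (intro mult_mono) auto
      then show "h n ^ 3 \<le> h n * sqrt (h n)" using h_pos[of n] by (simp add: power3_eq_cube)
    qed (use B_nonneg in auto)
    also have "\<dots> = (4 * B ^ 3 + 8 * \<bar>\<sigma>\<bar> ^ 3 * N ^ 4 * c) * (h n * sqrt (h n))" by (simp add: algebra_simps)
    also have "\<dots> \<le> D * (h n * sqrt (h n))"
      using D(1) h_pos[of n] by (intro mult_right_mono) (auto simp: D_def)
    finally show ?thesis .
  qed
  moreover have "D \<ge> 0" using D by (simp add: D_def)
  ultimately show ?thesis using that i1 i3 by blast
qed

text \<open>The substitute for Ito's formula.\<close>

lemma expansion_limit:
  assumes a: "\<And>n i. a n i \<in> borel_measurable (P (s n))" "\<And>n i w. \<bar>a n i w\<bar> \<le> C"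
      "\<And>i. la i \<in> borel_measurable M" "\<And>i. AE w in M. (\<lambda>n. a n i w) \<longlonglongrightarrow> la i w"
      "\<And>i w. \<bar>la i w\<bar> \<le> C"
    and H: "\<And>n i j. H n i j \<in> borel_measurable (P (s n))" "\<And>n i j w. \<bar>H n i j w\<bar> \<le> C"
      "\<And>i j. lH i j \<in> borel_measurable M" "\<And>i j. AE w in M. (\<lambda>n. H n i j w) \<longlonglongrightarrow> lH i j w"
      "\<And>i j w. \<bar>lH i j w\<bar> \<le> C"
    and e: "e \<in> borel_measurable M" "\<And>w. \<bar>e w\<bar> \<le> C"
    and Y: "\<And>n. Y n \<in> borel_measurable M"
    and rem: "\<forall>\<^sub>F n in sequentially. \<forall>w. \<bar>Y n w - (h n * e w + (\<Sum>i\<in>UNIV. a n i w * inc n w $ i)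
        + (\<Sum>i\<in>UNIV. \<Sum>j\<in>UNIV. H n i j w * (inc n w $ i * inc n w $ j)) / 2)\<bar>
        \<le> C * ((h n)\<^sup>2 + h n * norm (inc n w) + norm (inc n w) ^ 3)"
  shows "(\<lambda>n. expectation (Y n) / h n) \<longlonglongrightarrow>
      expectation (\<lambda>w. e w + (\<Sum>i\<in>UNIV. la i w * b t (X t w) $ i) + \<sigma>\<^sup>2 / 2 * (\<Sum>i\<in>UNIV. lH i i w))"
proof -
  obtain D where D: "D \<ge> 0" "\<And>n. integrable M (\<lambda>w. norm (inc n w))" "\<And>n. integrable M (\<lambda>w. norm (inc n w) ^ 3)"
    "\<And>n. expectation (\<lambda>w. norm (inc n w)) \<le> D * sqrt (h n)"
    "\<And>n. expectation (\<lambda>w. norm (inc n w) ^ 3) \<le> D * (h n * sqrt (h n))"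
    using norm_inc_moments by blast
  have C0: "0 \<le> C" using e(2)[of undefined] by linarith
  note lin = linear_limit[where a = "\<lambda>n. a n i" and l = "la i" and C = C for i, OF a(1-4)]
  note quad = quadratic_limit[where a = "\<lambda>n. H n i j" and l = "lH i j" and C = C for i j, OF H(1-4)]
  \<comment> \<open>The weighted Taylor polynomial: its expectation is computable term by term, and
    \<open>Y n\<close> differs from it only by the remainder.\<close>
  define Z where "Z = (\<lambda>n w. h n * e w + (\<Sum>i\<in>UNIV. a n i w * inc n w $ i)
        + (\<Sum>i\<in>UNIV. \<Sum>j\<in>UNIV. H n i j w * (inc n w $ i * inc n w $ j)) / 2)"
  have ie: "integrable M e" using e by (intro integrable_const_bound[of _ C]) auto
  have iZ: "integrable M (Z n)" for n
    unfolding Z_def by (intro Bochner_Integration.integrable_add Bochner_Integration.integrable_sum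
      integrable_mult_right integrable_divide_zero ie lin(1) quad(1))
  have EZ: "expectation (Z n) / h n = expectation e + (\<Sum>i\<in>UNIV. expectation (\<lambda>w. a n i w * inc n w $ i) / h n)
      + (\<Sum>i\<in>UNIV. \<Sum>j\<in>UNIV. expectation (\<lambda>w. H n i j w * (inc n w $ i * inc n w $ j)) / h n) / 2" for n
  proof -
    have "expectation (Z n) = h n * expectation e + (\<Sum>i\<in>UNIV. expectation (\<lambda>w. a n i w * inc n w $ i))
      + (\<Sum>i\<in>UNIV. \<Sum>j\<in>UNIV. expectation (\<lambda>w. H n i j w * (inc n w $ i * inc n w $ j))) / 2"
      unfolding Z_def using ie lin(1) quad(1)
      by (simp add: Bochner_Integration.integral_add Bochner_Integration.integral_sum)
    then show ?thesis using h_pos[of n] by (simp add: add_divide_distrib sum_divide_distrib mult.commute)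
  qed
  have "(\<lambda>n. expectation (Z n) / h n) \<longlonglongrightarrow> expectation e
      + (\<Sum>i\<in>UNIV. expectation (\<lambda>w. la i w * b t (X t w) $ i))
      + (\<Sum>i\<in>UNIV. \<Sum>j\<in>UNIV. (if i = j then \<sigma>\<^sup>2 * expectation (lH i j) else 0)) / 2"
    unfolding EZ by (intro tendsto_add tendsto_const tendsto_sum tendsto_divide lin(2) quad(2)) simp
  moreover have "integrable M (\<lambda>w. la i w * b t (X t w) $ i)" for i
  proof (rule integrable_const_bound[of _ "C * B"])
    have "(\<lambda>w. b t (X t w) $ i) \<in> borel_measurable M"
      by (intro measurable_compose[OF measurable_X[OF times(3)]] borel_measurable_continuous_onI
          continuous_on_component b_slice_continuous times)
    then show "(\<lambda>w. la i w * b t (X t w) $ i) \<in> borel_measurable M" using a(3) by measurable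
    show "AE w in M. norm (la i w * b t (X t w) $ i) \<le> C * B"
      unfolding real_norm_def abs_mult
      by (intro AE_I2 mult_mono a(5) order_trans[OF component_le_norm_cart b_bound] times C0) simp
  qed
  moreover have "integrable M (lH i j)" for i j
    by (rule integrable_const_bound[of _ C]) (use H in auto)
  ultimately have limZ: "(\<lambda>n. expectation (Z n) / h n) \<longlonglongrightarrow>
      expectation (\<lambda>w. e w + (\<Sum>i\<in>UNIV. la i w * b t (X t w) $ i) + \<sigma>\<^sup>2 / 2 * (\<Sum>i\<in>UNIV. lH i i w))"
    using ie by (simp add: sum_divide_distrib sum_distrib_left)
  have "\<forall>\<^sub>F n in sequentially. norm (expectation (Y n) / h n - expectation (Z n) / h n)
      \<le> C * (h n + D * sqrt (h n) + D * sqrt (h n))"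
    using rem
  proof eventually_elim
    case (elim n)
    define Q where "Q = (\<lambda>w. C * ((h n)\<^sup>2 + h n * norm (inc n w) + norm (inc n w) ^ 3))"
    have iQ: "integrable M Q" unfolding Q_def using D by auto
    have bd: "\<bar>Y n w - Z n w\<bar> \<le> Q w" for w using elim unfolding Z_def Q_def by blast
    \<comment> \<open>Integrability of \<open>Y n\<close> is derived, not assumed: it is the
      integrable \<open>Z n\<close> plus a difference dominated by \<open>Q\<close>.\<close>
    have iYZ: "integrable M (\<lambda>w. Y n w - Z n w)"
      by (rule Bochner_Integration.integrable_bound[OF iQ])
        (use bd Y borel_measurable_integrable[OF iZ] in \<open>auto intro: order_trans[OF _ abs_ge_self]\<close>)
    have iY: "integrable M (Y n)" using Bochner_Integration.integrable_add[OF iYZ iZ[of n]] by simp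
    have "expectation (Y n) - expectation (Z n) = expectation (\<lambda>w. Y n w - Z n w)" using iY iZ by simp
    also have "\<bar>\<dots>\<bar> \<le> expectation (\<lambda>w. \<bar>Y n w - Z n w\<bar>)" by (rule integral_abs_bound)
    also have "\<dots> \<le> expectation Q" by (rule integral_mono[OF integrable_abs[OF iYZ] iQ bd])
    finally have "\<bar>expectation (Y n) - expectation (Z n)\<bar> \<le> expectation Q" .
    also have "expectation Q = C * ((h n)\<^sup>2 + h n * expectation (\<lambda>w. norm (inc n w)) + expectation (\<lambda>w. norm (inc n w) ^ 3))"
      unfolding Q_def using D by (simp add: prob_space)
    also have "\<dots> \<le> C * ((h n)\<^sup>2 + h n * (D * sqrt (h n)) + D * (h n * sqrt (h n)))"
      using C0 D h_pos[of n] by (intro mult_left_mono add_mono) auto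
    also have "\<dots> = C * (h n + D * sqrt (h n) + D * sqrt (h n)) * h n"
      by (simp add: power2_eq_square algebra_simps)
    finally have "\<bar>expectation (Y n) - expectation (Z n)\<bar> / h n \<le> C * (h n + D * sqrt (h n) + D * sqrt (h n))"
      using h_pos[of n] by (simp add: pos_divide_le_eq)
    then show ?case using h_pos[of n] by (simp add: diff_divide_distrib[symmetric])
  qed
  moreover have "(\<lambda>n. C * (h n + D * sqrt (h n) + D * sqrt (h n))) \<longlonglongrightarrow> 0"
  proof -
    have "(\<lambda>n. C * (h n + D * sqrt (h n) + D * sqrt (h n))) \<longlonglongrightarrow> C * (0 + D * 0 + D * 0)"
      by (intro tendsto_intros h_lim sqrt_h_lim)
    then show ?thesis by simp
  qed
  ultimately have "(\<lambda>n. expectation (Y n) / h n - expectation (Z n) / h n) \<longlonglongrightarrow> 0"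
    by (rule Lim_null_comparison)
  from tendsto_add[OF this limZ] show ?thesis by simp
qed

end

section \<open>Forward and backward difference quotients\<close>

lemma dd_mult:
  fixes f g :: "'a::euclidean_space \<Rightarrow> real"
  assumes "f differentiable (at x)" "g differentiable (at x)"
  shows "dd v (\<lambda>x. f x * g x) x = f x * dd v g x + dd v f x * g x"
  by (rule dd_unique[OF has_derivative_mult[OF has_derivative_dd[OF assms(1)] has_derivative_dd[OF assms(2)]]])

lemma dd_add:
  assumes "f differentiable (at x)" "g differentiable (at x)"
  shows "dd v (\<lambda>x. f x + g x) x = dd v f x + dd v g x"
  by (rule dd_unique[OF has_derivative_add[OF has_derivative_dd[OF assms(1)] has_derivative_dd[OF assms(2)]]])

lemma dd_diff:
  assumes "f differentiable (at x)" "g differentiable (at x)"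
  shows "dd v (\<lambda>x. f x - g x) x = dd v f x - dd v g x"
  by (rule dd_unique[OF has_derivative_diff[OF has_derivative_dd[OF assms(1)] has_derivative_dd[OF assms(2)]]])

lemma dd_cmult:
  fixes f :: "'a::euclidean_space \<Rightarrow> real"
  assumes "f differentiable (at x)"
  shows "dd v (\<lambda>x. c * f x) x = c * dd v f x"
  by (rule dd_unique[OF has_derivative_mult_right[OF has_derivative_dd[OF assms]]])

lemma Ck_on_exp:
  fixes f :: "'a::euclidean_space \<Rightarrow> real"
  assumes "open A"
  shows "Ck_on k A f \<Longrightarrow> Ck_on k A (\<lambda>x. exp (f x))"
proof (induction k)
  case 0
  then show ?case by (auto intro: continuous_on_exp)
next
  case (Suc k)
  have *: "((\<lambda>x. exp (f x)) has_derivative (\<lambda>v. dd v f x * exp (f x))) (at x)" if "x \<in> A" for x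
    using Suc.prems that by (auto simp: Ck_on_Suc_dd intro!: has_derivative_exp has_derivative_dd)
  have "Ck_on k A (dd v (\<lambda>x. exp (f x)))" for v
    by (rule Ck_on_cong[OF assms, of "\<lambda>x. dd v f x * exp (f x)"])
      (use dd_unique[OF *] Suc.IH[OF Ck_on_SucD[OF Suc.prems]] Ck_on_dd[OF Suc.prems]
        in \<open>auto intro!: Ck_on_mult[OF assms]\<close>)
  then show ?case using * unfolding Ck_on_Suc_dd differentiable_def by blast
qed

lemma Cinf_on_exp:
  fixes f :: "'a::euclidean_space \<Rightarrow> real"
  shows "open A \<Longrightarrow> Cinf_on A f \<Longrightarrow> Cinf_on A (\<lambda>x. exp (f x))"
  unfolding Cinf_on_def using Ck_on_exp by blast

lemma dd_exp:
  fixes f :: "'a::euclidean_space \<Rightarrow> real"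
  assumes "f differentiable (at x)"
  shows "dd v (\<lambda>x. exp (f x)) x = exp (f x) * dd v f x"
  by (subst dd_unique[OF has_derivative_exp[OF has_derivative_dd[OF assms]]]) simp

lemma compact_support_mult_bound:
  fixes g q :: "'a::euclidean_space \<Rightarrow> real"
  assumes "continuous_on UNIV g" "\<And>x. x \<notin> cball c r \<Longrightarrow> g x = 0" "continuous_on UNIV q"
  obtains C where "C \<ge> 0" "\<And>x. \<bar>g x * q x\<bar> \<le> C"
proof -
  have "continuous_on (cball c r) (\<lambda>x. g x * q x)"
    by (rule continuous_on_subset[OF continuous_on_mult[OF assms(1,3)] subset_UNIV])
  then obtain C where C: "C \<ge> 0" "\<And>x. x \<in> cball c r \<Longrightarrow> \<bar>g x * q x\<bar> \<le> C"
    using compact_abs_bound[OF compact_cball] by blast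
  have "\<bar>g x * q x\<bar> \<le> C" for x
    using C assms(2)[of x] by (cases "x \<in> cball c r") auto
  then show ?thesis using that C by blast
qed

lemma compact_support_family_bound:
  fixes f :: "'i::finite \<Rightarrow> 'a::euclidean_space \<Rightarrow> real"
  assumes "\<And>i. continuous_on UNIV (f i)" "\<And>i x. x \<notin> cball c r \<Longrightarrow> f i x = 0"
  obtains C where "C \<ge> 0" "\<And>i x. \<bar>f i x\<bar> \<le> C"
proof -
  have "\<exists>C\<ge>0. \<forall>x. \<bar>f i x * 1\<bar> \<le> C" for i
    by (rule compact_support_mult_bound[where q = "\<lambda>_. 1", OF assms continuous_on_const]) auto
  then obtain C where C: "\<And>i. C i \<ge> 0" "\<And>i x. \<bar>f i x\<bar> \<le> C i" by (metis mult.right_neutral)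
  have "C i \<le> (\<Sum>i\<in>UNIV. C i)" for i using C(1) by (intro member_le_sum) auto
  then show ?thesis using that[of "\<Sum>i\<in>UNIV. C i"] C by (meson order_trans sum_nonneg)
qed

lemma integrable_compact_support_mult:
  fixes g q :: "'a::euclidean_space \<Rightarrow> real"
  assumes "continuous_on UNIV g" "\<And>x. x \<notin> cball c r \<Longrightarrow> g x = 0" "continuous_on UNIV q"
  shows "integrable lborel (\<lambda>x. g x * q x)"
  by (rule integrable_compact_support[OF continuous_on_mult[OF assms(1,3)], of c r]) (simp add: assms)

lemma Cinf_on_slice_UNIV:
  assumes "Cinf_on spacetime F" "t \<in> {0<..<1}"
  shows "Cinf_on UNIV (\<lambda>x. F (t, x))"
  by (rule Cinf_on_slice[OF open_spacetime assms(1)]) (use assms in auto)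

lemma pdx_slice:
  assumes "Cinf_on spacetime F" "t \<in> {0<..<1}"
  shows "pdx i (\<lambda>x. F (t, x)) = (\<lambda>x. dx i F (t, x))"
  by (rule ext, rule dd_slice, rule Cinf_on_differentiable[OF assms(1)]) (use assms in auto)

context diffusion
begin

lemma expectation_density:
  assumes "t \<in> {0<..1}" "q \<in> borel_measurable borel"
  shows "expectation (\<lambda>w. q (X t w)) = (LINT x|lborel. p t x * (q x :: real))"
  using distributed_integral[OF density[OF assms(1)], of q] density_nonneg[OF assms(1)] assms(2) by simp

lemma measurable_comp_X:
  fixes q :: "real ^ 'n \<Rightarrow> real"
  assumes "t \<in> {0..1}" "continuous_on UNIV q"
  shows "(\<lambda>w. q (X t w)) \<in> borel_measurable (P t)" "(\<lambda>w. q (X t w)) \<in> borel_measurable M"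
    "(\<lambda>w. q (X t w)) \<in> borel_measurable (F t)"
  using measurable_compose[OF measurable_X_P[OF assms(1)] borel_measurable_continuous_onI[OF assms(2)]]
    measurable_compose[OF measurable_X[OF assms(1)] borel_measurable_continuous_onI[OF assms(2)]]
    measurable_compose[OF measurable_X_F[OF assms(1)] borel_measurable_continuous_onI[OF assms(2)]] .

text \<open>The weight g(X_t) is known at the start of the interval, and its support confines the
  base point of the expansion to a ball, so that for G a global bound and local derivative bounds
  are enough. The limit contains the forward generator.\<close>

lemma forward_limit:
  fixes G :: "real \<times> (real ^ 'n) \<Rightarrow> real" and g :: "real ^ 'n \<Rightarrow> real"
  assumes G: "Cinf_on spacetime G" and GM: "\<And>z. z \<in> spacetime \<Longrightarrow> \<bar>G z\<bar> \<le> K"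
    and g: "continuous_on UNIV g" and supp: "\<And>x. x \<notin> cball c r \<Longrightarrow> g x = 0"
    and t: "t \<in> {0<..<1}" and h: "\<And>n. 0 < h n" "h \<longlonglongrightarrow> 0" "\<And>n. t + h n < 1"
  shows "(\<lambda>n. expectation (\<lambda>w. g (X t w) * (G (t + h n, X (t + h n) w) - G (t, X t w))) / h n) \<longlonglongrightarrow>
    expectation (\<lambda>w. g (X t w) * (dt G (t, X t w) + (\<Sum>i\<in>UNIV. b t (X t w) $ i * dx i G (t, X t w))
       + \<sigma>\<^sup>2 / 2 * (\<Sum>i\<in>UNIV. dx i (dx i G) (t, X t w))))"
proof -
  interpret I: increment_sequence M P F X W b p \<sigma> B t "\<lambda>_. t" h
    by unfold_locales (use t h in \<open>auto intro: less_imp_le\<close>)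
  have t01: "t \<in> {0..1}" using t by auto
  have cont: "continuous_on UNIV (\<lambda>x. H (t, x))" if "Cinf_on spacetime H" for H :: "real \<times> (real ^ 'n) \<Rightarrow> real"
    by (rule Cinf_on_continuous[OF Cinf_on_slice_UNIV[OF that t]])
  note G1 = Cinf_on_dd[OF G] and G2 = Cinf_on_dd[OF Cinf_on_dd[OF G]]
  obtain C0 where C0: "C0 \<ge> 0" "\<And>x. \<bar>g x * dt G (t, x)\<bar> \<le> C0"
    using compact_support_mult_bound[OF g supp cont[OF G1]] by blast
  obtain C1 where C1: "C1 \<ge> 0" "\<And>i x. \<bar>g x * dx i G (t, x)\<bar> \<le> C1"
    by (rule compact_support_family_bound[of "\<lambda>i x. g x * dx i G (t, x)" c r])
      (use continuous_on_mult[OF g cont[OF G1]] supp in auto)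
  obtain C2 where C2: "C2 \<ge> 0" "\<And>i x. \<bar>g x * dx (fst i) (dx (snd i) G) (t, x)\<bar> \<le> C2"
    by (rule compact_support_family_bound[of "\<lambda>i x. g x * dx (fst i) (dx (snd i) G) (t, x)" c r])
      (use continuous_on_mult[OF g cont[OF G2]] supp in auto)
  obtain Cg where Cg: "Cg \<ge> 0" "\<And>x. \<bar>g x * 1\<bar> \<le> Cg"
    using compact_support_mult_bound[where q = "\<lambda>_. 1", OF g supp continuous_on_const] by auto
  have t0: "0 < t" "t < 1" using t by auto
  obtain CT \<delta> where T: "CT \<ge> 0" "\<delta> > 0" "t + \<delta> < 1"
    "\<And>x k h. x \<in> cball c r \<Longrightarrow> 0 \<le> h \<Longrightarrow> h \<le> \<delta> \<Longrightarrow>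
      \<bar>G (t + h, x + k) - G (t, x) - h * dt G (t, x) - dd k (\<lambda>x. G (t, x)) x - dd k (dd k (\<lambda>x. G (t, x))) x / 2\<bar>
        \<le> CT * (h ^ 2 + h * norm k + norm k ^ 3)"
    by (rule spacetime_Taylor[OF G GM t0, of c r]) (assumption, (rule that; assumption))
  define C where "C = C0 + C1 + C2 + Cg * CT"
  have CgT: "0 \<le> Cg * CT" using Cg T by simp
  have le: "C0 \<le> C" "C1 \<le> C" "C2 \<le> C" "Cg * CT \<le> C" using C0 C1 C2 CgT by (simp_all add: C_def)
  have slices: "pdx i (\<lambda>x. G (t, x)) = (\<lambda>x. dx i G (t, x))" "pdx i (\<lambda>x. dx j G (t, x)) = (\<lambda>x. dx i (dx j G) (t, x))" for i j
    using pdx_slice[OF G t] pdx_slice[OF G1 t] by auto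
  have Ck: "Ck_on k UNIV (\<lambda>x. G (t, x))" for k using Cinf_on_slice_UNIV[OF G t] by (simp add: Cinf_on_def)
  have diff: "(\<lambda>x. G (t, x)) differentiable (at x)" for x
    using Cinf_on_differentiable[OF Cinf_on_slice_UNIV[OF G t]] by simp
  note mes = measurable_comp_X[OF t01]
  let ?a = "\<lambda>i w. g (X t w) * dx i G (t, X t w)"
  let ?H = "\<lambda>i j w. g (X t w) * dx i (dx j G) (t, X t w)"
  let ?e = "\<lambda>w. g (X t w) * dt G (t, X t w)"
  have "(\<lambda>n. expectation (\<lambda>w. g (X t w) * (G (t + h n, X (t + h n) w) - G (t, X t w))) / h n) \<longlonglongrightarrow>
    expectation (\<lambda>w. ?e w + (\<Sum>i\<in>UNIV. ?a i w * b t (X t w) $ i) + \<sigma>\<^sup>2 / 2 * (\<Sum>i\<in>UNIV. ?H i i w))"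
  proof (rule I.expansion_limit[where a = "\<lambda>n. ?a" and H = "\<lambda>n. ?H" and la = ?a and lH = ?H and C = C])
    show "?a i \<in> borel_measurable (P t)" "?a i \<in> borel_measurable M" for i
      by (rule mes[OF continuous_on_mult[OF g cont[OF G1]]])+
    show "?H i j \<in> borel_measurable (P t)" "?H i j \<in> borel_measurable M" for i j
      by (rule mes[OF continuous_on_mult[OF g cont[OF G2]]])+
    show "?e \<in> borel_measurable M"
      by (rule mes[OF continuous_on_mult[OF g cont[OF G1]]])
    show "\<bar>?a i w\<bar> \<le> C" "\<bar>?a i w\<bar> \<le> C" for i w by (rule order_trans[OF C1(2) le(2)])+
    show "\<bar>?H i j w\<bar> \<le> C" "\<bar>?H i j w\<bar> \<le> C" for i j w using order_trans[OF C2(2)[of _ "(i, j)"] le(3)] by simp_all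
    show "\<bar>?e w\<bar> \<le> C" for w using order_trans[OF C0(2) le(1)] .
    show "(\<lambda>w. g (X t w) * (G (t + h n, X (t + h n) w) - G (t, X t w))) \<in> borel_measurable M" for n
    proof -
      have "t + h n \<in> {0<..<1}" "t + h n \<in> {0..1}" using t h(1)[of n] h(3)[of n] by auto
      then have "(\<lambda>w. G (t + h n, X (t + h n) w)) \<in> borel_measurable M"
        by (intro measurable_comp_X Cinf_on_continuous[OF Cinf_on_slice_UNIV[OF G]])
      with mes(2)[OF g] mes(2)[OF cont[OF G]] show ?thesis by measurable
    qed
    have "\<forall>\<^sub>F n in sequentially. h n < \<delta>" using order_tendstoD(2)[OF h(2) T(2)] .
    then show "\<forall>\<^sub>F n in sequentially. \<forall>w. \<bar>g (X t w) * (G (t + h n, X (t + h n) w) - G (t, X t w)) - (h n * ?e w + (\<Sum>i\<in>UNIV. ?a i w * I.inc n w $ i)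
        + (\<Sum>i\<in>UNIV. \<Sum>j\<in>UNIV. ?H i j w * (I.inc n w $ i * I.inc n w $ j)) / 2)\<bar>
        \<le> C * ((h n)\<^sup>2 + h n * norm (I.inc n w) + norm (I.inc n w) ^ 3)"
    proof (eventually_elim, intro allI)
      fix n w assume hn: "h n < \<delta>"
      define x where "x = X t w"
      define k where "k = I.inc n w"
      have xk: "X (t + h n) w = x + k" by (simp add: x_def k_def I.inc_def)
      define T where "T = G (t + h n, x + k) - G (t, x) - h n * dt G (t, x) - dd k (\<lambda>x. G (t, x)) x - dd k (dd k (\<lambda>x. G (t, x))) x / 2"
      have eq: "g x * (G (t + h n, x + k) - G (t, x)) - (h n * (g x * dt G (t, x)) + (\<Sum>i\<in>UNIV. g x * dx i G (t, x) * k $ i)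
        + (\<Sum>i\<in>UNIV. \<Sum>j\<in>UNIV. g x * dx i (dx j G) (t, x) * (k $ i * k $ j)) / 2) = g x * T"
        unfolding T_def dd_sum_axis[OF diff, of k] dd_dd_sum_axis[OF Ck, of k] slices
        by (simp add: sum_distrib_left algebra_simps)
      have nn: "0 \<le> (h n)\<^sup>2 + h n * norm k + norm k ^ 3" using h(1)[of n] by simp
      have "\<bar>g x * T\<bar> \<le> Cg * CT * ((h n)\<^sup>2 + h n * norm k + norm k ^ 3)"
      proof (cases "x \<in> cball c r")
        case True
        have "\<bar>g x\<bar> * \<bar>T\<bar> \<le> Cg * (CT * ((h n)\<^sup>2 + h n * norm k + norm k ^ 3))"
          using T(4)[OF True, of "h n" k] hn h(1)[of n] Cg unfolding T_def by (intro mult_mono) auto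
        then show ?thesis by (simp add: abs_mult mult.assoc)
      next
        case False
        then show ?thesis using supp CgT nn by simp
      qed
      also have "\<dots> \<le> C * ((h n)\<^sup>2 + h n * norm k + norm k ^ 3)" by (rule mult_right_mono[OF le(4) nn])
      finally show "\<bar>g (X t w) * (G (t + h n, X (t + h n) w) - G (t, X t w)) - (h n * ?e w + (\<Sum>i\<in>UNIV. ?a i w * I.inc n w $ i)
        + (\<Sum>i\<in>UNIV. \<Sum>j\<in>UNIV. ?H i j w * (I.inc n w $ i * I.inc n w $ j)) / 2)\<bar>
        \<le> C * ((h n)\<^sup>2 + h n * norm (I.inc n w) + norm (I.inc n w) ^ 3)"
        unfolding xk x_def[symmetric] k_def[symmetric] eq .
    qed
  qed auto
  then show ?thesis by (simp add: sum_distrib_left algebra_simps)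
qed

text \<open>Here G is the weight and g is expanded: G at time t - h n is known at the start of the
  interval from t - h n to t, whereas g(X_t) is not.\<close>

lemma backward_increment_limit:
  fixes G :: "real \<times> (real ^ 'n) \<Rightarrow> real" and g :: "real ^ 'n \<Rightarrow> real"
  assumes G: "Cinf_on spacetime G" and GM: "\<And>z. z \<in> spacetime \<Longrightarrow> \<bar>G z\<bar> \<le> K"
    and g: "Ck_on 3 UNIV g" and supp: "\<And>x. x \<notin> cball c r \<Longrightarrow> g x = 0"
    and t: "t \<in> {0<..<1}" and h: "\<And>n. 0 < h n" "h \<longlonglongrightarrow> 0" "\<And>n. 0 < t - h n"
  shows "(\<lambda>n. expectation (\<lambda>w. G (t - h n, X (t - h n) w) * (g (X t w) - g (X (t - h n) w))) / h n) \<longlonglongrightarrow>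
    expectation (\<lambda>w. G (t, X t w) * ((\<Sum>i\<in>UNIV. b t (X t w) $ i * pdx i g (X t w))
       + \<sigma>\<^sup>2 / 2 * (\<Sum>i\<in>UNIV. pdx i (pdx i g) (X t w))))"
proof -
  interpret I: increment_sequence M P F X W b p \<sigma> B t "\<lambda>n. t - h n" h
    by unfold_locales (use t h in \<open>auto intro: less_imp_le\<close>)
  have t01: "t \<in> {0..1}" using t by auto
  have K0: "0 \<le> K" using GM[of "(t, 0)"] t by force
  have sn: "t - h n \<in> {0<..<1}" "t - h n \<in> {0..1}" for n using t h(1)[of n] h(3)[of n] by auto
  have contG: "continuous_on UNIV (\<lambda>x. G (s, x))" if "s \<in> {0<..<1}" for s
    by (rule Cinf_on_continuous[OF Cinf_on_slice_UNIV[OF G that]])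
  have g1: "Ck_on 2 UNIV (dd v g)" for v using g by (simp add: numeral_3_eq_3 numeral_2_eq_2 Ck_on_Suc_dd)
  have g2: "Ck_on 1 UNIV (dd u (dd v g))" for u v using g1 by (simp add: numeral_2_eq_2 Ck_on_Suc_dd)
  note c1 = Ck_on_continuous[OF g1] and c2 = Ck_on_continuous[OF g2]
  have s1: "x \<notin> cball c r \<Longrightarrow> dd v g x = 0" for x v using dd_eq_0_outside[of c r g] supp by blast
  have s2: "x \<notin> cball c r \<Longrightarrow> dd u (dd v g) x = 0" for x u v using dd_eq_0_outside[of c r "dd v g"] s1 by blast
  obtain C1 where C1: "C1 \<ge> 0" "\<And>i x. \<bar>pdx i g x\<bar> \<le> C1"
    by (rule compact_support_family_bound[of "\<lambda>i. pdx i g" c r]) (use c1 s1 in auto)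
  obtain C2 where C2: "C2 \<ge> 0" "\<And>i x. \<bar>pdx (fst i) (pdx (snd i) g) x\<bar> \<le> C2"
    by (rule compact_support_family_bound[of "\<lambda>i. pdx (fst i) (pdx (snd i) g)" c r]) (use c2 s2 in auto)
  \<comment> \<open>The factor G is bounded but not compactly supported, so nothing localizes X(t -
    h n); the Taylor estimate for g has to be uniform in the base point.\<close>
  obtain CT where T: "CT \<ge> 0" "\<And>x k. \<bar>g (x + k) - g x - dd k g x - dd k (dd k g) x / 2\<bar> \<le> CT * norm k ^ 3"
    by (rule second_order_Taylor_compact_support[OF g supp]) (assumption, (rule that; assumption))
  define C' where "C' = C1 + C2 + CT"
  have le: "C1 \<le> C'" "C2 \<le> C'" "CT \<le> C'" "0 \<le> C'" using C1 C2 T by (simp_all add: C'_def)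
  have Gb: "\<bar>G (t - h n, X (t - h n) w)\<bar> \<le> K" for n w using GM sn(1)[of n] by simp
  have diff: "g differentiable (at x)" for x using g by (simp add: numeral_3_eq_3 Ck_on_Suc_dd)
  \<comment> \<open>The weights move with n, and continuity of the paths supplies their
    limits.\<close>
  have path: "AE w in M. (\<lambda>n. (t - h n, X (t - h n) w)) \<longlonglongrightarrow> (t, X t w)"
    using drift_part_eq
  proof eventually_elim
    case (elim w)
    have "(\<lambda>n. t - h n) \<longlonglongrightarrow> t - 0" by (intro tendsto_intros h(2))
    then have lim: "(\<lambda>n. t - h n) \<longlonglongrightarrow> t" by simp
    have "continuous_on {0..1} (\<lambda>t. X t w)" using elim by blast
    then have "(\<lambda>n. X (t - h n) w) \<longlonglongrightarrow> X t w"
      by (rule continuous_on_tendsto_compose[OF _ lim t01]) (use sn in auto)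
    with lim show ?case by (rule tendsto_Pair)
  qed
  have limq: "AE w in M. (\<lambda>n. G (t - h n, X (t - h n) w) * q (X (t - h n) w)) \<longlonglongrightarrow> G (t, X t w) * q (X t w)"
    if q: "continuous_on UNIV q" for q :: "real ^ 'n \<Rightarrow> real"
    using path
  proof eventually_elim
    case (elim w)
    have "(t, X t w) \<in> spacetime" using t by auto
    then have "isCont G (t, X t w)"
      using Cinf_on_continuous[OF G] continuous_on_eq_continuous_at[OF open_spacetime] by blast
    then have "(\<lambda>n. G (t - h n, X (t - h n) w)) \<longlonglongrightarrow> G (t, X t w)"
      using isCont_tendsto_compose elim by blast
    moreover have "isCont q (X t w)" using q by (simp add: continuous_on_eq_continuous_at)
    then have "(\<lambda>n. q (X (t - h n) w)) \<longlonglongrightarrow> q (X t w)"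
      using isCont_tendsto_compose tendsto_snd[OF elim] by fastforce
    ultimately show ?case by (rule tendsto_mult)
  qed
  note mesn = measurable_comp_X[OF sn(2)] and mes = measurable_comp_X[OF t01]
  let ?a = "\<lambda>n i w. G (t - h n, X (t - h n) w) * pdx i g (X (t - h n) w)"
  let ?H = "\<lambda>n i j w. G (t - h n, X (t - h n) w) * pdx i (pdx j g) (X (t - h n) w)"
  let ?la = "\<lambda>i w. G (t, X t w) * pdx i g (X t w)"
  let ?lH = "\<lambda>i j w. G (t, X t w) * pdx i (pdx j g) (X t w)"
  have "(\<lambda>n. expectation (\<lambda>w. G (t - h n, X (t - h n) w) * (g (X t w) - g (X (t - h n) w))) / h n) \<longlonglongrightarrow>
    expectation (\<lambda>w. 0 + (\<Sum>i\<in>UNIV. ?la i w * b t (X t w) $ i) + \<sigma>\<^sup>2 / 2 * (\<Sum>i\<in>UNIV. ?lH i i w))"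
  proof (rule I.expansion_limit[where a = ?a and H = ?H and la = ?la and lH = ?lH and C = "K * C'"])
    show "?a n i \<in> borel_measurable (P (t - h n))" for n i
      by (rule mesn[OF continuous_on_mult[OF contG[OF sn(1)] c1]])
    show "?H n i j \<in> borel_measurable (P (t - h n))" for n i j
      by (rule mesn[OF continuous_on_mult[OF contG[OF sn(1)] c2]])
    show "?la i \<in> borel_measurable M" for i
      by (rule mes[OF continuous_on_mult[OF contG[OF t] c1]])
    show "?lH i j \<in> borel_measurable M" for i j
      by (rule mes[OF continuous_on_mult[OF contG[OF t] c2]])
    show "\<bar>?a n i w\<bar> \<le> K * C'" for n i w
      unfolding abs_mult by (intro mult_mono Gb order_trans[OF C1(2) le(1)] K0) auto
    have C2': "\<bar>pdx i (pdx j g) x\<bar> \<le> C'" for i j x using order_trans[OF C2(2)[of "(i, j)"] le(2)] by simp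
    show "\<bar>?H n i j w\<bar> \<le> K * C'" for n i j w
      unfolding abs_mult by (intro mult_mono Gb C2' K0) auto
    have Gt: "\<bar>G (t, X t w)\<bar> \<le> K" for w using GM t by simp
    show "\<bar>?la i w\<bar> \<le> K * C'" for i w
      unfolding abs_mult by (intro mult_mono Gt order_trans[OF C1(2) le(1)] K0) auto
    show "\<bar>?lH i j w\<bar> \<le> K * C'" for i j w
      unfolding abs_mult by (intro mult_mono Gt C2' K0) auto
    show "AE w in M. (\<lambda>n. ?a n i w) \<longlonglongrightarrow> ?la i w" for i by (rule limq[OF c1])
    show "AE w in M. (\<lambda>n. ?H n i j w) \<longlonglongrightarrow> ?lH i j w" for i j by (rule limq[OF c2])
    show "(\<lambda>w. G (t - h n, X (t - h n) w) * (g (X t w) - g (X (t - h n) w))) \<in> borel_measurable M" for n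
      using mesn(2)[OF contG[OF sn(1)]] mesn(2)[OF Ck_on_continuous[OF g]] mes(2)[OF Ck_on_continuous[OF g]] by measurable
    show "\<forall>\<^sub>F n in sequentially. \<forall>w. \<bar>G (t - h n, X (t - h n) w) * (g (X t w) - g (X (t - h n) w)) - (h n * 0 + (\<Sum>i\<in>UNIV. ?a n i w * I.inc n w $ i)
        + (\<Sum>i\<in>UNIV. \<Sum>j\<in>UNIV. ?H n i j w * (I.inc n w $ i * I.inc n w $ j)) / 2)\<bar>
        \<le> K * C' * ((h n)\<^sup>2 + h n * norm (I.inc n w) + norm (I.inc n w) ^ 3)"
    proof (intro always_eventually allI)
      fix n w
      define x where "x = X (t - h n) w"
      define k where "k = I.inc n w"
      define \<gamma> where "\<gamma> = G (t - h n, x)"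
      have xk: "X t w = x + k" by (simp add: x_def k_def I.inc_def)
      define T where "T = g (x + k) - g x - dd k g x - dd k (dd k g) x / 2"
      have eq: "\<gamma> * (g (x + k) - g x) - (h n * 0 + (\<Sum>i\<in>UNIV. \<gamma> * pdx i g x * k $ i)
        + (\<Sum>i\<in>UNIV. \<Sum>j\<in>UNIV. \<gamma> * pdx i (pdx j g) x * (k $ i * k $ j)) / 2) = \<gamma> * T"
        unfolding T_def dd_sum_axis[OF diff, of k] dd_dd_sum_axis[OF Ck_on_SucD[OF g[unfolded numeral_3_eq_3], folded numeral_2_eq_2], of k]
        by (simp add: sum_distrib_left algebra_simps)
      have "0 \<le> (h n)\<^sup>2 + h n * norm k" using h(1)[of n] by simp
      then have "\<bar>T\<bar> \<le> C' * ((h n)\<^sup>2 + h n * norm k + norm k ^ 3)"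
        using mult_mono[OF le(3), of "norm k ^ 3" "(h n)\<^sup>2 + h n * norm k + norm k ^ 3"] T(2)[of x k] le(4) unfolding T_def by force
      then have "\<bar>\<gamma>\<bar> * \<bar>T\<bar> \<le> K * (C' * ((h n)\<^sup>2 + h n * norm k + norm k ^ 3))"
        using Gb[of n w] K0 unfolding \<gamma>_def x_def by (intro mult_mono) auto
      then have "\<bar>\<gamma> * T\<bar> \<le> K * C' * ((h n)\<^sup>2 + h n * norm k + norm k ^ 3)" by (simp add: abs_mult mult.assoc)
      then show "\<bar>G (t - h n, X (t - h n) w) * (g (X t w) - g (X (t - h n) w)) - (h n * 0 + (\<Sum>i\<in>UNIV. ?a n i w * I.inc n w $ i)
        + (\<Sum>i\<in>UNIV. \<Sum>j\<in>UNIV. ?H n i j w * (I.inc n w $ i * I.inc n w $ j)) / 2)\<bar>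
        \<le> K * C' * ((h n)\<^sup>2 + h n * norm (I.inc n w) + norm (I.inc n w) ^ 3)"
        unfolding xk x_def[symmetric] k_def[symmetric] \<gamma>_def[symmetric] eq .
    qed
  qed (use K0 le(4) in auto)
  then show ?thesis by (simp add: sum_distrib_left algebra_simps)
qed

end

text \<open>Differentiation under the integral. The bound \<delta> < t keeps all times in a compact
  part of the open interval, where the mean value theorem yields an integrable majorant.\<close>

lemma time_difference_quotient_integral:
  fixes G :: "real \<times> (real ^ 'n) \<Rightarrow> real"
  assumes G: "Cinf_on spacetime G" and g: "continuous_on UNIV g" and supp: "\<And>x. x \<notin> cball c r \<Longrightarrow> g x = 0"
    and t: "t \<in> {0<..<1}" and h: "\<And>n. 0 < h n" "h \<longlonglongrightarrow> 0" "\<And>n. h n \<le> \<delta>" and \<delta>: "\<delta> < t"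
  shows "(\<lambda>n. ((LINT x|lborel. g x * G (t, x)) - (LINT x|lborel. g x * G (t - h n, x))) / h n)
    \<longlonglongrightarrow> (LINT x|lborel. g x * dt G (t, x))"
proof -
  have \<delta>0: "0 < \<delta>" using h(1,3)[of 0] by linarith
  have cont: "continuous_on UNIV (\<lambda>x. H (s, x))" if "Cinf_on spacetime H" "s \<in> {0<..<1}" for s and H :: "real \<times> (real ^ 'n) \<Rightarrow> real"
    by (rule Cinf_on_continuous[OF Cinf_on_slice_UNIV[OF that]])
  have sn: "t - h n \<in> {0<..<1}" for n using t h(1)[of n] h(3)[of n] \<delta> by auto
  have int: "integrable lborel (\<lambda>x. g x * G (s, x))" if "s \<in> {0<..<1}" for s
    by (rule integrable_compact_support_mult[OF g supp cont[OF G that]])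
  define Q where "Q = (\<lambda>n x. g x * ((G (t, x) - G (t - h n, x)) / h n))"
  have "((LINT x|lborel. g x * G (t, x)) - (LINT x|lborel. g x * G (t - h n, x))) / h n = (LINT x|lborel. Q n x)" for n
    using int[OF t] int[OF sn[of n]] unfolding Q_def by (simp add: right_diff_distrib diff_divide_distrib)
  moreover have "(\<lambda>n. LINT x|lborel. Q n x) \<longlonglongrightarrow> (LINT x|lborel. g x * dt G (t, x))"
  proof -
    define K where "K = {t - \<delta>..t} \<times> cball c r"
    have K: "compact K" "K \<subseteq> spacetime" using t \<delta> \<delta>0 by (auto simp: K_def intro!: compact_Times)
    obtain A where A: "A \<ge> 0" "\<And>z. z \<in> K \<Longrightarrow> \<bar>dt G z\<bar> \<le> A"
      using compact_abs_bound[OF K(1) continuous_on_subset[OF Cinf_on_continuous[OF Cinf_on_dd[OF G]] K(2)]] by blast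
    obtain Cg where Cg: "Cg \<ge> 0" "\<And>x. \<bar>g x * 1\<bar> \<le> Cg"
      using compact_support_mult_bound[where q = "\<lambda>_. 1", OF g supp continuous_on_const] by auto
    have d: "((\<lambda>s. G (s, x)) has_real_derivative dt G (s, x)) (at s)" if "s \<in> {0<..<1}" for s x
      by (rule DERIV_time, rule Cinf_on_differentiable[OF G]) (use that in auto)
    show ?thesis
    proof (rule integral_dominated_convergence)
      have "(\<lambda>x. g x * G (s, x)) \<in> borel_measurable borel" if "s \<in> {0<..<1}" for s
        by (intro borel_measurable_continuous_onI continuous_on_mult g cont[OF G that])
      from this[OF t] this[OF sn] show "Q n \<in> borel_measurable lborel" for n
        unfolding Q_def times_divide_eq_right right_diff_distrib by measurable
      show "(\<lambda>x. g x * dt G (t, x)) \<in> borel_measurable lborel"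
        using borel_measurable_continuous_onI[OF continuous_on_mult[OF g cont[OF Cinf_on_dd[OF G] t]]] by simp
      show "integrable lborel (\<lambda>x. Cg * A * indicator (cball c r) x)"
        using emeasure_bounded_finite[OF bounded_cball, of c r]
        by (intro integrable_mult_right integrable_real_indicator) auto
      show "AE x in lborel. (\<lambda>n. Q n x) \<longlonglongrightarrow> g x * dt G (t, x)"
      proof (rule AE_I2)
        fix x
        have "((\<lambda>k. (G (t + k, x) - G (t, x)) / k) \<longlongrightarrow> dt G (t, x)) (at 0)"
          using d[OF t, of x] by (simp add: DERIV_def)
        moreover have "filterlim (\<lambda>n. - h n) (at 0) sequentially"
          using tendsto_minus[OF h(2)] h(1) by (auto simp: filterlim_at less_imp_neq[symmetric] intro!: always_eventually)
        ultimately have "(\<lambda>n. (G (t + - h n, x) - G (t, x)) / - h n) \<longlonglongrightarrow> dt G (t, x)"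
          by (rule filterlim_compose)
        moreover have "(G (t + - h n, x) - G (t, x)) / - h n = (G (t, x) - G (t - h n, x)) / h n" for n
          using h(1)[of n] by (simp add: field_simps)
        ultimately show "(\<lambda>n. Q n x) \<longlonglongrightarrow> g x * dt G (t, x)"
          unfolding Q_def by (intro tendsto_mult tendsto_const) simp
      qed
      show "AE x in lborel. norm (Q n x) \<le> Cg * A * indicator (cball c r) x" for n
      proof (rule AE_I2)
        fix x
        show "norm (Q n x) \<le> Cg * A * indicator (cball c r) x"
        proof (cases "x \<in> cball c r")
          case True
          have "t - h n < t" using h(1) by simp
          moreover have "((\<lambda>s. G (s, x)) has_real_derivative dt G (s, x)) (at s)" if "t - h n \<le> s" "s \<le> t" for s
            by (rule d) (use that sn[of n] t in auto)
          ultimately obtain s where s: "t - h n < s" "s < t" "G (t, x) - G (t - h n, x) = (t - (t - h n)) * dt G (s, x)"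
            using MVT2[of "t - h n" t "\<lambda>s. G (s, x)" "\<lambda>s. dt G (s, x)"] by blast
          have "(s, x) \<in> K" using s h(3)[of n] True by (auto simp: K_def)
          then have "\<bar>g x\<bar> * \<bar>dt G (s, x)\<bar> \<le> Cg * A" using A(2) Cg by (intro mult_mono) auto
          then show ?thesis using s(3) h(1)[of n] True by (simp add: Q_def abs_mult)
        next
          case False
          then show ?thesis using supp by (simp add: Q_def)
        qed
      qed
    qed
  qed
  ultimately show ?thesis by simp
qed

section \<open>Continuity equation and mean acceleration\<close>

lemma harmonic_null_sequence:
  fixes a :: real
  assumes a: "0 < a"
  shows "0 < a / real (Suc n)" "(\<lambda>n. a / real (Suc n)) \<longlonglongrightarrow> 0" "a / real (Suc n) \<le> a"
proof -
  show "0 < a / real (Suc n)" using a by simp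
  show "(\<lambda>n. a / real (Suc n)) \<longlonglongrightarrow> 0" by real_asymp
  have "a * 1 \<le> a * real (Suc n)" using a by (intro mult_left_mono) auto
  then show "a / real (Suc n) \<le> a" by (simp add: pos_divide_le_eq del: of_nat_Suc)
qed

text \<open>The bounds on b and on grad R together bound b = grad S + grad R and b_* = grad S - grad
  R, the functions to which the limit lemmas are applied.\<close>

locale wave_diffusion = diffusion M P F X W b p \<sigma> B
  for M :: "'w measure" and P F and X W :: "real \<Rightarrow> 'w \<Rightarrow> real ^ 'n::finite" and b p \<sigma> B +
  fixes R S :: "real \<times> (real ^ 'n) \<Rightarrow> real" and Bu :: real
  assumes sigma: "\<sigma> \<noteq> 0"
    and R: "Cinf_on spacetime R" and S: "Cinf_on spacetime S"
    and p_eq: "\<And>t x. t \<in> {0<..<1} \<Longrightarrow> p t x = exp (2 / \<sigma>\<^sup>2 * R (t, x))"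
    and b_eq: "\<And>t x i. t \<in> {0<..<1} \<Longrightarrow> b t x $ i = dx i S (t, x) + dx i R (t, x)"
    and R_bound: "\<And>z i. z \<in> spacetime \<Longrightarrow> \<bar>dx i R z\<bar> \<le> Bu"
begin

definition \<kappa> :: real where "\<kappa> = 2 / \<sigma>\<^sup>2"

lemma kappa: "\<kappa> \<noteq> 0" "\<kappa> * \<sigma>\<^sup>2 = 2"
  using sigma by (simp_all add: \<kappa>_def)

text \<open>The density as a smooth function on space-time; it equals p for 0 < t < 1.\<close>

definition \<rho> :: "real \<times> (real ^ 'n) \<Rightarrow> real" where "\<rho> z = exp (\<kappa> * R z)"

lemma rho_pos: "0 < \<rho> z" by (simp add: \<rho>_def)

lemma Cinf_rho: "Cinf_on spacetime \<rho>"
  unfolding \<rho>_def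
  by (intro Cinf_on_exp Cinf_on_mult Cinf_on_const R open_spacetime)

lemma dd_rho: "z \<in> spacetime \<Longrightarrow> dd d \<rho> z = \<kappa> * (\<rho> z * dd d R z)"
proof -
  assume z: "z \<in> spacetime"
  have dR: "R differentiable (at z)" by (rule Cinf_on_differentiable[OF R z])
  have "(\<lambda>z. \<kappa> * R z) differentiable (at z)"
    by (rule Cinf_on_differentiable[OF Cinf_on_mult[OF open_spacetime Cinf_on_const R] z])
  from dd_exp[OF this, of d] show ?thesis by (simp add: \<rho>_def[abs_def] dd_cmult[OF dR])
qed

lemma expectation_rho:
  assumes "t \<in> {0<..<1}" "q \<in> borel_measurable borel"
  shows "expectation (\<lambda>w. q (X t w)) = (LINT x|lborel. q x * \<rho> (t, x))"
  using expectation_density[of t q] assms p_eq[OF assms(1)] by (simp add: \<rho>_def \<kappa>_def mult.commute)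

lemma continuous_slice: "Cinf_on spacetime G \<Longrightarrow> t \<in> {0<..<1} \<Longrightarrow> continuous_on UNIV (\<lambda>x. G (t, x))"
  by (rule Cinf_on_continuous[OF Cinf_on_slice_UNIV])

text \<open>The left side is the Fokker-Planck operator applied to \<rho> G. On the right it becomes
  \<rho> times the backward generator of G, plus a multiple of G whose factor is the expression in
  the continuity equation.\<close>

lemma adjoint_pointwise:
  assumes G: "Cinf_on spacetime G" and z: "z \<in> spacetime"
  shows "dt (\<lambda>z. \<rho> z * G z) z + (\<Sum>i\<in>UNIV. dx i (\<lambda>z. \<rho> z * G z * (dx i S z + dx i R z)) z - \<sigma>\<^sup>2 / 2 * dx i (dx i (\<lambda>z. \<rho> z * G z)) z)
    = \<rho> z * (dt G z + G z * \<kappa> * (dt R z + (\<Sum>i\<in>UNIV. dx i R z * dx i S z + \<sigma>\<^sup>2 / 2 * dx i (dx i S) z))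
        + (\<Sum>i\<in>UNIV. (dx i S z - dx i R z) * dx i G z - \<sigma>\<^sup>2 / 2 * dx i (dx i G) z))"
proof -
  have diff: "H differentiable (at y)" if "Cinf_on spacetime H" "y \<in> spacetime" for H :: "real \<times> (real ^ 'n) \<Rightarrow> real" and y
    by (rule Cinf_on_differentiable[OF that])
  note o = open_spacetime
  have d1: "dd d (\<lambda>z. \<rho> z * G z) y = \<rho> y * (\<kappa> * (dd d R y * G y) + dd d G y)" if "y \<in> spacetime" for y d
    using dd_mult[OF diff[OF Cinf_rho that] diff[OF G that], of d] dd_rho[OF that, of d] by (simp add: algebra_simps)
  have i: "dx i (\<lambda>z. \<rho> z * G z * (dx i S z + dx i R z)) z - \<sigma>\<^sup>2 / 2 * dx i (dx i (\<lambda>z. \<rho> z * G z)) z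
    = \<rho> z * (G z * \<kappa> * (dx i R z * dx i S z + \<sigma>\<^sup>2 / 2 * dx i (dx i S) z)
       + ((dx i S z - dx i R z) * dx i G z - \<sigma>\<^sup>2 / 2 * dx i (dx i G) z))" for i
  proof -
    have e1: "dx i (\<lambda>z. \<rho> z * G z * (dx i S z + dx i R z)) z
      = \<rho> z * G z * (dx i (dx i S) z + dx i (dx i R) z)
        + \<rho> z * (\<kappa> * (dx i R z * G z) + dx i G z) * (dx i S z + dx i R z)"
      using dd_mult[OF diff[OF Cinf_on_mult[OF o Cinf_rho G] z] diff[OF Cinf_on_add[OF o Cinf_on_dd[OF S] Cinf_on_dd[OF R]] z]]
        dd_add[OF diff[OF Cinf_on_dd[OF S] z] diff[OF Cinf_on_dd[OF R] z]] d1[OF z] by simp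
    have e2: "dx i (dx i (\<lambda>z. \<rho> z * G z)) z = dx i (\<lambda>z. \<rho> z * (\<kappa> * (dx i R z * G z) + dx i G z)) z"
      by (rule dd_cong[OF o z]) (rule d1)
    have e3: "dx i (\<lambda>z. \<rho> z * (\<kappa> * (dx i R z * G z) + dx i G z)) z
      = \<rho> z * (\<kappa> * (dx i R z * dx i G z + dx i (dx i R) z * G z) + dx i (dx i G) z)
        + \<kappa> * (\<rho> z * dx i R z) * (\<kappa> * (dx i R z * G z) + dx i G z)"
    proof -
      have C1: "Cinf_on spacetime (\<lambda>z. dx i R z * G z)" by (rule Cinf_on_mult[OF o Cinf_on_dd[OF R] G])
      have C2: "Cinf_on spacetime (\<lambda>z. \<kappa> * (dx i R z * G z))" by (rule Cinf_on_mult[OF o Cinf_on_const C1])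
      show ?thesis
        using dd_mult[OF diff[OF Cinf_rho z] diff[OF Cinf_on_add[OF o C2 Cinf_on_dd[OF G]] z]]
          dd_add[OF diff[OF C2 z] diff[OF Cinf_on_dd[OF G] z]] dd_cmult[OF diff[OF C1 z]]
          dd_mult[OF diff[OF Cinf_on_dd[OF R] z] diff[OF G z]] dd_rho[OF z] by simp
    qed
    have ks: "\<kappa> * (\<sigma>\<^sup>2 / 2) = 1" using kappa(2) by simp
    \<comment> \<open>The two sides differ by a multiple of 1 - k * m, so the identity expresses
      that R is sigma^2/2 times the logarithm of the density.\<close>
    have alg: "r * g * (v' + u') + r * (k * (u * g) + g') * (v + u)
        - m * (r * (k * (u * g' + u' * g) + g'') + k * (r * u) * (k * (u * g) + g'))
      = r * (g * k * (u * v + m * v') + ((v - u) * g' - m * g''))"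
      if "k * m = 1" for r g v v' u u' k g' g'' m :: real
    proof -
      have "r * g * (v' + u') + r * (k * (u * g) + g') * (v + u)
        - m * (r * (k * (u * g' + u' * g) + g'') + k * (r * u) * (k * (u * g) + g'))
        - r * (g * k * (u * v + m * v') + ((v - u) * g' - m * g''))
        = (1 - k * m) * (r * (g * (v' + u') + k * u * u * g + 2 * u * g'))"
        by (simp add: algebra_simps)
      then show ?thesis using that by simp
    qed
    show ?thesis unfolding e1 e2 e3 by (rule alg[OF ks])
  qed
  have sums: "r * (k * (u * g) + g') + (\<Sum>i\<in>UNIV. r * (g * k * a i + c i))
      = r * (g' + g * k * (u + (\<Sum>i\<in>UNIV. a i)) + (\<Sum>i\<in>UNIV. c i))"
    for r k u g g' :: real and a c :: "'n \<Rightarrow> real"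
    by (simp add: sum.distrib sum_distrib_left algebra_simps)
  show ?thesis unfolding d1[OF z] i by (rule sums)
qed

text \<open>The limit still carries the multiple of G from \<open>adjoint_pointwise\<close>. That
  factor does not depend on G, so the case G = 1 can be used to remove it for every G.\<close>

lemma backward_limit_weak:
  assumes G: "Cinf_on spacetime G" and GM: "\<And>z. z \<in> spacetime \<Longrightarrow> \<bar>G z\<bar> \<le> K"
    and g: "Ck_on 3 UNIV g" and supp: "\<And>x. x \<notin> cball c r \<Longrightarrow> g x = 0"
    and t: "t \<in> {0<..<1}" and h: "\<And>n. 0 < h n" "h \<longlonglongrightarrow> 0" "\<And>n. h n \<le> \<delta>" and \<delta>: "\<delta> < t"
  shows "(\<lambda>n. expectation (\<lambda>w. g (X t w) * (G (t, X t w) - G (t - h n, X (t - h n) w))) / h n) \<longlonglongrightarrow>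
    (LINT x|lborel. g x * (\<rho> (t, x) * (dt G (t, x) + G (t, x) * \<kappa> * (dt R (t, x) + (\<Sum>i\<in>UNIV. dx i R (t, x) * dx i S (t, x) + \<sigma>\<^sup>2 / 2 * dx i (dx i S) (t, x)))
        + (\<Sum>i\<in>UNIV. (dx i S (t, x) - dx i R (t, x)) * dx i G (t, x) - \<sigma>\<^sup>2 / 2 * dx i (dx i G) (t, x)))))"
proof -
  let ?Q = "\<lambda>z. \<rho> z * G z"
  note o = open_spacetime
  have Q: "Cinf_on spacetime ?Q" by (rule Cinf_on_mult[OF o Cinf_rho G])
  have sn: "t - h n \<in> {0<..<1}" for n using t h(1)[of n] h(3)[of n] \<delta> by auto
  have th: "0 < t - h n" for n using sn[of n] by simp
  note cg = Ck_on_continuous[OF g]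
  have cgi: "continuous_on UNIV (dd d g)" for d using g by (intro Ck_on_continuous[of 2] Ck_on_dd) (simp add: numeral_3_eq_3 numeral_2_eq_2)
  have g1: "Ck_on 1 UNIV g" "Ck_on 1 UNIV (dd d g)" for d
    using Ck_on_le[OF g, of 1] Ck_on_le[of 2 UNIV "dd d g" 1] Ck_on_dd[of 2 UNIV g d] g by (auto simp: numeral_3_eq_3 numeral_2_eq_2)
  have cgii: "continuous_on UNIV (dd d' (dd d g))" for d d' using g1(2)[of d] by (simp add: Ck_on_Suc_dd)
  have s1: "x \<notin> cball c r \<Longrightarrow> dd v g x = 0" for x v using dd_eq_0_outside[of c r g] supp by blast
  have s2: "x \<notin> cball c r \<Longrightarrow> dd u (dd v g) x = 0" for x u v using dd_eq_0_outside[of c r "dd v g"] s1 by blast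
  have bnd: "integrable M (\<lambda>w. G (s, X s w) * q (X s' w))"
    if s: "s \<in> {0<..<1}" "s' \<in> {0<..<1}" and q: "continuous_on UNIV q" "\<And>x. x \<notin> cball c r \<Longrightarrow> q x = 0" for s s' q
  proof -
    obtain C where C: "C \<ge> 0" "\<And>x. \<bar>q x * 1\<bar> \<le> C"
      using compact_support_mult_bound[where q = "\<lambda>_. 1", OF q continuous_on_const] by blast
    have s01: "s \<in> {0..1}" "s' \<in> {0..1}" using s by auto
    note mX = measurable_comp_X(2)[OF s01(1) continuous_slice[OF G s(1)]] measurable_comp_X(2)[OF s01(2) q(1)]
    have b: "\<bar>G (s, X s w)\<bar> * \<bar>q (X s' w)\<bar> \<le> K * C" for w
      using GM[of "(s, X s w)"] C(2)[of "X s' w"] s by (intro mult_mono) (auto intro: order_trans[OF abs_ge_zero])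
    show ?thesis
      by (rule integrable_const_bound[of _ "K * C"]) (use b mX in \<open>auto simp: abs_mult\<close>)
  qed
  have E: "expectation (\<lambda>w. G (s, X s w) * g (X s w)) = (LINT x|lborel. g x * ?Q (s, x))" if s: "s \<in> {0<..<1}" for s
    using expectation_rho[OF s borel_measurable_continuous_onI[OF continuous_on_mult[OF continuous_slice[OF G s] cg]]]
    by (simp add: mult_ac)
  let ?A = "\<lambda>x. (\<Sum>i\<in>UNIV. b t x $ i * pdx i g x) + \<sigma>\<^sup>2 / 2 * (\<Sum>i\<in>UNIV. pdx i (pdx i g) x)"
  \<comment> \<open>A discrete product rule: the increment of g G minus G at the earlier time times
    the increment of g. The expectation of the first part is a difference of integrals against
    \<rho>.\<close>
  have dec: "expectation (\<lambda>w. g (X t w) * (G (t, X t w) - G (t - h n, X (t - h n) w))) / h n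
     = ((LINT x|lborel. g x * ?Q (t, x)) - (LINT x|lborel. g x * ?Q (t - h n, x))) / h n
       - expectation (\<lambda>w. G (t - h n, X (t - h n) w) * (g (X t w) - g (X (t - h n) w))) / h n" for n
  proof -
    have "expectation (\<lambda>w. g (X t w) * (G (t, X t w) - G (t - h n, X (t - h n) w)))
      = expectation (\<lambda>w. G (t, X t w) * g (X t w) - G (t - h n, X (t - h n) w) * g (X (t - h n) w)
          - (G (t - h n, X (t - h n) w) * g (X t w) - G (t - h n, X (t - h n) w) * g (X (t - h n) w)))"
      by (rule arg_cong[where f = "integral\<^sup>L M"]) (simp add: fun_eq_iff algebra_simps)
    also have "\<dots> = (LINT x|lborel. g x * ?Q (t, x)) - (LINT x|lborel. g x * ?Q (t - h n, x))
       - expectation (\<lambda>w. G (t - h n, X (t - h n) w) * g (X t w) - G (t - h n, X (t - h n) w) * g (X (t - h n) w))"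
      using bnd[OF t t cg supp] bnd[OF sn t cg supp] bnd[OF sn sn cg supp] E[OF t] E[OF sn] by simp
    finally show ?thesis by (simp add: diff_divide_distrib right_diff_distrib)
  qed
  have "(\<lambda>n. expectation (\<lambda>w. g (X t w) * (G (t, X t w) - G (t - h n, X (t - h n) w))) / h n) \<longlonglongrightarrow>
     (LINT x|lborel. g x * dt ?Q (t, x)) - expectation (\<lambda>w. G (t, X t w) * ?A (X t w))"
    unfolding dec
    by (intro tendsto_diff time_difference_quotient_integral[OF Q cg supp t h \<delta>] backward_increment_limit[OF G GM g supp t h(1,2) th])
  also have "expectation (\<lambda>w. G (t, X t w) * ?A (X t w))
     = (LINT x|lborel. (\<Sum>i\<in>UNIV. ?Q (t, x) * (dx i S (t, x) + dx i R (t, x)) * pdx i g x + \<sigma>\<^sup>2 / 2 * (?Q (t, x) * pdx i (pdx i g) x)))"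
  proof -
    have t01: "t \<in> {0..1}" using t by auto
    have "continuous_on UNIV ?A"
      by (intro continuous_intros continuous_on_component b_slice_continuous t01 cgi cgii)
    then have "(\<lambda>x. G (t, x) * ?A x) \<in> borel_measurable borel"
      by (intro borel_measurable_continuous_onI continuous_on_mult continuous_slice[OF G t])
    from expectation_rho[OF t this] have "expectation (\<lambda>w. G (t, X t w) * ?A (X t w)) = (LINT x|lborel. G (t, x) * ?A x * \<rho> (t, x))" .
    also have "\<dots> = (LINT x|lborel. (\<Sum>i\<in>UNIV. ?Q (t, x) * (dx i S (t, x) + dx i R (t, x)) * pdx i g x + \<sigma>\<^sup>2 / 2 * (?Q (t, x) * pdx i (pdx i g) x)))"
      by (rule arg_cong[where f = "integral\<^sup>L lborel"])
        (simp add: fun_eq_iff b_eq[OF t] sum.distrib sum_distrib_left distrib_left distrib_right mult_ac)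
    finally show ?thesis .
  qed
  \<comment> \<open>Integration by parts, once in the drift term and twice in the second order term,
    moves all derivatives from g to \<rho> G; boundary terms vanish by the compact support of
    g.\<close>
  also have "\<dots> = - (LINT x|lborel. g x * (\<Sum>i\<in>UNIV. dx i (\<lambda>z. ?Q z * (dx i S z + dx i R z)) (t, x) - \<sigma>\<^sup>2 / 2 * dx i (dx i ?Q) (t, x)))"
  proof -
    let ?J = "\<lambda>i z. ?Q z * (dx i S z + dx i R z)"
    have J: "Cinf_on spacetime (?J i)" for i
      by (intro Cinf_on_mult[OF o Q] Cinf_on_add[OF o] Cinf_on_dd R S)
    have Ck1: "Ck_on 1 UNIV (\<lambda>x. H (t, x))" if "Cinf_on spacetime H" for H :: "real \<times> (real ^ 'n) \<Rightarrow> real"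
      using Cinf_on_slice_UNIV[OF that t] by (simp add: Cinf_on_def)
    have a: "(LINT x|lborel. ?J i (t, x) * pdx i g x) = - (LINT x|lborel. g x * dx i (?J i) (t, x))" for i
      using integration_by_parts[where v = "axis i 1" and c = c and r = r, OF Ck1[OF J[of i]] g1(1) supp] by (simp add: pdx_slice[OF J[of i] t, of i])
    have bb: "(LINT x|lborel. ?Q (t, x) * pdx i (pdx i g) x) = (LINT x|lborel. g x * dx i (dx i ?Q) (t, x))" for i
    proof -
      have "(LINT x|lborel. ?Q (t, x) * pdx i (pdx i g) x) = - (LINT x|lborel. pdx i g x * dx i ?Q (t, x))"
        using integration_by_parts[where v = "axis i 1" and c = c and r = r, OF Ck1[OF Q] g1(2)[of "axis i 1"] s1]
        by (simp add: pdx_slice[OF Q t, of i])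
      also have "(LINT x|lborel. pdx i g x * dx i ?Q (t, x)) = (LINT x|lborel. dx i ?Q (t, x) * pdx i g x)"
        by (simp only: mult.commute)
      also have "\<dots> = - (LINT x|lborel. g x * dx i (dx i ?Q) (t, x))"
        using integration_by_parts[where v = "axis i 1" and c = c and r = r, OF Ck1[OF Cinf_on_dd[OF Q, of "(0, axis i 1)"]] g1(1) supp]
        by (simp add: pdx_slice[OF Cinf_on_dd[OF Q] t])
      finally show ?thesis by simp
    qed
    have i1: "integrable lborel (\<lambda>x. ?J i (t, x) * pdx i g x)" for i
      using integrable_compact_support_mult[where g = "pdx i g" and c = c and r = r, OF cgi s1 continuous_slice[OF J[of i] t]] by (simp add: mult.commute)
    have i2: "integrable lborel (\<lambda>x. ?Q (t, x) * pdx i (pdx i g) x)" for i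
      using integrable_compact_support_mult[where g = "pdx i (pdx i g)" and c = c and r = r, OF cgii s2 continuous_slice[OF Q t]] by (simp add: mult.commute)
    have i3: "integrable lborel (\<lambda>x. g x * dx i (?J i) (t, x))" "integrable lborel (\<lambda>x. g x * dx i (dx i ?Q) (t, x))" for i
      by (rule integrable_compact_support_mult[OF cg supp continuous_slice[OF Cinf_on_dd[OF J] t]],
          assumption, rule integrable_compact_support_mult[OF cg supp continuous_slice[OF Cinf_on_dd[OF Cinf_on_dd[OF Q]] t]], assumption)
    have "(LINT x|lborel. (\<Sum>i\<in>UNIV. ?J i (t, x) * pdx i g x + \<sigma>\<^sup>2 / 2 * (?Q (t, x) * pdx i (pdx i g) x)))
       = (\<Sum>i\<in>UNIV. (LINT x|lborel. ?J i (t, x) * pdx i g x) + \<sigma>\<^sup>2 / 2 * (LINT x|lborel. ?Q (t, x) * pdx i (pdx i g) x))"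
      using i1 i2 by simp
    also have "\<dots> = - (\<Sum>i\<in>UNIV. (LINT x|lborel. g x * dx i (?J i) (t, x)) - \<sigma>\<^sup>2 / 2 * (LINT x|lborel. g x * dx i (dx i ?Q) (t, x)))"
      unfolding a bb by (simp add: sum_negf[symmetric])
    also have "\<dots> = - (LINT x|lborel. (\<Sum>i\<in>UNIV. g x * dx i (?J i) (t, x) - \<sigma>\<^sup>2 / 2 * (g x * dx i (dx i ?Q) (t, x))))"
      using i3 by simp
    also have "(\<lambda>x. \<Sum>i\<in>UNIV. g x * dx i (?J i) (t, x) - \<sigma>\<^sup>2 / 2 * (g x * dx i (dx i ?Q) (t, x)))
       = (\<lambda>x. g x * (\<Sum>i\<in>UNIV. dx i (?J i) (t, x) - \<sigma>\<^sup>2 / 2 * dx i (dx i ?Q) (t, x)))"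
      by (simp add: fun_eq_iff sum_distrib_left right_diff_distrib mult_ac)
    finally show ?thesis .
  qed
  also have "(LINT x|lborel. g x * dt ?Q (t, x)) - - (LINT x|lborel. g x * (\<Sum>i\<in>UNIV. dx i (\<lambda>z. ?Q z * (dx i S z + dx i R z)) (t, x) - \<sigma>\<^sup>2 / 2 * dx i (dx i ?Q) (t, x)))
     = (LINT x|lborel. g x * (dt ?Q (t, x) + (\<Sum>i\<in>UNIV. dx i (\<lambda>z. ?Q z * (dx i S z + dx i R z)) (t, x) - \<sigma>\<^sup>2 / 2 * dx i (dx i ?Q) (t, x))))"
  proof -
    have "continuous_on UNIV (\<lambda>x. \<Sum>i\<in>UNIV. dx i (\<lambda>z. ?Q z * (dx i S z + dx i R z)) (t, x) - \<sigma>\<^sup>2 / 2 * dx i (dx i ?Q) (t, x))"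
      by (intro continuous_on_sum continuous_on_diff continuous_on_mult continuous_on_const continuous_slice[OF _ t] Cinf_on_dd
          Cinf_on_mult[OF o Q] Cinf_on_add[OF o] R S Q)
    from integrable_compact_support_mult[OF cg supp this] integrable_compact_support_mult[OF cg supp continuous_slice[OF Cinf_on_dd[OF Q] t]]
    show ?thesis by (simp add: distrib_left)
  qed
  also have "\<dots> = (LINT x|lborel. g x * (\<rho> (t, x) * (dt G (t, x) + G (t, x) * \<kappa> * (dt R (t, x) + (\<Sum>i\<in>UNIV. dx i R (t, x) * dx i S (t, x) + \<sigma>\<^sup>2 / 2 * dx i (dx i S) (t, x)))
        + (\<Sum>i\<in>UNIV. (dx i S (t, x) - dx i R (t, x)) * dx i G (t, x) - \<sigma>\<^sup>2 / 2 * dx i (dx i G) (t, x)))))"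
    by (rule arg_cong[where f = "integral\<^sup>L lborel"], rule ext, subst adjoint_pointwise[OF G]) (use t in auto)
  finally show ?thesis .
qed

lemma continuity_equation:
  assumes z: "z \<in> spacetime"
  shows "dt R z + (\<Sum>i\<in>UNIV. dx i R z * dx i S z + \<sigma>\<^sup>2 / 2 * dx i (dx i S) z) = 0"
proof -
  obtain t x where zt: "z = (t, x)" "t \<in> {0<..<1}" using z by auto
  note t = zt(2)
  let ?E = "\<lambda>x. dt R (t, x) + (\<Sum>i\<in>UNIV. dx i R (t, x) * dx i S (t, x) + \<sigma>\<^sup>2 / 2 * dx i (dx i S) (t, x))"
  have cE: "continuous_on UNIV ?E"
    by (intro continuous_intros continuous_slice[OF _ t] Cinf_on_dd R S)
  define h where "h = (\<lambda>n::nat. t / 2 / real (Suc n))"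
  have h: "0 < h n" "h \<longlonglongrightarrow> 0" "h n \<le> t / 2" for n
    unfolding h_def using t by (intro harmonic_null_sequence; simp)+
  have "\<rho> (t, x) * (\<kappa> * ?E x) = 0"
  \<comment> \<open>Exponent 4 is the one for which \<open>Ck_on_bump\<close> gives class
    C^3.\<close>
  proof (rule test_function_zero[where m = 4 and Q = "\<lambda>x. \<rho> (t, x) * (\<kappa> * ?E x)"])
    show "continuous_on UNIV (\<lambda>x. \<rho> (t, x) * (\<kappa> * ?E x))"
      by (intro continuous_on_mult continuous_on_const cE continuous_slice[OF Cinf_rho t])
    fix c :: "real ^ 'n" and r :: real assume r: "0 < r"
    have supp: "y \<notin> cball c r \<Longrightarrow> bump 4 c r y = 0" for y using bump_eq_0[of y c r 4] r by simp
    have Ck: "Ck_on 3 UNIV (bump 4 c r)" using Ck_on_bump[of 3 c r] by (simp add: eval_nat_numeral)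
    have d0: "dd d (\<lambda>z. 1 :: real) y = 0" "dd d (\<lambda>z. 0 :: real) y = 0" for d y :: "real \<times> (real ^ 'n)"
      by (rule dd_unique[OF has_derivative_const])+
    have "(\<lambda>n::nat. 0) \<longlonglongrightarrow> (LINT x|lborel. bump 4 c r x * (\<rho> (t, x) * (\<kappa> * ?E x)))"
      using backward_limit_weak[OF Cinf_on_const[of spacetime 1] _ Ck supp t h, of 1] t
      by (simp add: d0 d0(1)[abs_def])
    then show "(LINT x|lborel. bump 4 c r x * (\<rho> (t, x) * (\<kappa> * ?E x))) = 0"
      by (simp add: LIMSEQ_const_iff)
  qed simp
  then show ?thesis using rho_pos[of "(t, x)"] kappa zt(1) by simp
qed

lemma backward_limit:
  assumes G: "Cinf_on spacetime G" and GM: "\<And>z. z \<in> spacetime \<Longrightarrow> \<bar>G z\<bar> \<le> K"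
    and g: "Ck_on 3 UNIV g" and supp: "\<And>x. x \<notin> cball c r \<Longrightarrow> g x = 0"
    and t: "t \<in> {0<..<1}" and h: "\<And>n. 0 < h n" "h \<longlonglongrightarrow> 0" "\<And>n. h n \<le> \<delta>" and \<delta>: "\<delta> < t"
  shows "(\<lambda>n. expectation (\<lambda>w. g (X t w) * (G (t, X t w) - G (t - h n, X (t - h n) w))) / h n) \<longlonglongrightarrow>
    (LINT x|lborel. g x * (\<rho> (t, x) * (dt G (t, x)
        + (\<Sum>i\<in>UNIV. (dx i S (t, x) - dx i R (t, x)) * dx i G (t, x) - \<sigma>\<^sup>2 / 2 * dx i (dx i G) (t, x)))))"
  using backward_limit_weak[OF assms] continuity_equation[of "(t, _)"] t by simp

lemma forward_limit_rho:
  assumes G: "Cinf_on spacetime G" and GM: "\<And>z. z \<in> spacetime \<Longrightarrow> \<bar>G z\<bar> \<le> K"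
    and g: "continuous_on UNIV g" and supp: "\<And>x. x \<notin> cball c r \<Longrightarrow> g x = 0"
    and t: "t \<in> {0<..<1}" and h: "\<And>n. 0 < h n" "h \<longlonglongrightarrow> 0" "\<And>n. t + h n < 1"
  shows "(\<lambda>n. expectation (\<lambda>w. g (X t w) * (G (t + h n, X (t + h n) w) - G (t, X t w))) / h n) \<longlonglongrightarrow>
    (LINT x|lborel. g x * (\<rho> (t, x) * (dt G (t, x)
        + (\<Sum>i\<in>UNIV. (dx i S (t, x) + dx i R (t, x)) * dx i G (t, x) + \<sigma>\<^sup>2 / 2 * dx i (dx i G) (t, x)))))"
proof -
  have t01: "t \<in> {0..1}" using t by auto
  have "continuous_on UNIV (\<lambda>x. g x * (dt G (t, x) + (\<Sum>i\<in>UNIV. b t x $ i * dx i G (t, x)) + \<sigma>\<^sup>2 / 2 * (\<Sum>i\<in>UNIV. dx i (dx i G) (t, x))))"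
    by (intro continuous_on_mult continuous_on_add continuous_on_sum continuous_on_const g continuous_slice[OF _ t] Cinf_on_dd G
        continuous_on_component b_slice_continuous t01)
  from expectation_rho[OF t borel_measurable_continuous_onI[OF this]] forward_limit[OF G GM g supp t h]
  show ?thesis
    by (simp add: b_eq[OF t] sum.distrib sum_distrib_left algebra_simps)
qed

text \<open>Nelson's mean acceleration \<open>(D D\<^sub>* + D\<^sub>* D) X / 2\<close> in terms of current and osmotic velocities.\<close>

lemma mean_acceleration:
  assumes t: "t \<in> {0<..<1}" and N: "continuous_on UNIV N" and \<delta>: "0 < \<delta>" "\<delta> < t" "t + \<delta> < 1"
    and weak: "\<And>g c r h A A'. continuous_on UNIV g \<Longrightarrow> (\<And>x. x \<notin> cball c r \<Longrightarrow> g x = 0) \<Longrightarrow>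
      (\<And>n. 0 < h n) \<Longrightarrow> h \<longlonglongrightarrow> 0 \<Longrightarrow> (\<And>n. h n \<le> \<delta>) \<Longrightarrow>
      (\<lambda>n. expectation (\<lambda>w. g (X t w) * ((dx i S (t + h n, X (t + h n) w) - dx i R (t + h n, X (t + h n) w)) - (dx i S (t, X t w) - dx i R (t, X t w)))) / h n) \<longlonglongrightarrow> A \<Longrightarrow>
      (\<lambda>n. expectation (\<lambda>w. g (X t w) * ((dx i S (t, X t w) + dx i R (t, X t w)) - (dx i S (t - h n, X (t - h n) w) + dx i R (t - h n, X (t - h n) w)))) / h n) \<longlonglongrightarrow> A' \<Longrightarrow>
      A + A' = - 2 * expectation (\<lambda>w. g (X t w) * N (X t w))"
  shows "dt (dx i S) (t, x) + (\<Sum>j\<in>UNIV. dx j S (t, x) * dx j (dx i S) (t, x) - dx j R (t, x) * dx j (dx i R) (t, x)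
      - \<sigma>\<^sup>2 / 2 * dx j (dx j (dx i R)) (t, x)) = - N x"
proof -
  note o = open_spacetime
  \<comment> \<open>\<open>?G1\<close> is a component of b_* and \<open>?G2\<close> one of b: the
    forward derivative is taken of the first and the backward derivative of the second.\<close>
  let ?G1 = "\<lambda>z. dx i S z - dx i R z" and ?G2 = "\<lambda>z. dx i S z + dx i R z"
  have G1: "Cinf_on spacetime ?G1" and G2: "Cinf_on spacetime ?G2"
    by (intro Cinf_on_diff Cinf_on_add o Cinf_on_dd R S)+
  have bd2: "\<bar>?G2 z\<bar> \<le> B" if "z \<in> spacetime" for z
  proof -
    obtain s y where z: "z = (s, y)" by (cases z)
    with that have s: "s \<in> {0<..<1}" by simp
    have "\<bar>b s y $ i\<bar> \<le> norm (b s y)" by (rule component_le_norm_cart)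
    also have "\<dots> \<le> B" using b_bound[of s y] s by simp
    finally show ?thesis using z s b_eq by simp
  qed
  have bd1: "\<bar>?G1 z\<bar> \<le> B + 2 * Bu" if "z \<in> spacetime" for z
    using bd2[OF that] R_bound[OF that, of i] by linarith
  \<comment> \<open>The forward generator applied to b_* and the backward generator applied to b;
    half their sum is the mean acceleration.\<close>
  define L1 where "L1 = (\<lambda>x. dt ?G1 (t, x) + (\<Sum>j\<in>UNIV. (dx j S (t, x) + dx j R (t, x)) * dx j ?G1 (t, x) + \<sigma>\<^sup>2 / 2 * dx j (dx j ?G1) (t, x)))"
  define L2 where "L2 = (\<lambda>x. dt ?G2 (t, x) + (\<Sum>j\<in>UNIV. (dx j S (t, x) - dx j R (t, x)) * dx j ?G2 (t, x) - \<sigma>\<^sup>2 / 2 * dx j (dx j ?G2) (t, x)))"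
  have cL: "continuous_on UNIV L1" "continuous_on UNIV L2" unfolding L1_def L2_def
    by (intro continuous_intros continuous_slice[OF _ t] Cinf_on_dd G1 G2 R S)+
  have c\<rho>: "continuous_on UNIV (\<lambda>x. \<rho> (t, x))" by (rule continuous_slice[OF Cinf_rho t])
  define h where "h = (\<lambda>n::nat. \<delta> / real (Suc n))"
  have h: "0 < h n" "h \<longlonglongrightarrow> 0" "h n \<le> \<delta>" for n
    unfolding h_def by (rule harmonic_null_sequence[OF \<delta>(1)])+
  have th: "t + h n < 1" for n using h(3)[of n] \<delta> by simp
  have "\<rho> (t, x) * (L1 x + L2 x + 2 * N x) = 0"
  proof (rule test_function_zero[where m = 4 and Q = "\<lambda>x. \<rho> (t, x) * (L1 x + L2 x + 2 * N x)"])
    show "continuous_on UNIV (\<lambda>x. \<rho> (t, x) * (L1 x + L2 x + 2 * N x))"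
      by (intro continuous_on_mult continuous_on_add continuous_on_const c\<rho> cL N)
    fix c :: "real ^ 'n" and r :: real assume r: "0 < r"
    let ?g = "bump 4 c r"
    have supp: "y \<notin> cball c r \<Longrightarrow> ?g y = 0" for y using bump_eq_0[of y c r 4] r by simp
    have Ck: "Ck_on 3 UNIV ?g" using Ck_on_bump[of 3 c r] by (simp add: eval_nat_numeral)
    note cg = Ck_on_continuous[OF Ck]
    have "(LINT x|lborel. ?g x * (\<rho> (t, x) * L1 x)) + (LINT x|lborel. ?g x * (\<rho> (t, x) * L2 x)) = - 2 * expectation (\<lambda>w. ?g (X t w) * N (X t w))"
      unfolding L1_def L2_def
      by (rule weak[OF cg supp h forward_limit_rho[OF G1 bd1 cg supp t h(1,2) th] backward_limit[OF G2 bd2 Ck supp t h \<delta>(2)]])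
    also have "expectation (\<lambda>w. ?g (X t w) * N (X t w)) = (LINT x|lborel. ?g x * (\<rho> (t, x) * N x))"
      using expectation_rho[OF t borel_measurable_continuous_onI[OF continuous_on_mult[OF cg N]]] by (simp add: mult_ac)
    finally have "(LINT x|lborel. ?g x * (\<rho> (t, x) * L1 x)) + (LINT x|lborel. ?g x * (\<rho> (t, x) * L2 x)) + 2 * (LINT x|lborel. ?g x * (\<rho> (t, x) * N x)) = 0"
      by simp
    moreover have "integrable lborel (\<lambda>x. ?g x * (\<rho> (t, x) * q x))" if "continuous_on UNIV q" for q
      by (rule integrable_compact_support_mult[OF cg supp continuous_on_mult[OF c\<rho> that]])
    note this[OF cL(1)] this[OF cL(2)] this[OF N]
    ultimately show "(LINT x|lborel. ?g x * (\<rho> (t, x) * (L1 x + L2 x + 2 * N x))) = 0"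
      by (simp add: distrib_left mult.left_commute[of _ 2])
  qed simp
  then have eq: "L1 x + L2 x + 2 * N x = 0" using rho_pos[of "(t, x)"] by simp
  have z: "(t, x) \<in> spacetime" using t by auto
  have diff: "H differentiable (at y)" if "Cinf_on spacetime H" "y \<in> spacetime" for H :: "real \<times> (real ^ 'n) \<Rightarrow> real" and y
    by (rule Cinf_on_differentiable[OF that])
  have d1: "dd d ?G1 y = dd d (dx i S) y - dd d (dx i R) y" "dd d ?G2 y = dd d (dx i S) y + dd d (dx i R) y"
    if "y \<in> spacetime" for d y
    by (intro dd_diff dd_add diff Cinf_on_dd R S that)+
  have d2: "dd e (dd d ?G1) (t, x) = dd e (dd d (dx i S)) (t, x) - dd e (dd d (dx i R)) (t, x)" for d e
  proof -
    have "dd e (dd d ?G1) (t, x) = dd e (\<lambda>y. dd d (dx i S) y - dd d (dx i R) y) (t, x)"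
      by (rule dd_cong[OF o z]) (rule d1)
    also have "\<dots> = dd e (dd d (dx i S)) (t, x) - dd e (dd d (dx i R)) (t, x)"
      by (intro dd_diff diff Cinf_on_dd R S z)
    finally show ?thesis .
  qed
  have d3: "dd e (dd d ?G2) (t, x) = dd e (dd d (dx i S)) (t, x) + dd e (dd d (dx i R)) (t, x)" for d e
  proof -
    have "dd e (dd d ?G2) (t, x) = dd e (\<lambda>y. dd d (dx i S) y + dd d (dx i R) y) (t, x)"
      by (rule dd_cong[OF o z]) (rule d1)
    also have "\<dots> = dd e (dd d (dx i S)) (t, x) + dd e (dd d (dx i R)) (t, x)"
      by (intro dd_add diff Cinf_on_dd R S z)
    finally show ?thesis .
  qed
  have "L1 x + L2 x = 2 * (dt (dx i S) (t, x) + (\<Sum>j\<in>UNIV. dx j S (t, x) * dx j (dx i S) (t, x) - dx j R (t, x) * dx j (dx i R) (t, x)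
      - \<sigma>\<^sup>2 / 2 * dx j (dx j (dx i R)) (t, x)))"
  proof -
    have "L1 x + L2 x = 2 * dt (dx i S) (t, x) + (\<Sum>j\<in>UNIV. ((dx j S (t, x) + dx j R (t, x)) * dx j ?G1 (t, x) + \<sigma>\<^sup>2 / 2 * dx j (dx j ?G1) (t, x))
      + ((dx j S (t, x) - dx j R (t, x)) * dx j ?G2 (t, x) - \<sigma>\<^sup>2 / 2 * dx j (dx j ?G2) (t, x)))"
      unfolding L1_def L2_def sum.distrib by (simp add: d1[OF z])
    \<comment> \<open>In the sum of the two generators the mixed products of S and R cancel, and so
      do the second order terms in S.\<close>
    also have "\<dots> = 2 * dt (dx i S) (t, x) + (\<Sum>j\<in>UNIV. 2 * (dx j S (t, x) * dx j (dx i S) (t, x) - dx j R (t, x) * dx j (dx i R) (t, x)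
      - \<sigma>\<^sup>2 / 2 * dx j (dx j (dx i R)) (t, x)))"
      unfolding d1[OF z] d2 d3 by (intro arg_cong2[where f = "(+)"] sum.cong refl) (simp add: algebra_simps)
    finally show ?thesis by (simp only: sum_distrib_left[symmetric] distrib_left)
  qed
  with eq show ?thesis by simp
qed

end

section \<open>Nelson's derivatives\<close>

lemma integrable_vec_lambda:
  fixes f :: "'n::finite \<Rightarrow> 'w \<Rightarrow> real"
  assumes "\<And>i. integrable M (f i)"
  shows "integrable M (\<lambda>w. \<chi> i. f i w)"
proof -
  have "(\<chi> i. f i w) = (\<Sum>i\<in>UNIV. f i w *\<^sub>R axis i 1)" for w
    by (simp add: vec_eq_iff axis_def if_distrib[of "\<lambda>x. _ * x"] cong: if_cong)
  then show ?thesis using assms by simp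
qed

lemma integrable_vec_nth: "integrable M f \<Longrightarrow> integrable M (\<lambda>w. (f w :: real ^ 'n::finite) $ i)"
  by (rule integrable_bounded_linear[OF bounded_linear_vec_nth])

text \<open>Both of Nelson's derivatives are of the following form, with increments \<open>D h\<close>.\<close>

definition cond_L1_limit ::
  "'w measure \<Rightarrow> 'w measure \<Rightarrow> (real \<Rightarrow> 'w \<Rightarrow> real ^ 'n::finite) \<Rightarrow> ('w \<Rightarrow> real ^ 'n) \<Rightarrow> bool" where
  "cond_L1_limit M A D Z \<longleftrightarrow> integrable M Z \<and> (\<forall>\<^sub>F h in at_right 0. integrable M (D h)) \<and>
     ((\<lambda>h. LINT w|M. norm (vec_cond_exp M A (\<lambda>w. D h w /\<^sub>R h) w - Z w)) \<longlongrightarrow> 0) (at_right 0)"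

lemma has_forward_deriv_iff:
  "has_forward_deriv M P Y t Z \<longleftrightarrow> cond_L1_limit M (P t) (\<lambda>h w. Y (t + h) w - Y t w) Z"
  by (simp add: has_forward_deriv_def cond_L1_limit_def)

lemma has_backward_deriv_iff:
  "has_backward_deriv M F Y t Z \<longleftrightarrow> cond_L1_limit M (F t) (\<lambda>h w. Y t w - Y (t - h) w) Z"
  by (simp add: has_backward_deriv_def cond_L1_limit_def)

context prob_space
begin

lemma sigma_finite_subalgebraI: "subalgebra M A \<Longrightarrow> sigma_finite_subalgebra M A"
  by (rule finite_measure_subalgebra_is_sigma_finite) (simp add: finite_measure_subalgebra_def finite_measure_subalgebra_axioms_def finite_measure_axioms)

lemma integrable_vec_cond_exp:
  assumes "subalgebra M A" "integrable M Y"
  shows "integrable M (vec_cond_exp M A Y)"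
proof -
  interpret sigma_finite_subalgebra M A by (rule sigma_finite_subalgebraI[OF assms(1)])
  show ?thesis unfolding vec_cond_exp_def
    by (intro integrable_vec_lambda real_cond_exp_int integrable_vec_nth assms)
qed

text \<open>Two limits are compared through the same conditional difference quotient by the triangle
  inequality in L^1.\<close>

lemma cond_L1_limit_unique:
  assumes A: "subalgebra M A" and Z: "cond_L1_limit M A D Z" "cond_L1_limit M A D Z'"
  shows "AE w in M. Z w = Z' w"
proof -
  have i: "integrable M Z" "integrable M Z'" using Z by (auto simp: cond_L1_limit_def)
  let ?V = "\<lambda>h. vec_cond_exp M A (\<lambda>w. D h w /\<^sub>R h)"
  have "((\<lambda>h. (LINT w|M. norm (?V h w - Z w)) + (LINT w|M. norm (?V h w - Z' w))) \<longlongrightarrow> 0 + 0) (at_right 0)"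
    using Z unfolding cond_L1_limit_def by (intro tendsto_add) auto
  moreover have "\<forall>\<^sub>F h in at_right 0. (LINT w|M. norm (Z w - Z' w)) \<le> (LINT w|M. norm (?V h w - Z w)) + (LINT w|M. norm (?V h w - Z' w))"
  proof -
    have "\<forall>\<^sub>F h in at_right 0. integrable M (D h)" using Z by (auto simp: cond_L1_limit_def)
    then show ?thesis
    proof eventually_elim
      case (elim h)
      then have V: "integrable M (?V h)" by (intro integrable_vec_cond_exp A integrable_scaleR_right)
      have "(LINT w|M. norm (Z w - Z' w)) \<le> (LINT w|M. norm (?V h w - Z w) + norm (?V h w - Z' w))"
      proof (rule integral_mono)
        show "norm (Z w - Z' w) \<le> norm (?V h w - Z w) + norm (?V h w - Z' w)" for w
          using norm_triangle_ineq4[of "?V h w - Z' w" "?V h w - Z w"] by simp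
      qed (use V i in auto)
      also have "\<dots> = (LINT w|M. norm (?V h w - Z w)) + (LINT w|M. norm (?V h w - Z' w))"
        using V i by (intro Bochner_Integration.integral_add) auto
      finally show ?case .
    qed
  qed
  ultimately have "(LINT w|M. norm (Z w - Z' w)) \<le> 0"
    by (intro tendsto_lowerbound[of _ "0 + 0 :: real" "at_right 0", simplified]) auto
  moreover have "0 \<le> (LINT w|M. norm (Z w - Z' w))" by (rule integral_nonneg_AE) simp
  ultimately have "(LINT w|M. norm (Z w - Z' w)) = 0" by simp
  then have "AE w in M. norm (Z w - Z' w) = 0"
    using i by (subst (asm) integral_nonneg_eq_0_iff_AE) auto
  then show ?thesis by (auto elim!: eventually_mono)
qed

text \<open>The defining property of the conditional expectation removes the conditioning against an
  \<open>A\<close>-measurable weight, and a bounded weight preserves L^1 convergence. Integrability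
  of the increments is available only for small h, hence only eventually.\<close>

lemma cond_L1_limit_weak:
  assumes A: "subalgebra M A" and Z: "cond_L1_limit M A D Z"
    and \<zeta>: "\<zeta> \<in> borel_measurable A" "\<And>w. \<bar>\<zeta> w\<bar> \<le> C"
    and h: "\<And>n. 0 < h n" "h \<longlonglongrightarrow> 0"
  shows "\<forall>\<^sub>F n in sequentially. integrable M (\<lambda>w. \<zeta> w * D (h n) w $ i)"
    and "integrable M (\<lambda>w. \<zeta> w * Z w $ i)"
    and "(\<lambda>n. expectation (\<lambda>w. \<zeta> w * D (h n) w $ i) / h n) \<longlonglongrightarrow> expectation (\<lambda>w. \<zeta> w * Z w $ i)"
proof -
  interpret S: sigma_finite_subalgebra M A by (rule sigma_finite_subalgebraI[OF A])
  have \<zeta>m: "\<zeta> \<in> borel_measurable M" by (rule measurable_from_subalg[OF A \<zeta>(1)])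
  have C0: "0 \<le> C" using \<zeta>(2)[of undefined] by linarith
  have h0: "filterlim h (at_right 0) sequentially" unfolding filterlim_at
    using h(2) less_imp_neq[OF h(1)] by (auto intro!: always_eventually simp: h(1))
  have iD: "\<forall>\<^sub>F n in sequentially. integrable M (D (h n))"
    using Z filterlim_iff[THEN iffD1, OF h0] unfolding cond_L1_limit_def by blast
  have \<zeta>int: "integrable M (\<lambda>w. \<zeta> w * f w)" if f: "integrable M f" for f
  proof (rule Bochner_Integration.integrable_bound[OF integrable_mult_right[OF f, of C]])
    show "(\<lambda>w. \<zeta> w * f w) \<in> borel_measurable M" using \<zeta>m f by measurable
    show "AE w in M. norm (\<zeta> w * f w) \<le> norm (C * f w)"
      using \<zeta>(2) C0 by (intro AE_I2) (auto simp: abs_mult intro!: mult_right_mono)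
  qed
  show "\<forall>\<^sub>F n in sequentially. integrable M (\<lambda>w. \<zeta> w * D (h n) w $ i)"
    using iD by eventually_elim (intro \<zeta>int integrable_vec_nth)
  have iZ: "integrable M Z" using Z by (simp add: cond_L1_limit_def)
  show iZ': "integrable M (\<lambda>w. \<zeta> w * Z w $ i)" by (intro \<zeta>int integrable_vec_nth iZ)
  let ?V = "\<lambda>n. vec_cond_exp M A (\<lambda>w. D (h n) w /\<^sub>R h n)"
  have "(\<lambda>n. C * (LINT w|M. norm (?V n w - Z w))) \<longlonglongrightarrow> C * 0"
    using Z unfolding cond_L1_limit_def by (intro tendsto_mult tendsto_const filterlim_compose[OF _ h0]) auto
  then have "(\<lambda>n. C * (LINT w|M. norm (?V n w - Z w))) \<longlonglongrightarrow> 0" by simp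
  moreover have "\<forall>\<^sub>F n in sequentially. norm (expectation (\<lambda>w. \<zeta> w * D (h n) w $ i) / h n - expectation (\<lambda>w. \<zeta> w * Z w $ i))
      \<le> C * (LINT w|M. norm (?V n w - Z w))"
    using iD
  proof eventually_elim
    case (elim n)
    then have Dh: "integrable M (\<lambda>w. D (h n) w /\<^sub>R h n)" by (rule integrable_scaleR_right)
    have V: "integrable M (?V n)" by (rule integrable_vec_cond_exp[OF A Dh])
    have Di: "integrable M (\<lambda>w. (D (h n) w /\<^sub>R h n) $ i)" by (rule integrable_vec_nth[OF Dh])
    have "expectation (\<lambda>w. \<zeta> w * D (h n) w $ i) / h n = expectation (\<lambda>w. \<zeta> w * (D (h n) w /\<^sub>R h n) $ i)"
    proof -
      have "(\<lambda>w. \<zeta> w * (D (h n) w /\<^sub>R h n) $ i) = (\<lambda>w. inverse (h n) * (\<zeta> w * D (h n) w $ i))"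
        by (simp add: fun_eq_iff)
      then show ?thesis by (simp add: divide_inverse mult.commute)
    qed
    also have "\<dots> = expectation (\<lambda>w. \<zeta> w * ?V n w $ i)"
      using S.real_cond_exp_intg(2)[OF \<zeta>int[OF Di] \<zeta>(1) borel_measurable_integrable[OF Di]]
      by (simp add: vec_cond_exp_def)
    finally have "expectation (\<lambda>w. \<zeta> w * D (h n) w $ i) / h n - expectation (\<lambda>w. \<zeta> w * Z w $ i)
      = expectation (\<lambda>w. \<zeta> w * (?V n w - Z w) $ i)"
      using \<zeta>int[OF integrable_vec_nth[OF V]] iZ' by (simp add: right_diff_distrib)
    also have "\<bar>\<dots>\<bar> \<le> expectation (\<lambda>w. \<bar>\<zeta> w * (?V n w - Z w) $ i\<bar>)" by (rule integral_abs_bound)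
    also have "\<dots> \<le> expectation (\<lambda>w. C * norm (?V n w - Z w))"
    proof (rule integral_mono)
      have VZ: "integrable M (\<lambda>w. ?V n w - Z w)" using V iZ by simp
      show "integrable M (\<lambda>w. \<bar>\<zeta> w * (?V n w - Z w) $ i\<bar>)"
        by (rule integrable_abs, rule \<zeta>int, rule integrable_vec_nth[OF VZ])
      show "integrable M (\<lambda>w. C * norm (?V n w - Z w))" using VZ by simp
      show "\<bar>\<zeta> w * (?V n w - Z w) $ i\<bar> \<le> C * norm (?V n w - Z w)" for w
        unfolding abs_mult using \<zeta>(2) C0 by (intro mult_mono component_le_norm_cart) auto
    qed
    also have "\<dots> = C * (LINT w|M. norm (?V n w - Z w))" by simp
    finally show ?case by simp
  qed
  ultimately have "(\<lambda>n. expectation (\<lambda>w. \<zeta> w * D (h n) w $ i) / h n - expectation (\<lambda>w. \<zeta> w * Z w $ i)) \<longlonglongrightarrow> 0"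
    by (rule Lim_null_comparison[rotated])
  then show "(\<lambda>n. expectation (\<lambda>w. \<zeta> w * D (h n) w $ i) / h n) \<longlonglongrightarrow> expectation (\<lambda>w. \<zeta> w * Z w $ i)"
    by (simp add: LIM_zero_iff)
qed

text \<open>Matches a limit computed from an explicit version \<open>q\<close> of the combined
  increments with the two abstract derivatives. It is used with coefficient -1 for the forward
  derivatives and 1 for the backward ones.\<close>

lemma cond_L1_limit_combination:
  assumes A: "subalgebra M A" and Z: "cond_L1_limit M A D Z" "cond_L1_limit M A D' Z'"
    and \<zeta>: "\<zeta> \<in> borel_measurable A" "\<And>w. \<bar>\<zeta> w\<bar> \<le> C"
    and h: "\<And>n. 0 < h n" "h \<longlonglongrightarrow> 0"
    and q: "\<And>n. q n \<in> borel_measurable M" "\<And>n. AE w in M. \<zeta> w * D (h n) w $ i + \<kappa> * (\<zeta> w * D' (h n) w $ i) = q n w"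
    and L: "(\<lambda>n. expectation (q n) / h n) \<longlonglongrightarrow> L"
  shows "L = expectation (\<lambda>w. \<zeta> w * Z w $ i) + \<kappa> * expectation (\<lambda>w. \<zeta> w * Z' w $ i)"
proof -
  note w = cond_L1_limit_weak[OF A Z(1) \<zeta> h, of i] and w' = cond_L1_limit_weak[OF A Z(2) \<zeta> h, of i]
  have "\<forall>\<^sub>F n in sequentially. expectation (\<lambda>w. \<zeta> w * D (h n) w $ i) / h n
      + \<kappa> * (expectation (\<lambda>w. \<zeta> w * D' (h n) w $ i) / h n) = expectation (q n) / h n"
    using w(1) w'(1)
  proof eventually_elim
    case (elim n)
    let ?f = "\<lambda>w. \<zeta> w * D (h n) w $ i + \<kappa> * (\<zeta> w * D' (h n) w $ i)"
    have "integrable M ?f" using elim by simp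
    then have "expectation ?f = expectation (q n)"
      by (intro integral_cong_AE borel_measurable_integrable q)
    moreover have "expectation ?f = expectation (\<lambda>w. \<zeta> w * D (h n) w $ i) + \<kappa> * expectation (\<lambda>w. \<zeta> w * D' (h n) w $ i)"
      using elim by simp
    ultimately show ?case by (metis add_divide_distrib times_divide_eq_right)
  qed
  from Lim_transform_eventually[OF tendsto_add[OF w(3) tendsto_mult_left[OF w'(3)]] this]
  show ?thesis by (rule LIMSEQ_unique[OF L])
qed

lemma has_stoch_deriv_unique:
  assumes "subalgebra M (P t)" "subalgebra M (F t)"
    and "has_stoch_deriv M P F V t D" "has_stoch_deriv M P F V t D'"
  shows "AE w in M. D w = D' w"
proof -
  obtain dY bY dZ bZ where 1: "has_forward_deriv M P (\<lambda>s w. Re_vec (V s w)) t dY" "has_backward_deriv M F (\<lambda>s w. Re_vec (V s w)) t bY"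
    "has_forward_deriv M P (\<lambda>s w. Im_vec (V s w)) t dZ" "has_backward_deriv M F (\<lambda>s w. Im_vec (V s w)) t bZ"
    "AE w in M. D w = Complex_vec ((dY w + bY w) /\<^sub>R 2) ((dY w - bY w) /\<^sub>R 2) +
           \<i> *s Complex_vec ((dZ w + bZ w) /\<^sub>R 2) ((dZ w - bZ w) /\<^sub>R 2)"
    using assms(3) unfolding has_stoch_deriv_def by blast
  obtain dY' bY' dZ' bZ' where 2: "has_forward_deriv M P (\<lambda>s w. Re_vec (V s w)) t dY'" "has_backward_deriv M F (\<lambda>s w. Re_vec (V s w)) t bY'"
    "has_forward_deriv M P (\<lambda>s w. Im_vec (V s w)) t dZ'" "has_backward_deriv M F (\<lambda>s w. Im_vec (V s w)) t bZ'"
    "AE w in M. D' w = Complex_vec ((dY' w + bY' w) /\<^sub>R 2) ((dY' w - bY' w) /\<^sub>R 2) +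
           \<i> *s Complex_vec ((dZ' w + bZ' w) /\<^sub>R 2) ((dZ' w - bZ' w) /\<^sub>R 2)"
    using assms(4) unfolding has_stoch_deriv_def by blast
  note f = cond_L1_limit_unique[OF assms(1)] and b = cond_L1_limit_unique[OF assms(2)]
  show ?thesis
    using 1(5) 2(5) f[OF 1(1)[unfolded has_forward_deriv_iff] 2(1)[unfolded has_forward_deriv_iff]]
      f[OF 1(3)[unfolded has_forward_deriv_iff] 2(3)[unfolded has_forward_deriv_iff]]
      b[OF 1(2)[unfolded has_backward_deriv_iff] 2(2)[unfolded has_backward_deriv_iff]]
      b[OF 1(4)[unfolded has_backward_deriv_iff] 2(4)[unfolded has_backward_deriv_iff]]
    by eventually_elim simp
qed

end

text \<open>The first identity isolates the forward derivative of Y - Z and the backward derivative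
  of Y + Z. The second, for the real process X with Z = 0, isolates the forward derivative of
  X.\<close>

lemma stoch_deriv_components:
  assumes "D = Complex_vec ((dY + bY) /\<^sub>R 2) ((dY - bY) /\<^sub>R 2) + \<i> *s Complex_vec ((dZ + bZ) /\<^sub>R 2) ((dZ - bZ) /\<^sub>R 2)"
  shows "2 * Re (D $ i) = (dY $ i - dZ $ i) + (bY $ i + bZ $ i)"
    and "Re (D $ i) + Im (D $ i) = dY $ i + bZ $ i"
  unfolding assms by (simp_all add: Complex_vec_def field_simps)

lemma Complex_vec_simps [simp]:
  "Re_vec (Complex_vec u v) = u" "Im_vec (Complex_vec u v) = v" "Complex_vec u v $ i = Complex (u $ i) (v $ i)"
  by (simp_all add: Complex_vec_def Re_vec_def Im_vec_def vec_eq_iff)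

section \<open>Positivity of the density, identification of the drift, and the equations for R and
  S\<close>

lemma positive_if_log_gradient_bounded:
  fixes f :: "real ^ 'n \<Rightarrow> real"
  assumes d: "\<And>y. f differentiable (at y)" and nn: "\<And>y. 0 \<le> f y"
    and bd: "\<And>y i. f y \<noteq> 0 \<Longrightarrow> \<bar>pdx i f y\<bar> \<le> C * f y" and a: "f a \<noteq> 0"
  shows "0 < f x"
proof -
  define v where "v = x - a"
  define \<phi> where "\<phi> = (\<lambda>s. f (a + s *\<^sub>R v))"
  have D: "(\<phi> has_real_derivative dd v f (a + s *\<^sub>R v)) (at s)" for s
    unfolding \<phi>_def by (rule DERIV_along_line[OF d])
  have "0 \<le> C * f a" using bd[OF a, of undefined] by (rule order_trans[OF abs_ge_zero])
  then have C0: "0 \<le> C" using a nn[of a] by (simp add: zero_le_mult_iff)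
  define L where "L = (\<Sum>i\<in>UNIV. \<bar>v $ i\<bar> * C)"
  \<comment> \<open>A Gronwall argument along the segment from a to x: this inequality makes exp(L
    s) \<phi>(s) nondecreasing, so \<phi> cannot drop from a positive value to zero.\<close>
  have b: "- L * \<phi> s \<le> dd v f (a + s *\<^sub>R v)" for s
  proof (cases "\<phi> s = 0")
    case True
    \<comment> \<open>At a zero the gradient bound says nothing, but there the nonnegative function
      has a minimum.\<close>
    have "dd v f (a + s *\<^sub>R v) = 0"
      by (rule DERIV_local_min[OF D, of 1]) (use True nn in \<open>auto simp: \<phi>_def\<close>)
    then show ?thesis using True by simp
  next
    case False
    define y where "y = a + s *\<^sub>R v"
    have fy: "f y \<noteq> 0" using False by (simp add: \<phi>_def y_def)
    have "\<bar>dd v f y\<bar> \<le> (\<Sum>i\<in>UNIV. \<bar>v $ i\<bar> * (C * f y))"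
      unfolding dd_sum_axis[OF d, of v] using bd[OF fy]
      by (intro sum_abs[THEN order_trans] sum_mono) (auto simp: abs_mult intro!: mult_left_mono)
    also have "\<dots> = L * f y" by (simp add: L_def sum_distrib_right mult.assoc)
    finally show ?thesis unfolding \<phi>_def y_def by linarith
  qed
  have "\<exists>D. ((\<lambda>s. exp (L * s) * \<phi> s) has_real_derivative D) (at s) \<and> 0 \<le> D" for s
  proof (intro exI conjI)
    show "((\<lambda>s. exp (L * s) * \<phi> s) has_real_derivative (exp (L * s) * (L * \<phi> s + dd v f (a + s *\<^sub>R v)))) (at s)"
      by (auto intro!: derivative_eq_intros D simp: algebra_simps)
    show "0 \<le> exp (L * s) * (L * \<phi> s + dd v f (a + s *\<^sub>R v))" using b[of s] by (intro mult_nonneg_nonneg) auto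
  qed
  then have "exp (L * 0) * \<phi> 0 \<le> exp (L * 1) * \<phi> 1"
    by (intro DERIV_nonneg_imp_nondecreasing[of 0 1 "\<lambda>s. exp (L * s) * \<phi> s"]) auto
  moreover have "0 < \<phi> 0" using a nn[of a] by (simp add: \<phi>_def)
  ultimately have "0 < exp L * \<phi> 1" by simp
  then show ?thesis by (simp add: \<phi>_def v_def zero_less_mult_iff)
qed

lemma div_matrix_scalar:
  fixes q :: "real ^ 'n::finite \<Rightarrow> real"
  assumes "q differentiable (at x)"
  shows "div_matrix (mat \<sigma> ** transpose (mat \<sigma>)) q x $ i = \<sigma>\<^sup>2 * pdx i q x"
proof -
  have entry: "((mat \<sigma> :: real ^ 'n ^ 'n) ** transpose (mat \<sigma>)) $ i $ j = (if i = j then \<sigma>\<^sup>2 else 0)" for j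
  proof -
    have "((mat \<sigma> :: real ^ 'n ^ 'n) ** transpose (mat \<sigma>)) $ i $ j = (\<Sum>k\<in>UNIV. (if i = k then \<sigma> else 0) * (if j = k then \<sigma> else 0))"
      by (simp add: matrix_matrix_mult_def transpose_def mat_def)
    also have "\<dots> = (\<Sum>k\<in>UNIV. if k = i then (if i = j then \<sigma>\<^sup>2 else 0) else 0)"
      by (rule sum.cong) (auto simp: power2_eq_square)
    finally show ?thesis by simp
  qed
  have "pderiv_at j (\<lambda>y. (if i = j then \<sigma>\<^sup>2 else 0) * q y) x = (if i = j then \<sigma>\<^sup>2 * pdx j q x else 0)" for j
  proof -
    have "(\<lambda>y. (if i = j then \<sigma>\<^sup>2 else 0) * q y) differentiable (at x)" using assms by (intro differentiable_mult) auto
    from pderiv_at_eq_dd[OF this, of j] show ?thesis using dd_cmult[OF assms] by simp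
  qed
  then show ?thesis unfolding div_matrix_def by (simp add: entry del: transpose_mat)
qed

context diffusion
begin

text \<open>The coordinates of X are unbounded, so they are treated directly as the linear term of
  an expansion instead of through \<open>forward_limit\<close>.\<close>

lemma forward_position_limit:
  assumes t: "t \<in> {0<..<1}" and g: "continuous_on UNIV g" "\<And>x. x \<notin> cball c r \<Longrightarrow> g x = 0"
    and h: "\<And>n. 0 < h n" "h \<longlonglongrightarrow> 0" "\<And>n. t + h n < 1"
  shows "(\<lambda>n. expectation (\<lambda>w. g (X t w) * (X (t + h n) w - X t w) $ i) / h n)
     \<longlonglongrightarrow> expectation (\<lambda>w. g (X t w) * b t (X t w) $ i)"
proof -
  interpret I: increment_sequence M P F X W b p \<sigma> B t "\<lambda>_. t" h
    by unfold_locales (use t h in \<open>auto intro: less_imp_le\<close>)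
  have t01: "t \<in> {0..1}" using t by auto
  obtain C where C: "C \<ge> 0" "\<And>x. \<bar>g x * 1\<bar> \<le> C"
    using compact_support_mult_bound[where q = "\<lambda>_. 1", OF g continuous_on_const] by blast
  show ?thesis
    using I.linear_limit(2)[of "\<lambda>n w. g (X t w)" C "\<lambda>w. g (X t w)" i] measurable_comp_X[OF t01 g(1)] C
    by (simp add: I.inc_def)
qed

end

lemma smooth_on_subset:
  assumes "smooth_on A f" "B \<subseteq> A"
  shows "smooth_on B f"
proof (rule smooth_onI)
  fix a assume "a \<in> B"
  then have "a \<in> A" using assms(2) by blast
  then obtain N g where N: "open N" "a \<in> N" "Cinf_on N g" "\<And>x. x \<in> A \<inter> N \<Longrightarrow> f x = g x"
    using smooth_onD[OF assms(1)] by metis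
  show "\<exists>N g. open N \<and> a \<in> N \<and> Cinf_on N g \<and> (\<forall>x\<in>B \<inter> N. f x = g x)"
    by (rule exI[of _ N], rule exI[of _ g]) (use N assms(2) in blast)
qed

text \<open>The passage from probability to analysis: the conclusions are positivity of p and
  differential equations for R and S, in which the process no longer occurs.\<close>

lemma stochastic_newton_imp_pde:
  fixes M :: "'w measure"
    and P F :: "real \<Rightarrow> 'w measure"
    and X :: "real \<Rightarrow> 'w \<Rightarrow> real ^ 'n::finite"
    and p R S :: "real \<Rightarrow> real ^ 'n \<Rightarrow> real"
  assumes U: "smooth_on UNIV U"
    and gd: "good_diffusion M P F \<sigma> b p X"
    and newton: "has_second_stoch_deriv M P F X (\<lambda>t w. Complex_vec (- grad U (X t w)) 0)"
    and wave: "wave_potentials M P F \<sigma> p X R S"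
    and sigma: "\<sigma> \<noteq> 0"
  defines "Rf \<equiv> \<lambda>z. R (fst z) (snd z)" and "Sf \<equiv> \<lambda>z. S (fst z) (snd z)"
  shows "\<And>t x. t \<in> {0<..1} \<Longrightarrow> 0 < p t x"
    and "\<And>z. z \<in> spacetime \<Longrightarrow> dt Rf z + (\<Sum>i\<in>UNIV. dx i Rf z * dx i Sf z + \<sigma>\<^sup>2 / 2 * dx i (dx i Sf) z) = 0"
    and "\<And>i t x. t \<in> {0<..<1} \<Longrightarrow> dt (dx i Sf) (t, x) + (\<Sum>j\<in>UNIV. dx j Sf (t, x) * dx j (dx i Sf) (t, x) - dx j Rf (t, x) * dx j (dx i Rf) (t, x)
      - \<sigma>\<^sup>2 / 2 * dx j (dx j (dx i Rf)) (t, x)) = - pdx i U x"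
proof -
  have ps: "prob_space M" and incr: "increasing_filtration M P" and ad: "adapted P X"
    and decr: "decreasing_filtration M F" and adF: "adapted F X"
    and sde: "solves_sde M P \<sigma> b X"
    and dens: "\<And>t. t \<in> {0<..1} \<Longrightarrow> (\<forall>x. 0 \<le> p t x) \<and> distributed M lborel (X t) (\<lambda>x. ennreal (p t x)) \<and> p t differentiable_on UNIV"
    and bc: "continuous_on ({0..1} \<times> UNIV) (\<lambda>(t, x). b t x)"
    and bb: "bounded ((\<lambda>(t, x). b t x) ` ({0..1} \<times> UNIV))"
    and lb: "bounded ((\<lambda>(t, x). (1 / p t x) *\<^sub>R div_matrix (mat \<sigma> ** transpose (mat \<sigma>)) (p t) x) ` Theta p)"
    using gd unfolding good_diffusion_def forward_markov_def backward_markov_def by blast+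
  obtain W where W: "brownian_motion M P W"
    "AE w in M. continuous_on {0..1} (\<lambda>t. X t w) \<and>
           (\<forall>t\<in>{0..1}. X t w = X 0 w + (LINT s:{0..t}|lborel. b s (X s w)) + \<sigma> *\<^sub>R W t w)"
    using sde unfolding solves_sde_def by blast
  obtain B where "\<And>y. y \<in> (\<lambda>(t, x). b t x) ` ({0..1} \<times> UNIV) \<Longrightarrow> norm y \<le> B" using bb unfolding bounded_iff by blast
  then have B: "norm (b t x) \<le> B" if "t \<in> {0..1}" for t x using that by force
  interpret prob_space M by (rule ps)
  interpret diffusion M P F X W b p \<sigma> B
    by unfold_locales (use incr ad decr adF W bc B dens in auto)
  have pd: "p t differentiable (at x)" if "t \<in> {0<..1}" for t x
    using dens[OF that] by (simp add: differentiable_on_def)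
  obtain C where C: "\<And>y. y \<in> (\<lambda>(t, x). (1 / p t x) *\<^sub>R div_matrix (mat \<sigma> ** transpose (mat \<sigma>)) (p t) x) ` Theta p \<Longrightarrow> norm y \<le> C"
    using lb unfolding bounded_iff by blast
  \<comment> \<open>For a = sigma^2 Id the bounded quotient in \<open>good_diffusion\<close> is
    sigma^2 times grad p / p.\<close>
  have grad_bd: "\<bar>pdx i (p t) x\<bar> \<le> C / \<sigma>\<^sup>2 * p t x" if t: "t \<in> {0<..1}" and nz: "p t x \<noteq> 0" for t x i
  proof -
    have pos: "0 < p t x" using dens[OF t] nz by (simp add: order_less_le)
    have "(t, x) \<in> Theta p" using t nz by (simp add: Theta_def)
    then have "norm ((1 / p t x) *\<^sub>R div_matrix (mat \<sigma> ** transpose (mat \<sigma>)) (p t) x) \<le> C" by (intro C) force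
    then have "\<bar>((1 / p t x) *\<^sub>R div_matrix (mat \<sigma> ** transpose (mat \<sigma>)) (p t) x) $ i\<bar> \<le> C"
      by (rule order_trans[OF component_le_norm_cart])
    then have "\<sigma>\<^sup>2 * \<bar>pdx i (p t) x\<bar> / p t x \<le> C"
      using pos by (simp add: div_matrix_scalar[OF pd[OF t]] abs_mult del: transpose_mat)
    then show ?thesis using pos sigma by (simp add: field_simps)
  qed
  show pos: "0 < p t x" if t: "t \<in> {0<..1}" for t x
  proof -
    \<comment> \<open>An identically vanishing density could not have total mass 1.\<close>
    have "\<exists>a. p t a \<noteq> 0"
    proof (rule ccontr)
      assume "\<not> ?thesis"
      then have "p t x = 0" for x by blast
      moreover have "expectation (\<lambda>w. 1) = (LINT x|lborel. p t x * 1)"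
        by (rule expectation_density[OF t]) simp
      ultimately show False by (simp add: prob_space)
    qed
    then obtain a where "p t a \<noteq> 0" by blast
    then show ?thesis
      using positive_if_log_gradient_bounded[OF pd[OF t] density_nonneg[OF t] grad_bd[OF t]] by blast
  qed
  have nz: "p t x \<noteq> 0" if "t \<in> {0<..1}" for t x using pos[OF that, of x] by simp
  have Theta: "Theta p = {0<..1} \<times> UNIV" by (auto simp: Theta_def nz)
  have Rsm: "smooth_on ({0<..1} \<times> UNIV) Rf" "smooth_on ({0<..1} \<times> UNIV) Sf"
    using wave unfolding wave_potentials_def Theta Rf_def Sf_def by (simp_all add: case_prod_beta')
  have "spacetime \<subseteq> {0<..1} \<times> (UNIV :: (real ^ 'n) set)" by auto
  note sub = smooth_on_subset[OF _ this]
  have R: "Cinf_on spacetime Rf" and S: "Cinf_on spacetime Sf"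
    by (rule smooth_on_open_imp_Cinf_on[OF open_spacetime sub], rule Rsm)+
  have Rln: "R t x = \<sigma>\<^sup>2 / 2 * ln (p t x)" if "t \<in> {0<..1}" for t x
    using wave that unfolding wave_potentials_def Theta by auto
  have gradR: "grad (R t) x $ i = dx i Rf (t, x)" and gradS: "grad (S t) x $ i = dx i Sf (t, x)"
    if t: "t \<in> {0<..<1}" for t x i
  proof -
    have e: "R t = (\<lambda>x. Rf (t, x))" "S t = (\<lambda>x. Sf (t, x))" by (simp_all add: Rf_def Sf_def)
    have "(\<lambda>x. Rf (t, x)) differentiable (at x)" "(\<lambda>x. Sf (t, x)) differentiable (at x)"
      using Cinf_on_differentiable[OF Cinf_on_slice_UNIV[OF R t]] Cinf_on_differentiable[OF Cinf_on_slice_UNIV[OF S t]] by auto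
    from pderiv_at_eq_dd[OF this(1), of i] pderiv_at_eq_dd[OF this(2), of i]
    show "grad (R t) x $ i = dx i Rf (t, x)" "grad (S t) x $ i = dx i Sf (t, x)"
      by (simp_all add: grad_def e pdx_slice[OF R t] pdx_slice[OF S t])
  qed
  have R_bd: "\<bar>dx i Rf z\<bar> \<le> C / 2" if z: "z \<in> spacetime" for z i
  proof -
    obtain t x where zt: "z = (t, x)" by (cases z)
    have t: "t \<in> {0<..<1}" "t \<in> {0<..1}" using z zt by auto
    have "dx i Rf (t, x) = pdx i (\<lambda>x. Rf (t, x)) x" using pdx_slice[OF R t(1), of i] by metis
    also have "(\<lambda>x. Rf (t, x)) = (\<lambda>x. \<sigma>\<^sup>2 / 2 * ln (p t x))" by (rule ext) (simp add: Rf_def Rln[OF t(2)])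
    also have "pdx i (\<lambda>x. \<sigma>\<^sup>2 / 2 * ln (p t x)) x = \<sigma>\<^sup>2 / 2 * (pdx i (p t) x / p t x)"
    proof -
      have "((\<lambda>x. ln (p t x)) has_derivative (\<lambda>v. dd v (p t) x * inverse (p t x))) (at x)"
        using DERIV_compose_FDERIV[OF DERIV_ln[OF pos[OF t(2), of x]] has_derivative_dd[OF pd[OF t(2), of x]]] .
      from dd_unique[OF has_derivative_mult_right[OF this, of "\<sigma>\<^sup>2 / 2"], of "axis i 1"]
      show ?thesis by (simp only: divide_inverse)
    qed
    finally have "\<bar>dx i Rf z\<bar> = \<sigma>\<^sup>2 / 2 * (\<bar>pdx i (p t) x\<bar> / p t x)" using pos[OF t(2), of x] zt by (simp add: abs_mult)
    also have "\<dots> \<le> \<sigma>\<^sup>2 / 2 * (C / \<sigma>\<^sup>2)"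
    proof (rule mult_left_mono)
      show "\<bar>pdx i (p t) x\<bar> / p t x \<le> C / \<sigma>\<^sup>2"
        using grad_bd[OF t(2) nz[OF t(2)], of i x] pos[OF t(2), of x] by (simp only: pos_divide_le_eq)
    qed simp
    also have "\<dots> = C / 2" using sigma by simp
    finally show ?thesis .
  qed
  have p_eq: "p t x = exp (2 / \<sigma>\<^sup>2 * Rf (t, x))" if "t \<in> {0<..<1}" for t x
  proof -
    have t: "t \<in> {0<..1}" using that by auto
    have "2 / \<sigma>\<^sup>2 * Rf (t, x) = ln (p t x)" unfolding Rf_def fst_conv snd_conv Rln[OF t] using sigma by simp
    then show ?thesis using pos[OF t] by simp
  qed
  have pot: "has_stoch_deriv M P F (\<lambda>s w. Complex_vec (X s w) 0) t (\<lambda>w. Complex_vec (grad (S t) (X t w)) (grad (R t) (X t w)))"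
    if "t \<in> {0<..<1}" for t
    using wave that unfolding wave_potentials_def by blast
  \<comment> \<open>The forward derivative of X is computed twice: it is grad S + grad R by the
    second identity of \<open>stoch_deriv_components\<close>, and b by
    \<open>forward_position_limit\<close>. The two agree almost surely at X_t, hence everywhere by
    continuity and positivity of p.\<close>
  have b_eq: "b t x $ i = dx i Sf (t, x) + dx i Rf (t, x)" if t: "t \<in> {0<..<1}" for t x i
  proof -
    have t01: "t \<in> {0..1}" "t \<in> {0<..1}" using t by auto
    obtain dY bY dZ bZ where D: "cond_L1_limit M (P t) (\<lambda>h w. X (t + h) w - X t w) dY"
      "cond_L1_limit M (F t) (\<lambda>h w. 0) bZ"
      "AE w in M. Complex_vec (grad (S t) (X t w)) (grad (R t) (X t w)) = Complex_vec ((dY w + bY w) /\<^sub>R 2) ((dY w - bY w) /\<^sub>R 2) +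
           \<i> *s Complex_vec ((dZ w + bZ w) /\<^sub>R 2) ((dZ w - bZ w) /\<^sub>R 2)"
      using pot[OF t] unfolding has_stoch_deriv_def has_forward_deriv_iff has_backward_deriv_iff by auto
    have AE: "AE w in M. dx i Sf (t, X t w) + dx i Rf (t, X t w) = dY w $ i + bZ w $ i"
      using D(3)
    proof eventually_elim
      case (elim w)
      from stoch_deriv_components(2)[OF elim, of i] show ?case by (simp add: gradS[OF t] gradR[OF t])
    qed
    have cG: "continuous_on UNIV (\<lambda>x. dx i Sf (t, x) + dx i Rf (t, x))"
      by (intro continuous_on_add Cinf_on_continuous[OF Cinf_on_slice_UNIV[OF _ t]] Cinf_on_dd R S)
    have cb: "continuous_on UNIV (\<lambda>x. b t x $ i)"
      by (intro continuous_on_component b_slice_continuous t01)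
    have cp: "continuous_on UNIV (p t)"
      using dens[OF t01(2)] differentiable_imp_continuous_on by blast
    have "p t x * (dx i Sf (t, x) + dx i Rf (t, x) - b t x $ i) = 0"
    proof (rule test_function_zero[where m = 4 and Q = "\<lambda>x. p t x * (dx i Sf (t, x) + dx i Rf (t, x) - b t x $ i)"])
      show "continuous_on UNIV (\<lambda>x. p t x * (dx i Sf (t, x) + dx i Rf (t, x) - b t x $ i))"
        by (intro continuous_on_mult continuous_on_diff cp cb cG)
      fix c :: "real ^ 'n" and r :: real assume r: "0 < r"
      let ?g = "bump 4 c r"
      have supp: "y \<notin> cball c r \<Longrightarrow> ?g y = 0" for y using bump_eq_0[of y c r 4] r by simp
      have cg: "continuous_on UNIV ?g" using Ck_on_continuous[OF Ck_on_bump[of 3 c r]] by (simp add: eval_nat_numeral)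
      have gb: "\<bar>?g (X t w)\<bar> \<le> (r\<^sup>2) ^ 4" for w using bump_le[of 4 c r] bump_nonneg[of 4 c r] by (simp add: abs_le_iff order_trans[of "- _" 0])
      define h where "h = (\<lambda>n::nat. (1 - t) / 2 / real (Suc n))"
      have h: "0 < h n" "h \<longlonglongrightarrow> 0" "h n \<le> (1 - t) / 2" for n
        unfolding h_def using t by (intro harmonic_null_sequence; simp)+
      have th: "t + h n < 1" for n using h(3)[of n] t by (simp add: field_simps)
      note mg = measurable_comp_X[OF t01(1) cg]
      note w1 = cond_L1_limit_weak[OF subalgebra_P[OF t01(1)] D(1) mg(1) gb h(1,2), of i]
      note w2 = cond_L1_limit_weak[OF subalgebra_F[OF t01(1)] D(2) mg(3) gb h(1,2), of i]
      have e1: "expectation (\<lambda>w. ?g (X t w) * dY w $ i) = expectation (\<lambda>w. ?g (X t w) * b t (X t w) $ i)"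
        by (rule LIMSEQ_unique[OF w1(3) forward_position_limit[OF t cg supp h(1,2) th]])
      \<comment> \<open>The imaginary part of X is the constant 0, so all its difference quotients
        vanish.\<close>
      have e2: "expectation (\<lambda>w. ?g (X t w) * bZ w $ i) = 0"
        using LIMSEQ_unique[OF w2(3), of 0] by simp
      have "expectation (\<lambda>w. ?g (X t w) * (dx i Sf (t, X t w) + dx i Rf (t, X t w)))
          = expectation (\<lambda>w. ?g (X t w) * dY w $ i + ?g (X t w) * bZ w $ i)"
      proof (rule integral_cong_AE)
        show "(\<lambda>w. ?g (X t w) * (dx i Sf (t, X t w) + dx i Rf (t, X t w))) \<in> borel_measurable M"
          by (rule measurable_comp_X[OF t01(1) continuous_on_mult[OF cg cG]])
        show "(\<lambda>w. ?g (X t w) * dY w $ i + ?g (X t w) * bZ w $ i) \<in> borel_measurable M"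
          using borel_measurable_integrable[OF w1(2)] borel_measurable_integrable[OF w2(2)] by measurable
        show "AE w in M. ?g (X t w) * (dx i Sf (t, X t w) + dx i Rf (t, X t w)) = ?g (X t w) * dY w $ i + ?g (X t w) * bZ w $ i"
          using AE by eventually_elim (simp add: distrib_left)
      qed
      also have "\<dots> = expectation (\<lambda>w. ?g (X t w) * b t (X t w) $ i)"
        using w1(2) w2(2) e1 e2 by simp
      finally have "(LINT x|lborel. p t x * (?g x * (dx i Sf (t, x) + dx i Rf (t, x)))) = (LINT x|lborel. p t x * (?g x * b t x $ i))"
        using expectation_density[OF t01(2) borel_measurable_continuous_onI[OF continuous_on_mult[OF cg cG]]]
          expectation_density[OF t01(2) borel_measurable_continuous_onI[OF continuous_on_mult[OF cg cb]]] by simp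
      moreover have "integrable lborel (\<lambda>x. ?g x * (p t x * (dx i Sf (t, x) + dx i Rf (t, x))))" "integrable lborel (\<lambda>x. ?g x * (p t x * b t x $ i))"
        by (rule integrable_compact_support_mult[OF cg supp continuous_on_mult[OF cp cG]], assumption,
            rule integrable_compact_support_mult[OF cg supp continuous_on_mult[OF cp cb]], assumption)
      ultimately show "(LINT x|lborel. ?g x * (p t x * (dx i Sf (t, x) + dx i Rf (t, x) - b t x $ i))) = 0"
        by (simp add: right_diff_distrib mult.left_commute)
    qed simp
    then show ?thesis using pos[OF t01(2), of x] by simp
  qed
  interpret wave_diffusion M P F X W b p \<sigma> B Rf Sf "C / 2"
    by unfold_locales (use sigma R S p_eq b_eq R_bd in auto)
  show "dt Rf z + (\<Sum>i\<in>UNIV. dx i Rf z * dx i Sf z + \<sigma>\<^sup>2 / 2 * dx i (dx i Sf) z) = 0" if "z \<in> spacetime" for z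
    by (rule continuity_equation[OF that])
  obtain V where V: "\<And>t. t \<in> {0<..<1} \<Longrightarrow> has_stoch_deriv M P F (\<lambda>s w. Complex_vec (X s w) 0) t (V t)"
    "\<And>t. t \<in> {0<..<1} \<Longrightarrow> has_stoch_deriv M P F V t (\<lambda>w. Complex_vec (- grad U (X t w)) 0)"
    using newton unfolding has_second_stoch_deriv_def by blast
  \<comment> \<open>The first derivative V inside the second one is known only by existence;
    uniqueness of the limits identifies it almost surely at each time with the given
    potentials.\<close>
  have V_eq: "AE w in M. V t w = Complex_vec (grad (S t) (X t w)) (grad (R t) (X t w))" if t: "t \<in> {0<..<1}" for t
    by (rule has_stoch_deriv_unique[OF subalgebra_P subalgebra_F V(1)[OF t] pot[OF t]]) (use t in auto)
  have Ui: "Cinf_on UNIV U" by (rule smooth_on_open_imp_Cinf_on[OF open_UNIV U])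
  show "dt (dx i Sf) (t, x) + (\<Sum>j\<in>UNIV. dx j Sf (t, x) * dx j (dx i Sf) (t, x) - dx j Rf (t, x) * dx j (dx i Rf) (t, x)
      - \<sigma>\<^sup>2 / 2 * dx j (dx j (dx i Rf)) (t, x)) = - pdx i U x" if t: "t \<in> {0<..<1}" for i t x
  proof (rule mean_acceleration[OF t, of "pdx i U" "min t (1 - t) / 2"])
    show "continuous_on UNIV (pdx i U)" by (rule Cinf_on_continuous[OF Cinf_on_dd[OF Ui]])
    show "0 < min t (1 - t) / 2" "min t (1 - t) / 2 < t" "t + min t (1 - t) / 2 < 1" using t by (auto simp: min_def field_simps)
    let ?f = "\<lambda>s w. dx i Sf (s, X s w) - dx i Rf (s, X s w)" and ?b = "\<lambda>s w. dx i Sf (s, X s w) + dx i Rf (s, X s w)"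
    fix g :: "real ^ 'n \<Rightarrow> real" and c r and h :: "nat \<Rightarrow> real" and A A'
    assume g: "continuous_on UNIV g" and supp: "\<And>x. x \<notin> cball c r \<Longrightarrow> g x = 0"
      and h: "\<And>n. 0 < h n" "h \<longlonglongrightarrow> 0" "\<And>n. h n \<le> min t (1 - t) / 2"
      and A: "(\<lambda>n. expectation (\<lambda>w. g (X t w) * (?f (t + h n) w - ?f t w)) / h n) \<longlonglongrightarrow> A"
      and A': "(\<lambda>n. expectation (\<lambda>w. g (X t w) * (?b t w - ?b (t - h n) w)) / h n) \<longlonglongrightarrow> A'"
    have t01: "t \<in> {0..1}" "t \<in> {0<..1}" using t by auto
    have sn: "t + h n \<in> {0<..<1}" "t - h n \<in> {0<..<1}" for n using t h(1)[of n] h(3)[of n] by (auto simp: min_def split: if_splits)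
    obtain Cg where Cg: "Cg \<ge> 0" "\<And>x. \<bar>g x * 1\<bar> \<le> Cg"
      using compact_support_mult_bound[where q = "\<lambda>_. 1", OF g supp continuous_on_const] by blast
    have gb: "\<bar>g (X t w)\<bar> \<le> Cg" for w using Cg(2)[of "X t w"] by simp
    note mg = measurable_comp_X[OF t01(1) g]
    obtain dY bY dZ bZ where D: "cond_L1_limit M (P t) (\<lambda>h w. Re_vec (V (t + h) w) - Re_vec (V t w)) dY"
      "cond_L1_limit M (F t) (\<lambda>h w. Re_vec (V t w) - Re_vec (V (t - h) w)) bY"
      "cond_L1_limit M (P t) (\<lambda>h w. Im_vec (V (t + h) w) - Im_vec (V t w)) dZ"
      "cond_L1_limit M (F t) (\<lambda>h w. Im_vec (V t w) - Im_vec (V (t - h) w)) bZ"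
      "AE w in M. Complex_vec (- grad U (X t w)) 0 = Complex_vec ((dY w + bY w) /\<^sub>R 2) ((dY w - bY w) /\<^sub>R 2) +
           \<i> *s Complex_vec ((dZ w + bZ w) /\<^sub>R 2) ((dZ w - bZ w) /\<^sub>R 2)"
      using V(2)[OF t] unfolding has_stoch_deriv_def has_forward_deriv_iff has_backward_deriv_iff by blast
    note wY = cond_L1_limit_weak[OF subalgebra_P[OF t01(1)] D(1) mg(1) gb h(1,2), of i]
      and wY' = cond_L1_limit_weak[OF subalgebra_F[OF t01(1)] D(2) mg(3) gb h(1,2), of i]
      and wZ = cond_L1_limit_weak[OF subalgebra_P[OF t01(1)] D(3) mg(1) gb h(1,2), of i]
      and wZ' = cond_L1_limit_weak[OF subalgebra_F[OF t01(1)] D(4) mg(3) gb h(1,2), of i]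
    have V_nth: "AE w in M. Re_vec (V s w) $ i = dx i Sf (s, X s w) \<and> Im_vec (V s w) $ i = dx i Rf (s, X s w)" if s: "s \<in> {0<..<1}" for s
      using V_eq[OF s] by eventually_elim (simp add: gradS[OF s] gradR[OF s])
    have mX: "(\<lambda>w. dd d G (s, X s w)) \<in> borel_measurable M" if "Cinf_on spacetime G" "s \<in> {0<..<1}" for d s and G :: "real \<times> (real ^ 'n) \<Rightarrow> real"
      by (rule measurable_comp_X(2)[where q = "\<lambda>x. dd d G (s, x)"])
        (use that in \<open>auto intro: Cinf_on_continuous[OF Cinf_on_slice_UNIV[OF Cinf_on_dd[OF that(1)] that(2)]]\<close>)
    note mSR = mX[OF S] mX[OF R]
    \<comment> \<open>Re V - Im V is b_* along the path, so A is the tested forward derivative of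
      b_*; below, A' is that of Re V + Im V = b in the backward direction.\<close>
    have "A = expectation (\<lambda>w. g (X t w) * dY w $ i) + (- 1) * expectation (\<lambda>w. g (X t w) * dZ w $ i)"
    proof (rule cond_L1_limit_combination[OF subalgebra_P[OF t01(1)] D(1,3) mg(1) gb h(1,2) _ _ A])
      fix n
      show "(\<lambda>w. g (X t w) * (?f (t + h n) w - ?f t w)) \<in> borel_measurable M"
        by (intro borel_measurable_times borel_measurable_diff mg mSR sn t)
      show "AE w in M. g (X t w) * (Re_vec (V (t + h n) w) - Re_vec (V t w)) $ i + (- 1) * (g (X t w) * (Im_vec (V (t + h n) w) - Im_vec (V t w)) $ i)
        = g (X t w) * (?f (t + h n) w - ?f t w)"
        using V_nth[OF t] V_nth[OF sn(1)[of n]] by eventually_elim (simp add: algebra_simps)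
    qed
    moreover have "A' = expectation (\<lambda>w. g (X t w) * bY w $ i) + 1 * expectation (\<lambda>w. g (X t w) * bZ w $ i)"
    proof (rule cond_L1_limit_combination[OF subalgebra_F[OF t01(1)] D(2,4) mg(3) gb h(1,2) _ _ A'])
      fix n
      show "(\<lambda>w. g (X t w) * (?b t w - ?b (t - h n) w)) \<in> borel_measurable M"
        by (intro borel_measurable_times borel_measurable_diff borel_measurable_add mg mSR sn t)
      show "AE w in M. g (X t w) * (Re_vec (V t w) - Re_vec (V (t - h n) w)) $ i + 1 * (g (X t w) * (Im_vec (V t w) - Im_vec (V (t - h n) w)) $ i)
        = g (X t w) * (?b t w - ?b (t - h n) w)"
        using V_nth[OF t] V_nth[OF sn(2)[of n]] by eventually_elim (simp add: algebra_simps)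
    qed
    moreover let ?E = "\<lambda>w. (g (X t w) * dY w $ i - g (X t w) * dZ w $ i) + (g (X t w) * bY w $ i + g (X t w) * bZ w $ i)"
    \<comment> \<open>Twice the real part of the stochastic Newton equation, tested against
      g.\<close>
    have "- 2 * expectation (\<lambda>w. g (X t w) * pdx i U (X t w)) = expectation ?E"
    proof -
      have "expectation ?E
        = expectation (\<lambda>w. - 2 * (g (X t w) * pdx i U (X t w)))"
      proof (rule integral_cong_AE)
        show "?E \<in> borel_measurable M"
          by (intro borel_measurable_add borel_measurable_diff borel_measurable_integrable wY(2) wZ(2) wY'(2) wZ'(2))
        show "(\<lambda>w. - 2 * (g (X t w) * pdx i U (X t w))) \<in> borel_measurable M"
          by (intro borel_measurable_times borel_measurable_const mg(2) measurable_comp_X(2)[OF t01(1) Cinf_on_continuous[OF Cinf_on_dd[OF Ui]]])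
        show "AE w in M. ?E w = - 2 * (g (X t w) * pdx i U (X t w))"
          using D(5)
        proof eventually_elim
          case (elim w)
          have "grad U (X t w) $ i = pdx i U (X t w)"
            unfolding grad_def using pderiv_at_eq_dd[OF Cinf_on_differentiable[OF Ui], of "X t w" i] by simp
          with stoch_deriv_components(1)[OF elim, of i]
          have "- 2 * pdx i U (X t w) = (dY w $ i - dZ w $ i) + (bY w $ i + bZ w $ i)" by simp
          then have "g (X t w) * (- 2 * pdx i U (X t w)) = g (X t w) * ((dY w $ i - dZ w $ i) + (bY w $ i + bZ w $ i))" by simp
          then show ?case by (simp add: algebra_simps)
        qed
      qed
      then show ?thesis by simp
    qed
    ultimately show "A + A' = - 2 * expectation (\<lambda>w. g (X t w) * pdx i U (X t w))"
      using wY(2) wZ(2) wY'(2) wZ'(2) by simp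
  qed
qed

section \<open>Schroedinger's equation\<close>

lemma smooth_on_continuous_on: "smooth_on A f \<Longrightarrow> continuous_on A f"
  unfolding continuous_on_eq_continuous_within
proof
  fix a assume sm: "smooth_on A f" and a: "a \<in> A"
  obtain N g where N: "open N" "a \<in> N" "Cinf_on N g" "\<And>x. x \<in> A \<inter> N \<Longrightarrow> f x = g x"
    using smooth_onD[OF sm a] by metis
  have "continuous (at a) g"
    using Cinf_on_continuous[OF N(3)] N(1,2) continuous_on_eq_continuous_at by blast
  then have "continuous (at a within A) g" by (rule continuous_at_imp_continuous_at_within)
  then have "(g \<longlongrightarrow> g a) (at a within A)" by (simp add: continuous_within)
  moreover have "\<forall>\<^sub>F x in at a within A. g x = f x"
    using N by (auto simp: eventually_at_topological)
  ultimately have "(f \<longlongrightarrow> g a) (at a within A)" by (rule Lim_transform_eventually)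
  then show "continuous (at a within A) f" using N(4)[of a] a N(2) by (simp add: continuous_within)
qed

text \<open>Smoothness up to the closed end t = 1 means a smooth extension beyond it; it is obtained
  by integrating the local extension of \<gamma>.\<close>

lemma smooth_antiderivative:
  assumes \<gamma>: "smooth_on {0<..1::real} \<gamma>"
  obtains c where "smooth_on {0<..1} c" "\<And>t. t \<in> {0<..1} \<Longrightarrow> (c has_real_derivative - \<gamma> t) (at t within {0<..1})"
proof -
  \<comment> \<open>Integration from t up to 1 stays away from 0, where \<gamma> may be unbounded,
    and gives the sign of -\<gamma>.\<close>
  define c where "c = (\<lambda>t. integral {t..1} \<gamma>)"
  have \<gamma>c: "continuous_on {0<..1} \<gamma>" by (rule smooth_on_continuous_on[OF \<gamma>])
  have D: "(c has_real_derivative - \<gamma> t) (at t within {0<..1})" if t: "t \<in> {0<..1}" for t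
  proof -
    have cc: "continuous_on {t/2..1} \<gamma>" by (rule continuous_on_subset[OF \<gamma>c]) (use t in auto)
    have "(c has_real_derivative - \<gamma> t) (at t within {t/2..1})"
      unfolding c_def by (rule integral_has_real_derivative'[OF cc]) (use t in auto)
    moreover have "at t within {t/2..1} = at t within {0<..1}"
      by (rule at_within_nhd[of _ "{t/2<..}"]) (use t in auto)
    ultimately show ?thesis by simp
  qed
  have "smooth_on {0<..1} c"
  proof (rule smooth_onI)
    fix a :: real assume a: "a \<in> {0<..1}"
    obtain N g where N: "open N" "a \<in> N" "Cinf_on N g" "\<And>x. x \<in> {0<..1} \<inter> N \<Longrightarrow> \<gamma> x = g x"
      using smooth_onD[OF \<gamma> a] by metis
    obtain e where e: "e > 0" "cball a e \<subseteq> N" using N(1,2) open_contains_cball by metis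
    define I where "I = {a - e<..<a + e}"
    have I: "open I" "a \<in> I" "I \<subseteq> {a - e..a + e}" "{a - e..a + e} \<subseteq> N"
      using e by (auto simp: I_def dist_real_def cball_def abs_le_iff intro!: subsetD[OF e(2)])
    have "continuous_on {a - e..a + e} g"
      by (rule continuous_on_subset[OF Cinf_on_continuous[OF N(3)] I(4)])
    then obtain G where G: "\<And>x. x \<in> {a - e..a + e} \<Longrightarrow> (G has_vector_derivative g x) (at x within {a - e..a + e})"
      using antiderivative_continuous by blast
    have GI: "(G has_real_derivative g x) (at x)" if "x \<in> I" for x
    proof -
      have "at x within {a - e..a + e} = at x" using that I(1,3)
        by (metis at_within_interior interior_maximal subsetD)
      then show ?thesis using G[of x] that I(3) by (auto simp: has_real_derivative_iff_has_vector_derivative)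
    qed
    have GD: "(G has_derivative (\<lambda>v. v * g x)) (at x)" if "x \<in> I" for x
      using GI[OF that] by (simp add: has_field_derivative_def mult_commute_abs)
    have gI: "Cinf_on I g" using Cinf_on_subset[OF N(3)] I by blast
    have CG: "Cinf_on I G" unfolding Cinf_on_def
    proof
      fix k
      have dG: "\<forall>x\<in>I. G differentiable (at x)" using GD differentiable_def by blast
      have "Ck_on k I (dd v G)" for k v
        by (rule Ck_on_cong[OF I(1), of "\<lambda>x. v * g x"])
          (use dd_unique[OF GD] Ck_on_mult[OF I(1) Ck_on_const[of k I v]] gI in \<open>auto simp: Cinf_on_def\<close>)
      with dG have "Ck_on (Suc k) I G" by (simp add: Ck_on_Suc_dd)
      then show "Ck_on k I G" by (rule Ck_on_SucD)
    qed
    \<comment> \<open>On the interval \<open>J\<close> both c and -G are antiderivatives of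
      -\<gamma>, so they differ by a constant there, and k - G is the smooth extension of c.\<close>
    define J where "J = I \<inter> {0<..1}"
    have J: "convex J" "a \<in> J" using a I(2) by (auto simp: J_def I_def intro!: convex_Int convex_real_interval)
    have "\<exists>k. \<forall>x\<in>J. c x + G x = k"
    proof (rule has_derivative_zero_constant[OF J(1)])
      fix x assume x: "x \<in> J"
      have "(c has_real_derivative - \<gamma> x) (at x within J)" "(G has_real_derivative g x) (at x within J)"
        using D[of x] GI[of x] x by (auto simp: J_def intro: DERIV_subset)
      from DERIV_add[OF this] have "((\<lambda>x. c x + G x) has_real_derivative 0) (at x within J)"
        using N(4)[of x] x I(3,4) by (auto simp: J_def)
      then show "((\<lambda>x. c x + G x) has_derivative (\<lambda>h. 0)) (at x within J)"
        by (simp add: has_field_derivative_def lambda_zero)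
    qed
    then obtain k where "\<And>x. x \<in> J \<Longrightarrow> c x + G x = k" by blast
    then have k: "c x = k - G x" if "x \<in> J" for x using that by (simp add: eq_diff_eq)
    show "\<exists>N g. open N \<and> a \<in> N \<and> Cinf_on N g \<and> (\<forall>x\<in>{0<..1} \<inter> N. c x = g x)"
      by (rule exI[of _ I], rule exI[of _ "\<lambda>x. k - G x"])
        (use I(1,2) k Cinf_on_diff[OF I(1) Cinf_on_const CG] in \<open>auto simp: J_def\<close>)
  qed
  then show ?thesis using that D by blast
qed

text \<open>The expression that is a function of time alone by the stochastic Newton equation.\<close>

definition bernoulli ::
  "real \<Rightarrow> (real ^ 'n::finite \<Rightarrow> real) \<Rightarrow> (real \<times> (real ^ 'n) \<Rightarrow> real) \<Rightarrow> (real \<times> (real ^ 'n) \<Rightarrow> real) \<Rightarrow> real \<times> (real ^ 'n) \<Rightarrow> real" where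
  "bernoulli \<sigma> U R S z = dt S z + (\<Sum>j\<in>UNIV. (1/2) * (dx j S z * dx j S z - dx j R z * dx j R z) - (\<sigma>\<^sup>2 / 2) * dx j (dx j R) z) + U (snd z)"

lemma Cinf_on_snd:
  assumes "Cinf_on UNIV U" "open N"
  shows "Cinf_on N (\<lambda>z. U (snd z))"
  using Cinf_on_affine[OF assms(2) bounded_linear_snd, of 0 UNIV U] assms(1) by simp

lemma Cinf_on_bernoulli:
  assumes "open N" "Cinf_on N R" "Cinf_on N S" "Cinf_on UNIV U"
  shows "Cinf_on N (bernoulli \<sigma> U R S)"
  unfolding bernoulli_def[abs_def]
  by (intro Cinf_on_add Cinf_on_sum Cinf_on_diff Cinf_on_mult Cinf_on_const Cinf_on_dd Cinf_on_snd assms)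

lemma dd_dd_cong:
  assumes "open N" "z \<in> N" "\<And>y. y \<in> N \<Longrightarrow> f y = g y"
  shows "dd u (dd v f) z = dd u (dd v g) z"
  by (rule dd_cong[OF assms(1,2)], rule dd_cong[OF assms(1) _ assms(3)])

lemma bernoulli_cong:
  assumes "open N" "z \<in> N" "\<And>y. y \<in> N \<Longrightarrow> R y = R' y" "\<And>y. y \<in> N \<Longrightarrow> S y = S' y"
  shows "bernoulli \<sigma> U R S z = bernoulli \<sigma> U R' S' z"
  unfolding bernoulli_def using dd_cong[OF assms(1-3)] dd_cong[OF assms(1,2,4)] dd_dd_cong[OF assms(1-3)] by simp

text \<open>In the Newton equation the derivative with respect to x_i is innermost. Schwarz's
  theorem brings it to the outside, so that the equation reads as the vanishing of the i-th
  derivative of \<open>bernoulli\<close>.\<close>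

lemma bernoulli_space_independent:
  fixes R S :: "real \<times> (real ^ 'n) \<Rightarrow> real"
  assumes R: "Cinf_on spacetime R" and S: "Cinf_on spacetime S" and U: "Cinf_on UNIV U"
    and newton: "\<And>i t x. t \<in> {0<..<1} \<Longrightarrow> dt (dx i S) (t, x) + (\<Sum>j\<in>UNIV. dx j S (t, x) * dx j (dx i S) (t, x) - dx j R (t, x) * dx j (dx i R) (t, x)
      - \<sigma>\<^sup>2 / 2 * dx j (dx j (dx i R)) (t, x)) = - pdx i U x"
    and t: "t \<in> {0<..<1}"
  shows "bernoulli \<sigma> U R S (t, x) = bernoulli \<sigma> U R S (t, 0)"
proof -
  note o = open_spacetime
  have diff: "H differentiable (at y)" if "Cinf_on spacetime H" "y \<in> spacetime" for H :: "real \<times> (real ^ 'n) \<Rightarrow> real" and y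
    by (rule Cinf_on_differentiable[OF that])
  have sym: "dd u (dd v H) y = dd v (dd u H) y" if "Cinf_on spacetime H" "y \<in> spacetime" for H :: "real \<times> (real ^ 'n) \<Rightarrow> real" and u v y
    using that by (intro dd_dd_symmetric[OF o]) (auto simp: Cinf_on_def)
  have zero: "dx i (bernoulli \<sigma> U R S) (t, x) = 0" for i x
  proof -
    let ?T = "\<lambda>j z. (1/2) * (dx j S z * dx j S z - dx j R z * dx j R z) - (\<sigma>\<^sup>2 / 2) * dx j (dx j R) z"
    have z: "(t, x) \<in> spacetime" using t by auto
    note S1 = Cinf_on_dd[OF S] and R1 = Cinf_on_dd[OF R] and R2 = Cinf_on_dd[OF Cinf_on_dd[OF R]]
    note SS = Cinf_on_mult[OF o S1 S1] and RR = Cinf_on_mult[OF o R1 R1]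
    note Q = Cinf_on_diff[OF o SS RR]
    note Q' = Cinf_on_mult[OF o Cinf_on_const Q] and R2' = Cinf_on_mult[OF o Cinf_on_const R2]
    have T: "Cinf_on spacetime (?T j)" for j
      by (intro Cinf_on_diff Cinf_on_mult Cinf_on_const Cinf_on_dd R S o)
    have Tj: "dx i (?T j) (t, x) = dx j S (t, x) * dx j (dx i S) (t, x) - dx j R (t, x) * dx j (dx i R) (t, x)
        - \<sigma>\<^sup>2 / 2 * dx j (dx j (dx i R)) (t, x)" for j
    proof -
      have "dx i (?T j) (t, x) = (1/2) * (2 * (dx j S (t, x) * dx i (dx j S) (t, x)) - 2 * (dx j R (t, x) * dx i (dx j R) (t, x)))
          - (\<sigma>\<^sup>2 / 2) * dx i (dx j (dx j R)) (t, x)"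
        unfolding dd_diff[OF diff[OF Q' z] diff[OF R2' z]] dd_cmult[OF diff[OF Q z]] dd_cmult[OF diff[OF R2 z]]
          dd_diff[OF diff[OF SS z] diff[OF RR z]] dd_mult[OF diff[OF S1 z] diff[OF S1 z]] dd_mult[OF diff[OF R1 z] diff[OF R1 z]]
        by (simp add: mult.commute)
      moreover have "dx i (dx j (dx j R)) (t, x) = dx j (dx j (dx i R)) (t, x)"
      proof -
        have "dx i (dx j (dx j R)) (t, x) = dx j (dx i (dx j R)) (t, x)" by (rule sym[OF R1 z])
        also have "\<dots> = dx j (dx j (dx i R)) (t, x)" by (rule dd_cong[OF o z]) (rule sym[OF R])
        finally show ?thesis .
      qed
      ultimately show ?thesis using sym[OF S z, of "(0, axis i 1)" "(0, axis j 1)"] sym[OF R z, of "(0, axis i 1)" "(0, axis j 1)"]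
        by (simp add: algebra_simps)
    qed
    have Tsum: "dx i (\<lambda>z. \<Sum>j\<in>UNIV. ?T j z) (t, x) = (\<Sum>j\<in>UNIV. dx i (?T j) (t, x))"
      using dd_lincomb[of UNIV ?T "(t, x)" "(0, axis i 1)" "\<lambda>_. 1"] diff[OF T z] by simp
    have Us: "Cinf_on spacetime (\<lambda>z. U (snd z))" by (rule Cinf_on_snd[OF U o])
    have Ud: "dx i (\<lambda>z. U (snd z)) (t, x) = pdx i U x"
      using dd_slice[OF diff[OF Us z], of "axis i 1"] by simp
    have TS: "Cinf_on spacetime (\<lambda>z. \<Sum>j\<in>UNIV. ?T j z)" by (rule Cinf_on_sum[OF o T])
    have "dx i (bernoulli \<sigma> U R S) (t, x) = dx i (dt S) (t, x) + (\<Sum>j\<in>UNIV. dx i (?T j) (t, x)) + pdx i U x"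
      unfolding bernoulli_def[abs_def] dd_add[OF diff[OF Cinf_on_add[OF o Cinf_on_dd[OF S] TS] z] diff[OF Us z]]
        dd_add[OF diff[OF Cinf_on_dd[OF S] z] diff[OF TS z]] Tsum Ud ..
    also have "dx i (dt S) (t, x) = dt (dx i S) (t, x)" by (rule sym[OF S z])
    finally show ?thesis unfolding Tj using newton[OF t, of i x] by linarith
  qed
  let ?q = "\<lambda>x. bernoulli \<sigma> U R S (t, x)"
  have H: "Cinf_on spacetime (bernoulli \<sigma> U R S)" by (rule Cinf_on_bernoulli[OF o R S U])
  have "(?q has_derivative (\<lambda>v. 0)) (at y)" for y
  proof -
    have d: "?q differentiable (at y)" by (rule Cinf_on_differentiable[OF Cinf_on_slice_UNIV[OF H t]]) simp
    have "dd v ?q y = 0" for v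
      unfolding dd_sum_axis[OF d] pdx_slice[OF H t] zero by simp
    then show ?thesis using has_derivative_dd[OF d] by simp
  qed
  then have "\<exists>k. \<forall>y\<in>UNIV. ?q y = k"
    by (intro has_derivative_zero_constant) auto
  then obtain k where "\<And>y. ?q y = k" by blast
  then show ?thesis by simp
qed

section \<open>Derivatives of the wave function and extension to the end point\<close>

abbreviation cpx :: "real \<Rightarrow> real \<Rightarrow> complex" where
  "cpx a b \<equiv> of_real a + \<i> * of_real b"

lemma wave_has_vector_derivative:
  assumes "(r has_real_derivative r') (at s within T)" "(q has_real_derivative q') (at s within T)"
  shows "((\<lambda>s. exp ((cpx (r s) (q s)) / of_real K)) has_vector_derivative
     exp ((cpx (r s) (q s)) / of_real K) * ((cpx r' q') / of_real K)) (at s within T)"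
proof -
  have "((\<lambda>s. (cpx (r s) (q s)) / complex_of_real K) has_vector_derivative
      (cpx r' q') / of_real K) (at s within T)"
    by (intro has_vector_derivative_divide has_vector_derivative_add has_vector_derivative_mult_right has_vector_derivative_of_real assms)
  from field_vector_diff_chain_within[OF this has_field_derivative_at_within[OF DERIV_exp]]
  show ?thesis by (simp add: o_def mult.commute)
qed

lemma has_vector_derivative_eventually:
  assumes "(f has_vector_derivative D) (at s within T)" "open N" "s \<in> N" "s \<in> T" "\<And>u. u \<in> N \<inter> T \<Longrightarrow> f u = g u"
  shows "(g has_vector_derivative D) (at s within T)"
proof -
  obtain e where "e > 0" "ball s e \<subseteq> N" using assms(2,3) openE by blast
  then show ?thesis
    using has_derivative_transform_within[of f _ s T e g] assms(1,4,5)
    unfolding has_vector_derivative_def by (auto simp: dist_commute mem_ball subset_iff)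
qed

text \<open>After division by \<psi> the imaginary part is the continuity equation and the real part
  the Bernoulli identity. Subtracting \<gamma> from the time derivative of S is the effect of adding
  c to S.\<close>

lemma schrodinger_algebra:
  fixes u v u2 v2 :: "'n::finite \<Rightarrow> real"
  assumes K: "K \<noteq> 0" and cont: "rt + (\<Sum>i\<in>UNIV. u i * v i + K / 2 * v2 i) = 0"
    and bern: "\<gamma> = st + (\<Sum>i\<in>UNIV. (1/2) * (v i * v i - u i * u i) - (K / 2) * u2 i) + U"
  shows "\<i> * of_real K * (\<psi> * ((cpx rt (st - \<gamma>)) / of_real K))
      + of_real (K ^ 2 / 2) * (\<Sum>i\<in>UNIV. \<psi> * ((cpx (u i) (v i)) / of_real K) * ((cpx (u i) (v i)) / of_real K)
        + \<psi> * ((cpx (u2 i) (v2 i)) / of_real K)) = of_real U * \<psi>"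
proof -
  have K': "complex_of_real K \<noteq> 0" using K by simp
  have 1: "\<i> * of_real K * (\<psi> * ((cpx rt (st - \<gamma>)) / of_real K)) = \<psi> * (\<i> * of_real rt - of_real (st - \<gamma>))"
    using K' by (simp add: field_simps)
  have 2: "of_real (K ^ 2 / 2) * (\<psi> * ((cpx (u i) (v i)) / of_real K) * ((cpx (u i) (v i)) / of_real K)
        + \<psi> * ((cpx (u2 i) (v2 i)) / of_real K))
     = \<psi> * (cpx ((1/2) * (u i * u i - v i * v i) + K / 2 * u2 i) (u i * v i + K / 2 * v2 i))" for i
    using K' by (simp add: field_simps power2_eq_square)
  have sR: "(\<Sum>i\<in>UNIV. (1/2) * (u i * u i - v i * v i) + K / 2 * u2 i) = - (\<Sum>i\<in>UNIV. (1/2) * (v i * v i - u i * u i) - (K / 2) * u2 i)"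
    by (simp add: sum_negf[symmetric] algebra_simps)
  have "of_real (K ^ 2 / 2) * (\<Sum>i\<in>UNIV. \<psi> * ((cpx (u i) (v i)) / of_real K) * ((cpx (u i) (v i)) / of_real K)
        + \<psi> * ((cpx (u2 i) (v2 i)) / of_real K))
     = \<psi> * (cpx (\<Sum>i\<in>UNIV. (1/2) * (u i * u i - v i * v i) + K / 2 * u2 i) (\<Sum>i\<in>UNIV. u i * v i + K / 2 * v2 i))"
    unfolding sum_distrib_left 2 of_real_sum sum.distrib[symmetric] ..
  also have "(\<Sum>i\<in>UNIV. (1/2) * (u i * u i - v i * v i) + K / 2 * u2 i) = st - \<gamma> + U" unfolding sR bern by simp
  also have "(\<Sum>i\<in>UNIV. u i * v i + K / 2 * v2 i) = - rt" using cont by simp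
  finally show ?thesis unfolding 1 by (simp add: algebra_simps)
qed

text \<open>An iterated \<open>pderiv_at\<close> depends on the first derivative near x and not only
  at x, hence the hypotheses on an open neighbourhood.\<close>

lemma wave_laplacian:
  fixes r q :: "real ^ 'n::finite \<Rightarrow> real" and f :: "real ^ 'n \<Rightarrow> complex"
  assumes N: "open N" "x \<in> N" and r: "Cinf_on N r" and q: "Cinf_on N q"
    and f: "\<And>y. y \<in> N \<Longrightarrow> f y = exp ((cpx (r y) (q y)) / of_real K)"
  shows "laplacian f x = (\<Sum>i\<in>UNIV. f x * ((cpx (pdx i r x) (pdx i q x)) / of_real K) * ((cpx (pdx i r x) (pdx i q x)) / of_real K)
      + f x * ((cpx (pdx i (pdx i r) x) (pdx i (pdx i q) x)) / of_real K))"
  unfolding laplacian_def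
proof (rule sum.cong[OF refl])
  fix i :: 'n
  let ?e = "axis i 1 :: real ^ 'n"
  let ?w = "\<lambda>y. (cpx (pdx i r y) (pdx i q y)) / complex_of_real K"
  define E where "E = (\<lambda>y. exp ((cpx (r y) (q y)) / complex_of_real K))"
  have line: "((\<lambda>s. g (y + s *\<^sub>R ?e)) has_real_derivative pdx i g y) (at 0)" if "Cinf_on N g" "y \<in> N" for g y
    using DERIV_along_line[of g y 0 ?e] Cinf_on_differentiable[OF that] by simp
  have nbhd: "open ((\<lambda>s. y + s *\<^sub>R ?e) -` N)" for y
    by (intro open_vimage N(1) continuous_intros)
  have E1: "((\<lambda>s. E (y + s *\<^sub>R ?e)) has_vector_derivative E y * ?w y) (at 0)" if "y \<in> N" for y
    using wave_has_vector_derivative[OF line[OF r that] line[OF q that], of K] by (simp add: E_def)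
  have first: "pderiv_at i f y = E y * ?w y" if y: "y \<in> N" for y
    unfolding pderiv_at_def
  proof (rule vector_derivative_at)
    show "((\<lambda>s. f (y + s *\<^sub>R ?e)) has_vector_derivative E y * ?w y) (at 0)"
      by (rule has_vector_derivative_eventually[OF E1[OF y] nbhd[of y]]) (use y f in \<open>auto simp: E_def\<close>)
  qed
  have "((\<lambda>s. ?w (x + s *\<^sub>R ?e)) has_vector_derivative (cpx (pdx i (pdx i r) x) (pdx i (pdx i q) x)) / of_real K) (at 0)"
    by (intro has_vector_derivative_divide has_vector_derivative_add has_vector_derivative_mult_right has_vector_derivative_of_real
        line Cinf_on_dd r q N)
  from has_vector_derivative_mult[OF E1[OF N(2)] this]
  have "((\<lambda>s. E (x + s *\<^sub>R ?e) * ?w (x + s *\<^sub>R ?e)) has_vector_derivative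
     E x * ((cpx (pdx i (pdx i r) x) (pdx i (pdx i q) x)) / of_real K) + E x * ?w x * ?w x) (at 0)"
    by simp
  then have "((\<lambda>s. pderiv_at i f (x + s *\<^sub>R ?e)) has_vector_derivative
     E x * ((cpx (pdx i (pdx i r) x) (pdx i (pdx i q) x)) / of_real K) + E x * ?w x * ?w x) (at 0)"
    by (rule has_vector_derivative_eventually[OF _ nbhd[of x]]) (use N(2) first in auto)
  then have "pderiv_at i (pderiv_at i f) x = E x * ((cpx (pdx i (pdx i r) x) (pdx i (pdx i q) x)) / of_real K) + E x * ?w x * ?w x"
    unfolding pderiv_at_def[of i "pderiv_at i f"] by (rule vector_derivative_at)
  moreover have "f x = E x" using f[OF N(2)] by (simp add: E_def)
  ultimately show "pderiv_at i (pderiv_at i f) x = f x * ?w x * ?w x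
      + f x * ((cpx (pdx i (pdx i r) x) (pdx i (pdx i q) x)) / of_real K)"
    by (simp add: add.commute)
qed

text \<open>Carries equations from 0 < t < 1 to t = 1 along a sequence increasing to 1 inside
  \<open>N\<close>; for t < 1 there is nothing to pass to the limit.\<close>

lemma closure_limit_eq:
  fixes f g :: "real \<Rightarrow> real"
  assumes t: "t \<in> {0<..1}" and N: "open N" "t \<in> N"
    and f: "continuous_on ({0<..1} \<inter> N) f" and g: "continuous_on ({0<..1} \<inter> N) g"
    and eq: "\<And>s. s \<in> N \<Longrightarrow> s \<in> {0<..<1} \<Longrightarrow> f s = g s"
  shows "f t = g t"
proof (cases "t < 1")
  case True
  then show ?thesis using eq t N by auto
next
  case False
  then have t1: "t = 1" using t by simp
  obtain e where e: "e > 0" "ball 1 e \<subseteq> N" using N t1 openE by blast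
  define \<delta> where "\<delta> = min e 1 / 2"
  have \<delta>: "0 < \<delta>" "\<delta> < e" "\<delta> < 1" using e by (auto simp: \<delta>_def min_def)
  define s where "s = (\<lambda>n::nat. 1 - \<delta> / real (Suc n))"
  note h = harmonic_null_sequence[OF \<delta>(1)]
  have sN: "s n \<in> N" "s n \<in> {0<..<1}" for n
    using h(1)[of n] h(3)[of n] \<delta> unfolding s_def
    by (auto simp: dist_real_def simp del: of_nat_Suc intro!: subsetD[OF e(2)])
  have lim: "s \<longlonglongrightarrow> t" unfolding s_def t1 using tendsto_diff[OF tendsto_const[of 1] h(2)] by simp
  have mem: "t \<in> {0<..1} \<inter> N" "\<forall>\<^sub>F n in sequentially. s n \<in> {0<..1} \<inter> N" using t N sN by (auto intro!: always_eventually less_imp_le)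
  have "(\<lambda>n. f (s n)) \<longlonglongrightarrow> f t" "(\<lambda>n. g (s n)) \<longlonglongrightarrow> g t"
    by (rule continuous_on_tendsto_compose[OF f lim mem], rule continuous_on_tendsto_compose[OF g lim mem])
  then show ?thesis using eq[OF sN] LIMSEQ_unique by auto
qed

theorem corollary9p1:
  fixes M :: "'w measure"
    and P F :: "real \<Rightarrow> 'w measure"
    and X :: "real \<Rightarrow> 'w \<Rightarrow> real ^ 'n::finite"
    and b :: "real \<Rightarrow> real ^ 'n \<Rightarrow> real ^ 'n"
    and p R S :: "real \<Rightarrow> real ^ 'n \<Rightarrow> real"
    and U :: "real ^ 'n \<Rightarrow> real"
    and \<sigma> K :: real
  assumes "smooth_on UNIV U"
    and "good_gradient_diffusion M P F \<sigma> b p X"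
    and "has_second_stoch_deriv M P F X (\<lambda>t w. Complex_vec (- grad U (X t w)) 0)"
    and "wave_potentials M P F \<sigma> p X R S"
    and "K > 0" and "K = \<sigma>\<^sup>2"
  shows "(\<exists>c. smooth_on {0<..1} c \<and>
              wave_potentials M P F \<sigma> p X R (\<lambda>t x. S t x + c t) \<and>
              (\<forall>(t, x)\<in>Theta p.
                 schrodinger_at \<sigma> U (wave_function K R (\<lambda>t x. S t x + c t)) t x)) \<and>
         (\<forall>(t, x)\<in>Theta p.
            wave_function K R S t x * cnj (wave_function K R S t x) = of_real (p t x))"
proof -
  define Rf Sf where "Rf = (\<lambda>z. R (fst z) (snd z))" and "Sf = (\<lambda>z. S (fst z) (snd z))"
  have K: "K \<noteq> 0" "\<sigma> \<noteq> 0" using assms(5,6) by auto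
  have gd: "good_diffusion M P F \<sigma> b p X" using assms(2) by (simp add: good_gradient_diffusion_def)
  note pde = stochastic_newton_imp_pde[OF assms(1) gd assms(3,4) K(2), folded Rf_def Sf_def]
  have Theta: "Theta p = {0<..1} \<times> UNIV" using less_imp_neq[OF pde(1)] by (force simp: Theta_def)
  have sm: "smooth_on ({0<..1} \<times> UNIV) Rf" "smooth_on ({0<..1} \<times> UNIV) Sf"
    using assms(4) unfolding wave_potentials_def Theta Rf_def Sf_def by (simp_all add: case_prod_beta')
  have "spacetime \<subseteq> {0<..1} \<times> (UNIV :: (real ^ 'n) set)" by auto
  note sub = smooth_on_subset[OF _ this]
  have R: "Cinf_on spacetime Rf" and S: "Cinf_on spacetime Sf"
    by (rule smooth_on_open_imp_Cinf_on[OF open_spacetime sub], rule sm)+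
  have U: "Cinf_on UNIV U" by (rule smooth_on_open_imp_Cinf_on[OF open_UNIV assms(1)])
  have Rln: "R t x = \<sigma>\<^sup>2 / 2 * ln (p t x)" if "t \<in> {0<..1}" for t x
    using assms(4) that unfolding wave_potentials_def Theta by auto
  \<comment> \<open>One neighbourhood on which both potentials have smooth extensions. All
    derivatives at t = 1 are taken of \<open>Rh\<close> and \<open>Sh\<close>, since two-sided
    derivatives of R and S would involve values after time 1.\<close>
  have local: "\<exists>N Rh Sh. open N \<and> (t, x) \<in> N \<and> Cinf_on N Rh \<and> Cinf_on N Sh \<and>
      (\<forall>z\<in>({0<..1} \<times> UNIV) \<inter> N. Rf z = Rh z \<and> Sf z = Sh z)" if "t \<in> {0<..1}" for t x
  proof -
    have z: "(t, x) \<in> {0<..1} \<times> UNIV" using that by auto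
    obtain N1 Rh where 1: "open N1" "(t, x) \<in> N1" "Cinf_on N1 Rh" "\<And>z. z \<in> ({0<..1} \<times> UNIV) \<inter> N1 \<Longrightarrow> Rf z = Rh z"
      using smooth_onD[OF sm(1) z] by metis
    obtain N2 Sh where 2: "open N2" "(t, x) \<in> N2" "Cinf_on N2 Sh" "\<And>z. z \<in> ({0<..1} \<times> UNIV) \<inter> N2 \<Longrightarrow> Sf z = Sh z"
      using smooth_onD[OF sm(2) z] by metis
    show ?thesis
      by (rule exI[of _ "N1 \<inter> N2"], rule exI[of _ Rh], rule exI[of _ Sh])
        (use 1 2 in \<open>auto intro: Cinf_on_subset\<close>)
  qed
  have interior: "open (N \<inter> spacetime)" "\<And>z. z \<in> N \<inter> spacetime \<Longrightarrow> Rf z = Rh z" "\<And>z. z \<in> N \<inter> spacetime \<Longrightarrow> Sf z = Sh z"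
    if "open N" "\<forall>z\<in>({0<..1} \<times> UNIV) \<inter> N. Rf z = Rh z \<and> Sf z = Sh z" for N Rh Sh
    using that open_spacetime by auto
  let ?H = "bernoulli \<sigma> U Rf Sf"
  have H0: "?H (t, x) = ?H (t, 0)" if "t \<in> {0<..<1}" for t x
    by (rule bernoulli_space_independent[OF R S U pde(3) that])
  have "(1 :: real) \<in> {0<..1}" by simp
  from local[OF this, of 0] obtain N1 R1 S1 where N1: "open N1" "(1, 0) \<in> N1" "Cinf_on N1 R1" "Cinf_on N1 S1"
    "\<forall>z\<in>({0<..1} \<times> UNIV) \<inter> N1. Rf z = R1 z \<and> Sf z = S1 z" by blast
  let ?H1 = "bernoulli \<sigma> U R1 S1"
  \<comment> \<open>At t = 1 the expression \<open>?H\<close> would depend on uncontrolled values of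
    R and S beyond the interval, so the value comes from the smooth extension near (1, 0).\<close>
  define \<gamma> where "\<gamma> = (\<lambda>t. if t < 1 then ?H (t, 0) else ?H1 (1, 0))"
  have \<gamma>: "smooth_on {0<..1} \<gamma>"
  proof (rule smooth_onI)
    fix a :: real assume a: "a \<in> {0<..1}"
    have bl: "bounded_linear (\<lambda>t::real. (t, 0 :: real ^ 'n))"
      by (intro bounded_linear_Pair bounded_linear_ident bounded_linear_zero)
    have time_slice: "Cinf_on T (\<lambda>t. G (t, 0))" if "open T" "\<And>t. t \<in> T \<Longrightarrow> (t, 0) \<in> N" "Cinf_on N G" for T N and G :: "real \<times> (real ^ 'n) \<Rightarrow> real"
      using Cinf_on_affine[OF that(1) bl, of 0 N G] that by simp
    show "\<exists>N g. open N \<and> a \<in> N \<and> Cinf_on N g \<and> (\<forall>x\<in>{0<..1} \<inter> N. \<gamma> x = g x)"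
    proof (cases "a < 1")
      case True
      have "Cinf_on {0<..<1} (\<lambda>t. ?H (t, 0))"
        by (rule time_slice[OF _ _ Cinf_on_bernoulli[OF open_spacetime R S U]]) auto
      then show ?thesis
        by (intro exI[of _ "{0<..<1}"] exI[of _ "\<lambda>t. ?H (t, 0)"]) (use True a in \<open>auto simp: \<gamma>_def\<close>)
    next
      case False
      then have a1: "a = 1" using a by simp
      define T where "T = (\<lambda>t::real. (t, 0 :: real ^ 'n)) -` N1"
      have T: "open T" unfolding T_def by (intro open_vimage N1 continuous_intros)
      have C: "Cinf_on T (\<lambda>t. ?H1 (t, 0))"
        by (rule time_slice[OF T _ Cinf_on_bernoulli[OF N1(1,3,4) U]]) (simp add: T_def)
      have "\<gamma> t = ?H1 (t, 0)" if "t \<in> {0<..1} \<inter> T" for t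
      \<comment> \<open>For t < 1 the extension and the original functions agree on an open set,
        hence so do their derivatives.\<close>
      proof (cases "t < 1")
        case True
        then show ?thesis unfolding \<gamma>_def
          using that bernoulli_cong[OF interior(1)[OF N1(1,5)] _ interior(2)[OF N1(1,5)] interior(3)[OF N1(1,5)]]
          by (auto simp: T_def)
      next
        case False
        then have "t = 1" using that by auto
        then show ?thesis by (simp add: \<gamma>_def)
      qed
      then show ?thesis
        by (intro exI[of _ T] exI[of _ "\<lambda>t. ?H1 (t, 0)"]) (use T C N1(2) a1 in \<open>auto simp: T_def\<close>)
    qed
  qed
  obtain c where c: "smooth_on {0<..1} c" "\<And>t. t \<in> {0<..1} \<Longrightarrow> (c has_real_derivative - \<gamma> t) (at t within {0<..1})"
    using smooth_antiderivative[OF \<gamma>] by blast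
  have wp: "wave_potentials M P F \<sigma> p X R (\<lambda>t x. S t x + c t)"
  proof -
    have "smooth_on ({0<..1} \<times> UNIV) (\<lambda>z. Sf z + c (fst z))"
    proof (rule smooth_onI)
      fix a :: "real \<times> (real ^ 'n)" assume a: "a \<in> {0<..1} \<times> UNIV"
      obtain N g where N: "open N" "a \<in> N" "Cinf_on N g" "\<And>z. z \<in> ({0<..1} \<times> UNIV) \<inter> N \<Longrightarrow> Sf z = g z"
        using smooth_onD[OF sm(2) a] by metis
      have "fst a \<in> {0<..1}" using a by auto
      then obtain T k where T: "open T" "fst a \<in> T" "Cinf_on T k" "\<And>t. t \<in> {0<..1} \<inter> T \<Longrightarrow> c t = k t"
        using smooth_onD[OF c(1)] by metis
      define N' where "N' = N \<inter> (fst -` T)"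
      have N': "open N'" unfolding N'_def by (intro open_Int N open_vimage T continuous_intros)
      have "Cinf_on N' (\<lambda>z. k (fst z))"
        using Cinf_on_affine[OF N' bounded_linear_fst, of 0 T k] T(3) by (auto simp: N'_def)
      moreover have "Cinf_on N' g" using Cinf_on_subset[OF N(3)] by (auto simp: N'_def)
      ultimately have "Cinf_on N' (\<lambda>z. g z + k (fst z))" using Cinf_on_add[OF N'] by blast
      then show "\<exists>N g. open N \<and> a \<in> N \<and> Cinf_on N g \<and> (\<forall>z\<in>({0<..1} \<times> UNIV) \<inter> N. Sf z + c (fst z) = g z)"
        by (intro exI[of _ N'] exI[of _ "\<lambda>z. g z + k (fst z)"]) (use N' N T in \<open>auto simp: N'_def\<close>)
    qed
    moreover have "grad (\<lambda>x. S t x + c t) x = grad (S t) x" for t x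
    proof -
      \<comment> \<open>An equivalence for every D, so the two gradients are equal even at points
        where no derivative exists.\<close>
      have "((\<lambda>s. S t (x + s *\<^sub>R axis i 1) + c t) has_vector_derivative D) (at 0) \<longleftrightarrow> ((\<lambda>s. S t (x + s *\<^sub>R axis i 1)) has_vector_derivative D) (at 0)" for i D
        using has_vector_derivative_add_const[of "\<lambda>s. S t (x + s *\<^sub>R axis i 1)" "c t"] by simp
      then show ?thesis by (simp add: grad_def pderiv_at_def vector_derivative_def)
    qed
    ultimately show ?thesis
      using assms(4) unfolding wave_potentials_def Theta by (simp add: case_prod_beta' Sf_def)
  qed
  have schr: "schrodinger_at \<sigma> U (wave_function K R (\<lambda>t x. S t x + c t)) t x" if t: "t \<in> {0<..1}" for t x
  proof -
    obtain N Rh Sh where N: "open N" "(t, x) \<in> N" "Cinf_on N Rh" "Cinf_on N Sh"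
      "\<forall>z\<in>({0<..1} \<times> UNIV) \<inter> N. Rf z = Rh z \<and> Sf z = Sh z"
      using local[OF t, of x] by blast
    have eqR: "R s y = Rh (s, y)" and eqS: "S s y = Sh (s, y)" if "(s, y) \<in> N" "s \<in> {0<..1}" for s y
      using bspec[OF N(5), of "(s, y)"] that by (auto simp: Rf_def Sf_def)
    note int = interior[OF N(1,5)]
    define T where "T = (\<lambda>s::real. (s, x)) -` N"
    define Y where "Y = (\<lambda>y. (t, y)) -` N"
    have T: "open T" "t \<in> T" and Y: "open Y" "x \<in> Y" unfolding T_def Y_def using N(2)
      by (auto intro!: open_vimage N(1) continuous_intros)
    have ct: "continuous_on ({0<..1} \<inter> T) (\<lambda>s. G (s, x))" if "Cinf_on N G" for G :: "real \<times> (real ^ 'n) \<Rightarrow> real"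
      by (rule continuous_on_compose2[OF Cinf_on_continuous[OF that]]) (auto simp: T_def intro!: continuous_intros)
    let ?Hh = "bernoulli \<sigma> U Rh Sh"
    \<comment> \<open>Extensions chosen at different points need not agree beyond t = 1, but their
      derivatives at t = 1 are limits from the left and therefore fit the single function
      \<gamma>.\<close>
    have bern: "?Hh (t, x) = \<gamma> t"
    proof (rule closure_limit_eq[OF t T, of "\<lambda>s. ?Hh (s, x)" \<gamma>])
      show "continuous_on ({0<..1} \<inter> T) (\<lambda>s. ?Hh (s, x))" by (rule ct[OF Cinf_on_bernoulli[OF N(1,3,4) U]])
      show "continuous_on ({0<..1} \<inter> T) \<gamma>" by (rule continuous_on_subset[OF smooth_on_continuous_on[OF \<gamma>]]) auto
      fix s assume s: "s \<in> T" "s \<in> {0<..<1}"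
      have "?Hh (s, x) = ?H (s, x)"
        by (rule bernoulli_cong[OF int(1), symmetric]) (use s int in \<open>auto simp: T_def\<close>)
      also have "\<dots> = \<gamma> s" using H0[OF s(2)] s(2) by (simp add: \<gamma>_def)
      finally show "?Hh (s, x) = \<gamma> s" .
    qed
    let ?C = "\<lambda>z. dt Rh z + (\<Sum>i\<in>UNIV. dx i Rh z * dx i Sh z + \<sigma>\<^sup>2 / 2 * dx i (dx i Sh) z)"
    have cont: "?C (t, x) = 0"
    proof (rule closure_limit_eq[OF t T, of "\<lambda>s. ?C (s, x)" "\<lambda>_. 0"])
      have "Cinf_on N ?C"
        by (intro Cinf_on_add Cinf_on_sum Cinf_on_mult Cinf_on_const Cinf_on_dd N(1,3,4))
      from ct[OF this] show "continuous_on ({0<..1} \<inter> T) (\<lambda>s. ?C (s, x))" .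
      fix s assume s: "s \<in> T" "s \<in> {0<..<1}"
      have z: "(s, x) \<in> N \<inter> spacetime" "(s, x) \<in> spacetime" using s by (auto simp: T_def)
      show "?C (s, x) = 0"
        using pde(2)[OF z(2)] dd_cong[OF int(1) z(1) int(2)] dd_cong[OF int(1) z(1) int(3)] dd_dd_cong[OF int(1) z(1) int(3)] by simp
    qed simp
    let ?\<Psi> = "wave_function K R (\<lambda>t x. S t x + c t)"
    have dRh: "Rh differentiable (at (t, x))" and dSh: "Sh differentiable (at (t, x))"
      using Cinf_on_differentiable[OF N(3,2)] Cinf_on_differentiable[OF N(4,2)] .
    let ?E = "\<lambda>s y. exp ((cpx (Rh (s, y)) (Sh (s, y) + c s)) / complex_of_real K)"
    have \<Psi>: "?\<Psi> s y = ?E s y" if "(s, y) \<in> N" "s \<in> {0<..1}" for s y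
      using eqR[OF that] eqS[OF that] by (simp add: wave_function_def)
    have "((\<lambda>s. Rh (s, x)) has_real_derivative dt Rh (t, x)) (at t within {0<..1})"
      "((\<lambda>s. Sh (s, x) + c s) has_real_derivative dt Sh (t, x) + - \<gamma> t) (at t within {0<..1})"
      by (intro DERIV_add has_field_derivative_at_within[OF DERIV_time] dRh dSh c(2)[OF t])+
    from wave_has_vector_derivative[OF this, of K]
    have "((\<lambda>s. ?E s x) has_vector_derivative ?E t x * ((cpx (dt Rh (t, x)) (dt Sh (t, x) + - \<gamma> t)) / of_real K)) (at t within {0<..1})" .
    then have "((\<lambda>s. ?\<Psi> s x) has_vector_derivative ?E t x * ((cpx (dt Rh (t, x)) (dt Sh (t, x) + - \<gamma> t)) / of_real K)) (at t within {0<..1})"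
      by (rule has_vector_derivative_eventually[OF _ T t]) (use \<Psi> in \<open>auto simp: T_def\<close>)
    \<comment> \<open>A one-sided derivative is unique only at a limit point of the interval; this
      lets \<open>vector_derivative\<close> be evaluated also at t = 1.\<close>
    moreover have "at t within {0<..1} \<noteq> bot"
    proof -
      have "at t within {0<..1} = at t within {t/2..1}"
        by (rule at_within_nhd[of _ "{t/2<..}"]) (use t in auto)
      then show ?thesis using t by (simp add: trivial_limit_within islimpt_Icc)
    qed
    ultimately have time: "vector_derivative (\<lambda>s. ?\<Psi> s x) (at t within {0<..1}) = ?\<Psi> t x * ((cpx (dt Rh (t, x)) (dt Sh (t, x) - \<gamma> t)) / of_real K)"
      using vector_derivative_within[of t "{0<..1}" "\<lambda>s. ?\<Psi> s x"] \<Psi>[OF N(2) t] by simp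
    have CR: "Cinf_on Y (\<lambda>y. Rh (t, y))" and CS: "Cinf_on Y (\<lambda>y. Sh (t, y) + c t)"
      by (rule Cinf_on_slice[OF N(1,3)] Cinf_on_add[OF Y(1) Cinf_on_slice[OF N(1,4)] Cinf_on_const]; use Y in \<open>auto simp: Y_def\<close>)+
    have CS0: "Cinf_on Y (\<lambda>y. Sh (t, y))"
      by (rule Cinf_on_slice[OF N(1,4)]; use Y in \<open>auto simp: Y_def\<close>)
    have pR: "pdx i (\<lambda>y. Rh (t, y)) y = dx i Rh (t, y)" if "y \<in> Y" for i y
      by (rule dd_slice[OF Cinf_on_differentiable[OF N(3)]]) (use that in \<open>simp add: Y_def\<close>)
    have pS: "pdx i (\<lambda>y. Sh (t, y) + c t) y = dx i Sh (t, y)" if "y \<in> Y" for i y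
    proof -
      have "pdx i (\<lambda>y. Sh (t, y) + c t) y = pdx i (\<lambda>y. Sh (t, y)) y"
        using dd_unique[OF has_derivative_add[OF Cinf_on_has_derivative[OF CS0 that] has_derivative_const[of "c t"]], of "axis i 1"] by simp
      also have "\<dots> = dx i Sh (t, y)"
        by (rule dd_slice[OF Cinf_on_differentiable[OF N(4)]]) (use that in \<open>simp add: Y_def\<close>)
      finally show ?thesis .
    qed
    have pR2: "pdx i (pdx i (\<lambda>y. Rh (t, y))) x = dx i (dx i Rh) (t, x)" for i
      using dd_cong[OF Y pR] dd_slice[OF Cinf_on_differentiable[OF Cinf_on_dd[OF N(3)] N(2)]] by simp
    have pS2: "pdx i (pdx i (\<lambda>y. Sh (t, y) + c t)) x = dx i (dx i Sh) (t, x)" for i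
      using dd_cong[OF Y pS] dd_slice[OF Cinf_on_differentiable[OF Cinf_on_dd[OF N(4)] N(2)]] by simp
    have \<Psi>Y: "?\<Psi> t y = exp ((cpx (Rh (t, y)) (Sh (t, y) + c t)) / of_real K)" if "y \<in> Y" for y
      using \<Psi>[of t y] that t by (simp add: Y_def)
    have space: "laplacian (?\<Psi> t) x = (\<Sum>i\<in>UNIV. ?\<Psi> t x * ((cpx (dx i Rh (t, x)) (dx i Sh (t, x))) / of_real K)
          * ((cpx (dx i Rh (t, x)) (dx i Sh (t, x))) / of_real K)
        + ?\<Psi> t x * ((cpx (dx i (dx i Rh) (t, x)) (dx i (dx i Sh) (t, x))) / of_real K))"
      using wave_laplacian[where f = "?\<Psi> t" and K = K, OF Y CR CS \<Psi>Y] unfolding pR[OF Y(2)] pS[OF Y(2)] pR2 pS2 by blast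
    \<comment> \<open>With K = sigma^2 all coefficients become powers of K, the form in which
      \<open>schrodinger_algebra\<close> applies.\<close>
    have K2: "\<sigma> ^ 4 = K\<^sup>2" using assms(6) by simp
    have "\<gamma> t = dt Sh (t, x) + (\<Sum>i\<in>UNIV. (1/2) * (dx i Sh (t, x) * dx i Sh (t, x) - dx i Rh (t, x) * dx i Rh (t, x)) - (K / 2) * dx i (dx i Rh) (t, x)) + U x"
      using bern by (simp add: bernoulli_def assms(6))
    from schrodinger_algebra[OF K(1) cont[folded assms(6)] this]
    show ?thesis unfolding schrodinger_at_def space time K2 assms(6)[symmetric] .
  qed
  have "wave_function K R S t x * cnj (wave_function K R S t x) = of_real (p t x)" if t: "t \<in> {0<..1}" for t x
  proof -
    \<comment> \<open>The phase S cancels against its conjugate, so the density formula is the same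
      for S and for S + c.\<close>
    have "wave_function K R S t x * cnj (wave_function K R S t x) = exp (of_real (2 * R t x / K))"
      unfolding wave_function_def exp_cnj mult_exp_exp
      by (rule arg_cong[where f = exp]) (simp add: add_divide_distrib[symmetric])
    also have "\<dots> = of_real (exp (2 * R t x / K))" by (rule exp_of_real)
    also have "2 * R t x / K = ln (p t x)" unfolding Rln[OF t] assms(6) using K(2) by simp
    finally show ?thesis using pde(1)[OF t] by simp
  qed
  then show ?thesis using c(1) wp schr by (intro conjI exI[of _ c]) (auto simp: Theta)
qed

end
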